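(* For every integer $k\ge 2$, it is NP-hard to decide whether a digraph $D=(V,E)$ is $k$-colorable, even when $D$ has a (directed) feedback vertex set of size $k$. Furthermore, this problem cannot be solved in time $2^{o(n)}$, where $n=|V|$, unless the Exponential Time Hypothesis is false.
   Context: Digraphs are loopless and have no parallel arcs, but two oppositely oriented arcs between the same pair of vertices (a digon) are allowed. A digraph $D$ is $k$-colorable if its vertices can be colored with $k$ colors so that each color class induces an acyclic subdigraph (no monochromatic directed cycle). A feedback vertex set of $D$ is a set $S\subseteq V$ such that $D-S$ is acyclic. The Exponential Time Hypothesis is used in the form: \textsc{3-SAT} with $n$ variables and $m$ clauses cannot be solved in time $2^{o(n+m)}$. *)

theory Defs
  imports
    "Graph_Theory.Graph_Theory"
    "HOL-Computational_Algebra.Polynomial"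
    "HOL-Library.Landau_Symbols"
begin

section \<open>Digraph colouring\<close>

definition acyclic_digraph :: "('a, 'b) pre_digraph \<Rightarrow> bool" where
  "acyclic_digraph D \<longleftrightarrow> \<not> (\<exists>p. pre_digraph.cycle D p)"

definition k_colorable :: "nat \<Rightarrow> ('a, 'b) pre_digraph \<Rightarrow> bool" where
  "k_colorable k D \<longleftrightarrow>
     (\<exists>c :: 'a \<Rightarrow> nat. c ` verts D \<subseteq> {..<k} \<and>
        (\<forall>i<k. acyclic_digraph (D \<restriction> {v \<in> verts D. c v = i})))"

definition feedback_vertex_set :: "('a, 'b) pre_digraph \<Rightarrow> 'a set \<Rightarrow> bool" where
  "feedback_vertex_set D S \<longleftrightarrow> S \<subseteq> verts D \<and> acyclic_digraph (D \<restriction> (verts D - S))"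


section \<open>Deterministic multi-tape Turing machines\<close>

text \<open>
  States and tape symbols are natural numbers below the bounds stored in the machine. Symbol 0 is
  the blank, 1 and 2 are the input bits and 3 separates the two parts of a verifier's input.
  Tapes are infinite in both directions. Tape 0 (the head of the tape list) holds the
  input and, for machines computing a function, the output.
\<close>

datatype move = Left | Stay | Right

record tm =
  tm_tapes :: nat
  tm_states :: nat
  tm_symbols :: nat
  tm_start :: nat
  tm_accept :: nat
  tm_reject :: nat
  tm_delta :: "nat \<Rightarrow> nat list \<Rightarrow> nat \<times> (nat \<times> move) list"

definition wf_tm :: "tm \<Rightarrow> bool" where
  "wf_tm M \<longleftrightarrow>
     1 \<le> tm_tapes M \<and> 4 \<le> tm_symbols M \<and>
     tm_start M < tm_states M \<and> tm_accept M < tm_states M \<and> tm_reject M < tm_states M \<and>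
     tm_accept M \<noteq> tm_reject M \<and>
     (\<forall>q rs. q < tm_states M \<and> length rs = tm_tapes M \<and> set rs \<subseteq> {..<tm_symbols M} \<longrightarrow>
        (case tm_delta M q rs of (q', as) \<Rightarrow>
           q' < tm_states M \<and> length as = tm_tapes M \<and> fst ` set as \<subseteq> {..<tm_symbols M}))"

text \<open>Tape contents together with the head position.\<close>
type_synonym tape = "(int \<Rightarrow> nat) \<times> int"

type_synonym config = "nat \<times> tape list"

fun move_offset :: "move \<Rightarrow> int" where
  "move_offset Left = -1"
| "move_offset Stay = 0"
| "move_offset Right = 1"

fun read_tape :: "tape \<Rightarrow> nat" where
  "read_tape (c, h) = c h"

fun act_tape :: "nat \<times> move \<Rightarrow> tape \<Rightarrow> tape" where
  "act_tape (s, d) (c, h) = (c(h := s), h + move_offset d)"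

definition halted :: "tm \<Rightarrow> config \<Rightarrow> bool" where
  "halted M c \<longleftrightarrow> fst c \<in> {tm_accept M, tm_reject M}"

definition tm_step :: "tm \<Rightarrow> config \<Rightarrow> config" where
  "tm_step M c =
     (if halted M c then c
      else case tm_delta M (fst c) (map read_tape (snd c)) of
        (q', as) \<Rightarrow> (q', map2 act_tape as (snd c)))"

definition word_tape :: "nat list \<Rightarrow> tape" where
  "word_tape w = (\<lambda>i. if 0 \<le> i \<and> i < int (length w) then w ! nat i else 0, 0)"

definition tm_init :: "tm \<Rightarrow> nat list \<Rightarrow> config" where
  "tm_init M w = (tm_start M, word_tape w # replicate (tm_tapes M - 1) (word_tape []))"

text \<open>The configuration after \<open>t\<close> steps; halted configurations are fixed points of \<open>tm_step\<close>.\<close>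
definition tm_run :: "tm \<Rightarrow> nat list \<Rightarrow> nat \<Rightarrow> config" where
  "tm_run M w t = (tm_step M ^^ t) (tm_init M w)"

definition bits :: "bool list \<Rightarrow> nat list" where
  "bits x = map (\<lambda>b. if b then 2 else 1) x"

definition pair_word :: "bool list \<Rightarrow> bool list \<Rightarrow> nat list" where
  "pair_word x y = bits x @ [3] @ bits y"


section \<open>Complexity\<close>

definition poly_time_computable :: "(bool list \<Rightarrow> bool list) \<Rightarrow> bool" where
  "poly_time_computable f \<longleftrightarrow>
     (\<exists>M (p :: nat poly). wf_tm M \<and>
        (\<forall>x. let c = tm_run M (bits x) (poly p (length x)) in
           halted M c \<and> hd (snd c) = word_tape (bits (f x))))"

definition NP :: "bool list set set" where
  "NP = {L. \<exists>M (p :: nat poly) (q :: nat poly). wf_tm M \<and>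
     (\<forall>x y. halted M (tm_run M (pair_word x y) (poly p (length x + length y)))) \<and>
     (\<forall>x. x \<in> L \<longleftrightarrow>
        (\<exists>y. length y \<le> poly q (length x) \<and>
           fst (tm_run M (pair_word x y) (poly p (length x + length y))) = tm_accept M))}"

text \<open>
  A decision problem consists of an encoding \<open>enc\<close>, a set \<open>I\<close> of admissible instances and a
  property \<open>P\<close> to be decided. Restricting \<open>I\<close> expresses hardness \<open>even when\<close> the
  instances satisfy the restriction: a reduction must produce instances from \<open>I\<close>, and an
  algorithm need only be correct and fast on \<open>I\<close>.
\<close>

definition NP_hard :: "('i \<Rightarrow> bool list) \<Rightarrow> 'i set \<Rightarrow> ('i \<Rightarrow> bool) \<Rightarrow> bool" where
  "NP_hard enc I P \<longleftrightarrow>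
     (\<forall>L\<in>NP. \<exists>f. poly_time_computable f \<and>
        (\<forall>x. \<exists>d\<in>I. f x = enc d \<and> (x \<in> L \<longleftrightarrow> P d)))"

definition solvable_in_time ::
  "('i \<Rightarrow> bool list) \<Rightarrow> 'i set \<Rightarrow> ('i \<Rightarrow> bool) \<Rightarrow> ('i \<Rightarrow> real) \<Rightarrow> bool" where
  "solvable_in_time enc I P T \<longleftrightarrow>
     (\<exists>M. wf_tm M \<and>
        (\<forall>d\<in>I. \<exists>t. real t \<le> T d \<and> halted M (tm_run M (bits (enc d)) t) \<and>
           (fst (tm_run M (bits (enc d)) t) = tm_accept M \<longleftrightarrow> P d)))"

text \<open>Solvable in time \<open>2\<^bsup>o(s)\<^esup>\<close>, where \<open>s\<close> is the size parameter of the instance.\<close>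
definition solvable_subexp ::
  "('i \<Rightarrow> bool list) \<Rightarrow> 'i set \<Rightarrow> ('i \<Rightarrow> bool) \<Rightarrow> ('i \<Rightarrow> nat) \<Rightarrow> bool" where
  "solvable_subexp enc I P s \<longleftrightarrow>
     (\<exists>f :: nat \<Rightarrow> real. f \<in> o(\<lambda>n. real n) \<and>
        solvable_in_time enc I P (\<lambda>d. 2 powr f (s d)))"


section \<open>3-SAT and the Exponential Time Hypothesis\<close>

text \<open>
  A literal is a variable with the truth value that satisfies it. A formula is the number \<open>n\<close>
  of its variables, which are \<open>0, \<dots>, n - 1\<close>, together with its list of clauses.
\<close>

type_synonym literal = "nat \<times> bool"
type_synonym cnf = "nat \<times> literal list list"

definition three_cnf :: "cnf set" where
  "three_cnf = {(n, cs). \<forall>C\<in>set cs. length C \<le> 3 \<and> fst ` set C \<subseteq> {..<n}}"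

definition satisfiable :: "cnf \<Rightarrow> bool" where
  "satisfiable \<phi> \<longleftrightarrow> (\<exists>\<sigma> :: nat \<Rightarrow> bool. \<forall>C\<in>set (snd \<phi>). \<exists>(v, b)\<in>set C. \<sigma> v = b)"

definition cnf_size :: "cnf \<Rightarrow> nat" where
  "cnf_size \<phi> = fst \<phi> + length (snd \<phi>)"

text \<open>
  Variables are written in unary. On \<open>three_cnf\<close> the length of the encoding is still
  polynomial in \<open>n + m\<close>, so this affects neither polynomial time nor time \<open>2\<^bsup>o(n+m)\<^esup>\<close>.
\<close>

fun encode_literal :: "literal \<Rightarrow> bool list" where
  "encode_literal (v, b) = [True, b] @ replicate v True @ [False]"

definition encode_clause :: "literal list \<Rightarrow> bool list" where
  "encode_clause C = concat (map encode_literal C) @ [False]"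

fun encode_cnf :: "cnf \<Rightarrow> bool list" where
  "encode_cnf (n, cs) = replicate n True @ [False] @ concat (map encode_clause cs)"

lemma replicate_True_False_eq:
  "replicate m True @ False # xs = replicate n True @ False # ys \<longleftrightarrow> m = n \<and> xs = ys"
proof (induction m arbitrary: n)
  case 0 then show ?case by (cases n) auto
next
  case (Suc m) then show ?case by (cases n) auto
qed

lemma encode_clause_append_eq:
  "encode_clause C @ xs = encode_clause C' @ ys \<longleftrightarrow> C = C' \<and> xs = ys"
proof (induction C arbitrary: C')
  case Nil then show ?case by (cases C') (auto simp: encode_clause_def)
next
  case (Cons l C)
  show ?case
  proof (cases C')
    case Nil then show ?thesis by (cases l) (auto simp: encode_clause_def)
  next
    case (Cons l' D)
    with Cons.IH[of D] show ?thesis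
      by (cases l; cases l') (auto simp: encode_clause_def replicate_True_False_eq)
  qed
qed

lemma inj_encode_cnf: "inj encode_cnf"
proof -
  have ne: "encode_clause C \<noteq> []" for C by (simp add: encode_clause_def)
  have "concat (map encode_clause cs) = concat (map encode_clause ds) \<Longrightarrow> cs = ds" for cs ds
  proof (induction cs arbitrary: ds)
    case Nil then show ?case by (cases ds) (auto simp: ne)
  next
    case (Cons C cs) then show ?case by (cases ds) (auto simp: ne encode_clause_append_eq)
  qed
  then show ?thesis by (auto intro!: injI simp: replicate_True_False_eq)
qed

definition ETH :: bool where
  "ETH \<longleftrightarrow> \<not> solvable_subexp encode_cnf three_cnf satisfiable cnf_size"


section \<open>Digraphs as problem instances\<close>

text \<open>Finite loopless digraphs without parallel arcs on the vertices \<open>0, \<dots>, n - 1\<close>.\<close>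
definition digraph_instances :: "nat pair_pre_digraph set" where
  "digraph_instances = {D. pair_digraph D \<and> pverts D = {..<card (pverts D)}}"

text \<open>The number of vertices in unary, followed by the rows of the adjacency matrix.\<close>
definition encode_digraph :: "nat pair_pre_digraph \<Rightarrow> bool list" where
  "encode_digraph D =
     (let n = card (pverts D)
      in replicate n True @ [False] @
         concat (map (\<lambda>u. map (\<lambda>v. (u, v) \<in> parcs D) [0..<n]) [0..<n]))"

lemma concat_map_upt_eq:
  fixes a b :: "nat \<Rightarrow> 'a list"
  assumes "concat (map a [0..<m]) = concat (map b [0..<m])"
    and "\<And>u. length (a u) = length (b u)" and "u < m"
  shows "a u = b u"
  using assms(1,3)
proof (induction m)
  case (Suc m)
  have "length (concat (map a [0..<m])) = length (concat (map b [0..<m]))"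
    by (simp add: length_concat o_def assms(2))
  with Suc show ?case by (auto simp: less_Suc_eq)
qed simp

lemma inj_on_encode_digraph: "inj_on encode_digraph digraph_instances"
proof (rule inj_onI)
  fix D E assume D: "D \<in> digraph_instances" and E: "E \<in> digraph_instances"
    and eq: "encode_digraph D = encode_digraph E"
  define n where "n = card (pverts D)"
  from eq have n: "card (pverts E) = n"
    and m: "concat (map (\<lambda>u. map (\<lambda>v. (u, v) \<in> parcs D) [0..<n]) [0..<n]) =
            concat (map (\<lambda>u. map (\<lambda>v. (u, v) \<in> parcs E) [0..<n]) [0..<n])"
    by (auto simp: encode_digraph_def Let_def n_def replicate_True_False_eq)
  have V: "pverts D = {..<n}" "pverts E = {..<n}"
    using D E n by (auto simp: digraph_instances_def n_def)
  have sub: "parcs D \<subseteq> {..<n} \<times> {..<n}" "parcs E \<subseteq> {..<n} \<times> {..<n}"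
    using D E V unfolding digraph_instances_def pair_digraph_def pair_fin_digraph_def
      pair_wf_digraph_def by fastforce+
  have iff: "(u, v) \<in> parcs D \<longleftrightarrow> (u, v) \<in> parcs E" if "u < n" "v < n" for u v
    using concat_map_upt_eq[OF m _ \<open>u < n\<close>] \<open>v < n\<close> by (simp add: map_eq_conv)
  have "parcs D = parcs E"
    using sub iff by blast
  with V show "D = E" by simp
qed

definition digraphs_with_fvs :: "nat \<Rightarrow> nat pair_pre_digraph set" where
  "digraphs_with_fvs k =
     {D \<in> digraph_instances. \<exists>S. feedback_vertex_set (with_proj D) S \<and> card S = k}"

end

theory Submission
  imports Defs "HOL-Library.Countable" "HOL-Real_Asymp.Real_Asymp"
begin

text \<open>
  A CNF formula becomes a digraph as follows. Special vertices \<open>0, \<dots>, k - 1\<close> are pairwise joined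
  by digons, so they carry all \<open>k\<close> colors; those numbered 2 and higher are joined by digons to all
  vertices, so every other vertex has the color of vertex 0 (false) or vertex 1 (true). A
  clause is a directed cycle through vertex 0, its literal occurrences and an end vertex that is
  forced to be false; it is not monochromatic iff some occurrence is true. Triangles through the
  vertices 0 and 1 make an occurrence that is colored true agree with the vertices of its variable.
  Removing the special vertices leaves only arcs that respect a linear order, and there are
  \<open>O(n + m)\<close> vertices.

  Hardness for NP follows by the Cook-Levin theorem. Its formula is Horn apart from
  the clauses that guess the certificate: it only propagates true facts about the computation
  forwards, so that no uniqueness conditions on the tableau are needed.

  Both reductions run in polynomial time on Turing machines because their output can be described
  by expressions made of bounded loops, arithmetic and runs of finite automata over the input. Every
  such expression is compiled to a multi-tape machine that represents counters by head positions.
\<close>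


section \<open>Runs of Turing machines\<close>

definition stay :: "nat \<Rightarrow> nat \<times> move" where
  "stay s = (s, Stay)"

lemma fst_stay [simp]: "fst (stay s) = s"
  by (simp add: stay_def)

lemma act_stay [simp]: "act_tape (stay (read_tape T)) T = T"
  by (cases T) (simp add: stay_def)

lemma map2_act_stay [simp]: "map2 act_tape (map stay (map read_tape ts)) ts = ts"
  by (induction ts) auto

lemma read_tape_eq: "read_tape T = fst T (snd T)"
  by (cases T) simp

lemma act_tape_eq: "act_tape a T = ((fst T)(snd T := fst a), snd T + move_offset (snd a))"
  by (cases a; cases T) simp

definition wf_config :: "tm \<Rightarrow> config \<Rightarrow> bool" where
  "wf_config M c \<longleftrightarrow> fst c < tm_states M \<and> length (snd c) = tm_tapes M \<and>
     (\<forall>T\<in>set (snd c). \<forall>i. fst T i < tm_symbols M)"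

lemma wf_config_read: "wf_config M c \<Longrightarrow> set (map read_tape (snd c)) \<subseteq> {..<tm_symbols M}"
  by (auto simp: wf_config_def read_tape_eq)

lemma wf_tm_delta:
  assumes "wf_tm M" "q < tm_states M" "length rs = tm_tapes M" "set rs \<subseteq> {..<tm_symbols M}"
    and "tm_delta M q rs = (q', as)"
  shows "q' < tm_states M" "length as = tm_tapes M" "fst ` set as \<subseteq> {..<tm_symbols M}"
proof -
  have "q < tm_states M \<and> length rs = tm_tapes M \<and> set rs \<subseteq> {..<tm_symbols M} \<longrightarrow>
      (case tm_delta M q rs of (q', as) \<Rightarrow>
      q' < tm_states M \<and> length as = tm_tapes M \<and> fst ` set as \<subseteq> {..<tm_symbols M})"
    using assms(1) unfolding wf_tm_def by (elim conjE) (erule allE, erule allE)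
  then show "q' < tm_states M" "length as = tm_tapes M" "fst ` set as \<subseteq> {..<tm_symbols M}"
    using assms(2-5) by simp_all
qed

lemma wf_config_step:
  assumes wf_M: "wf_tm M" and wf: "wf_config M c"
  shows "wf_config M (tm_step M c)"
proof (cases "halted M c")
  case True
  then show ?thesis using wf by (simp add: tm_step_def)
next
  case False
  obtain q' as where delta: "tm_delta M (fst c) (map read_tape (snd c)) = (q', as)"
    by fastforce
  have len: "length (snd c) = tm_tapes M" and state: "fst c < tm_states M"
    using wf by (auto simp: wf_config_def)
  note wf_as = wf_tm_delta[OF wf_M state _ wf_config_read[OF wf] delta]
  have "fst T i < tm_symbols M" if "T \<in> set (map2 act_tape as (snd c))" for T i
  proof -
    obtain a U where acted: "(a, U) \<in> set (zip as (snd c))" "T = act_tape a U"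
      using \<open>T \<in> _\<close> by auto
    then have "fst a < tm_symbols M" "\<forall>i. fst U i < tm_symbols M"
      using wf_as(3) len wf set_zip_leftD[OF acted(1)] set_zip_rightD[OF acted(1)]
      by (auto simp: wf_config_def)
    then show ?thesis using acted(2) by (simp add: act_tape_eq)
  qed
  then show ?thesis
    using False delta wf_as len by (simp add: tm_step_def wf_config_def)
qed

lemma wf_config_init:
  assumes "wf_tm M" "set w \<subseteq> {..<tm_symbols M}"
  shows "wf_config M (tm_init M w)"
proof -
  have "fst T i < tm_symbols M" if "T \<in> set (snd (tm_init M w))" for T i
    using that assms by (auto simp: tm_init_def word_tape_def wf_tm_def nth_mem subset_iff)
  then show ?thesis using assms by (auto simp: wf_config_def tm_init_def wf_tm_def)
qed

lemma tm_run_0 [simp]: "tm_run M w 0 = tm_init M w"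
  by (simp add: tm_run_def)

lemma tm_run_Suc: "tm_run M w (Suc t) = tm_step M (tm_run M w t)"
  by (simp add: tm_run_def)

lemma wf_config_run:
  "wf_tm M \<Longrightarrow> set w \<subseteq> {..<tm_symbols M} \<Longrightarrow> wf_config M (tm_run M w t)"
  by (induction t) (auto simp: tm_run_Suc wf_config_init wf_config_step)

lemma tm_step_halted: "halted M c \<Longrightarrow> tm_step M c = c"
  by (simp add: tm_step_def)

lemma tm_run_halted_le:
  assumes "halted M (tm_run M w t)" "t \<le> u"
  shows "tm_run M w u = tm_run M w t"
  using assms(2) by (induction rule: dec_induct) (simp_all add: tm_run_Suc tm_step_halted assms(1))

lemma set_bits: "set (bits x) \<subseteq> {1, 2}"
  by (auto simp: bits_def)

lemma set_bits_symbols: "wf_tm M \<Longrightarrow> set (bits x) \<subseteq> {..<tm_symbols M}"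
  using set_bits[of x] by (auto simp: wf_tm_def)

lemma length_bits [simp]: "length (bits x) = length x"
  by (simp add: bits_def)

lemma tm_run_tapes_bounded:
  "\<forall>T\<in>set (snd (tm_run M w t)). snd T \<le> int t \<and> (\<forall>i\<ge>int (length w + t). fst T i = 0)"
proof (induction t)
  case 0
  show ?case by (auto simp: tm_init_def word_tape_def)
next
  case (Suc t)
  let ?c = "tm_run M w t"
  show ?case
  proof (cases "halted M ?c")
    case True
    then show ?thesis using Suc by (force simp: tm_run_Suc tm_step_halted)
  next
    case False
    then have "\<exists>as. snd (tm_run M w (Suc t)) = map2 act_tape as (snd ?c)"
      by (auto simp: tm_run_Suc tm_step_def case_prod_beta)
    then obtain as where step: "snd (tm_run M w (Suc t)) = map2 act_tape as (snd ?c)" ..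
    show ?thesis
      unfolding step
    proof
      fix T assume "T \<in> set (map2 act_tape as (snd ?c))"
      then obtain a U where acted: "T = act_tape a U" and tape: "U \<in> set (snd ?c)"
        by (auto dest: set_zip_rightD)
      have "move_offset (snd a) \<le> 1" by (cases "snd a") auto
      then show "snd T \<le> int (Suc t) \<and> (\<forall>i\<ge>int (length w + Suc t). fst T i = 0)"
        using Suc tape by (fastforce simp: acted act_tape_eq)
    qed
  qed
qed

lemma length_tm_output_le:
  assumes "wf_tm M" and out: "hd (snd (tm_run M (bits x) t)) = word_tape (bits y)"
  shows "length y \<le> length x + t"
proof (cases "length y")
  case (Suc n)
  have "snd (tm_run M (bits x) t) \<noteq> []"
    using wf_config_run[OF assms(1) set_bits_symbols[OF assms(1)]] assms(1)
    by (metis list.size(3) not_one_le_zero wf_config_def wf_tm_def)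
  then have "word_tape (bits y) \<in> set (snd (tm_run M (bits x) t))"
    using out by (metis list.set_sel(1))
  then have blank: "fst (word_tape (bits y)) i = 0" if "int (length x + t) \<le> i" for i
    using tm_run_tapes_bounded that by fastforce
  have "fst (word_tape (bits y)) (int n) \<noteq> 0"
    using Suc by (simp add: word_tape_def bits_def)
  then have "\<not> length x + t \<le> n" using blank[of "int n"] by auto
  then show ?thesis using Suc by simp
qed simp


section \<open>Sequential composition of machines\<close>

text \<open>
  A composition has the larger of the two alphabets, so each machine can read symbols that are
  foreign to it.
\<close>
definition safe_delta :: "tm \<Rightarrow> nat \<Rightarrow> nat list \<Rightarrow> nat \<times> (nat \<times> move) list" where
  "safe_delta M q rs =
     (if set rs \<subseteq> {..<tm_symbols M} then tm_delta M q rs else (q, map stay rs))"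

lemma safe_delta_eq: "set rs \<subseteq> {..<tm_symbols M} \<Longrightarrow> safe_delta M q rs = tm_delta M q rs"
  by (simp add: safe_delta_def)

lemma wf_safe_delta:
  assumes wf_M: "wf_tm M" "q < tm_states M" "length rs = tm_tapes M"
    and rs: "set rs \<subseteq> {..<G}" and symbols_le: "tm_symbols M \<le> G"
    and delta: "safe_delta M q rs = (q', as)"
  shows "q' < tm_states M" "length as = tm_tapes M" "fst ` set as \<subseteq> {..<G}"
proof -
  have "q' < tm_states M \<and> length as = tm_tapes M \<and> fst ` set as \<subseteq> {..<G}"
  proof (cases "set rs \<subseteq> {..<tm_symbols M}")
    case True
    then have "tm_delta M q rs = (q', as)" using delta by (simp add: safe_delta_eq)
    from wf_tm_delta[OF wf_M True this] symbols_le show ?thesis by auto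
  next
    case False
    then show ?thesis using delta wf_M rs by (auto simp: safe_delta_def stay_def)
  qed
  then show "q' < tm_states M" "length as = tm_tapes M" "fst ` set as \<subseteq> {..<G}" by auto
qed

text \<open>
  Tape 0 is shared; it is followed by the remaining tapes of the first and then those of the
  second machine, which stay blank during the first phase.
\<close>
definition compose_delta :: "tm \<Rightarrow> tm \<Rightarrow> nat \<Rightarrow> nat list \<Rightarrow> nat \<times> (nat \<times> move) list" where
  "compose_delta M1 M2 q rs =
     (if q < tm_states M1 then
        if q \<in> {tm_accept M1, tm_reject M1} then (tm_states M1 + tm_start M2, map stay rs)
        else case safe_delta M1 q (take (tm_tapes M1) rs) of (q', as) \<Rightarrow>
          (q', as @ map stay (drop (tm_tapes M1) rs))
      else case safe_delta M2 (q - tm_states M1) (hd rs # drop (tm_tapes M1) rs) of (q', as) \<Rightarrow>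
        (tm_states M1 + q', hd as # map stay (take (tm_tapes M1 - 1) (tl rs)) @ tl as))"

definition compose_tm :: "tm \<Rightarrow> tm \<Rightarrow> tm" where
  "compose_tm M1 M2 = \<lparr>
     tm_tapes = tm_tapes M1 + (tm_tapes M2 - 1),
     tm_states = tm_states M1 + tm_states M2,
     tm_symbols = max (tm_symbols M1) (tm_symbols M2),
     tm_start = tm_start M1,
     tm_accept = tm_states M1 + tm_accept M2,
     tm_reject = tm_states M1 + tm_reject M2,
     tm_delta = compose_delta M1 M2 \<rparr>"

lemma compose_tm_simps [simp]:
  "tm_tapes (compose_tm M1 M2) = tm_tapes M1 + (tm_tapes M2 - 1)"
  "tm_states (compose_tm M1 M2) = tm_states M1 + tm_states M2"
  "tm_symbols (compose_tm M1 M2) = max (tm_symbols M1) (tm_symbols M2)"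
  "tm_start (compose_tm M1 M2) = tm_start M1"
  "tm_accept (compose_tm M1 M2) = tm_states M1 + tm_accept M2"
  "tm_reject (compose_tm M1 M2) = tm_states M1 + tm_reject M2"
  "tm_delta (compose_tm M1 M2) = compose_delta M1 M2"
  by (simp_all add: compose_tm_def)

lemma wf_compose_delta_first:
  assumes wf_M1: "wf_tm M1" and wf_M2: "wf_tm M2" and state: "q < tm_states M1"
    and len: "length rs = tm_tapes M1 + (tm_tapes M2 - 1)" and rs: "set rs \<subseteq> {..<G}"
    and symbols_le: "tm_symbols M1 \<le> G"
  shows "case compose_delta M1 M2 q rs of (q', as) \<Rightarrow> q' < tm_states M1 + tm_states M2 \<and>
    length as = tm_tapes M1 + (tm_tapes M2 - 1) \<and> fst ` set as \<subseteq> {..<G}"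
proof (cases "q \<in> {tm_accept M1, tm_reject M1}")
  case True
  then show ?thesis using state len rs wf_M2 by (auto simp: compose_delta_def wf_tm_def)
next
  case False
  obtain q' as where delta: "safe_delta M1 q (take (tm_tapes M1) rs) = (q', as)"
    by fastforce
  have take: "set (take (tm_tapes M1) rs) \<subseteq> {..<G}" and drop: "set (drop (tm_tapes M1) rs) \<subseteq> {..<G}"
    using rs by (auto dest: in_set_takeD in_set_dropD)
  have "q' < tm_states M1" "length as = tm_tapes M1" "fst ` set as \<subseteq> {..<G}"
    using wf_safe_delta[OF wf_M1 state _ take symbols_le delta] len by auto
  then show ?thesis
    using False state delta len drop by (auto simp: compose_delta_def image_Un)
qed

lemma wf_compose_delta_second:
  assumes wf_M1: "wf_tm M1" and wf_M2: "wf_tm M2"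
    and state: "\<not> q < tm_states M1" "q < tm_states M1 + tm_states M2"
    and len: "length rs = tm_tapes M1 + (tm_tapes M2 - 1)" and rs: "set rs \<subseteq> {..<G}"
    and symbols_le: "tm_symbols M2 \<le> G"
  shows "case compose_delta M1 M2 q rs of (q', as) \<Rightarrow> q' < tm_states M1 + tm_states M2 \<and>
    length as = tm_tapes M1 + (tm_tapes M2 - 1) \<and> fst ` set as \<subseteq> {..<G}"
proof -
  have tapes: "1 \<le> tm_tapes M1" "1 \<le> tm_tapes M2" using wf_M1 wf_M2 by (auto simp: wf_tm_def)
  then obtain r rs' where cons: "rs = r # rs'" using len by (cases rs) auto
  obtain q' as
    where delta: "safe_delta M2 (q - tm_states M1) (hd rs # drop (tm_tapes M1) rs) = (q', as)"
    by fastforce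
  have "set (hd rs # drop (tm_tapes M1) rs) \<subseteq> {..<G}"
    using rs set_drop_subset[of "tm_tapes M1" rs] by (auto simp: cons)
  then have wf: "q' < tm_states M2" "length as = tm_tapes M2" "fst ` set as \<subseteq> {..<G}"
    using wf_safe_delta[OF wf_M2 _ _ _ symbols_le delta] state len tapes by auto
  then obtain a as' where as: "as = a # as'" using tapes by (cases as) auto
  have "set (take (tm_tapes M1 - 1) rs') \<subseteq> {..<G}"
    using rs set_take_subset[of "tm_tapes M1 - 1" rs'] by (auto simp: cons)
  then show ?thesis
    using state(1) wf delta tapes len by (auto simp: compose_delta_def as cons image_Un)
qed

lemma wf_compose_tm:
  assumes wf_M1: "wf_tm M1" and wf_M2: "wf_tm M2"
  shows "wf_tm (compose_tm M1 M2)"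
proof -
  have "case compose_delta M1 M2 q rs of (q', as) \<Rightarrow> q' < tm_states M1 + tm_states M2 \<and>
      length as = tm_tapes M1 + (tm_tapes M2 - 1) \<and>
      fst ` set as \<subseteq> {..<max (tm_symbols M1) (tm_symbols M2)}"
    if "q < tm_states M1 + tm_states M2" "length rs = tm_tapes M1 + (tm_tapes M2 - 1)"
      "set rs \<subseteq> {..<max (tm_symbols M1) (tm_symbols M2)}" for q rs
    using wf_compose_delta_first[OF wf_M1 wf_M2] wf_compose_delta_second[OF wf_M1 wf_M2] that
    by (cases "q < tm_states M1") simp_all
  moreover have "1 \<le> tm_tapes M1" "4 \<le> tm_symbols M1" "tm_start M1 < tm_states M1"
    "tm_accept M2 < tm_states M2" "tm_reject M2 < tm_states M2" "tm_accept M2 \<noteq> tm_reject M2"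
    using wf_M1 wf_M2 by (auto simp: wf_tm_def)
  ultimately show ?thesis by (simp add: wf_tm_def)
qed

lemma compose_tm_step_first:
  assumes wf_M1: "wf_tm M1" and wf: "wf_config M1 (q, ts)" and running: "\<not> halted M1 (q, ts)"
  shows "tm_step (compose_tm M1 M2) (q, ts @ bs) =
    (fst (tm_step M1 (q, ts)), snd (tm_step M1 (q, ts)) @ bs)"
proof -
  have len: "length ts = tm_tapes M1" and state: "q < tm_states M1"
    using wf by (auto simp: wf_config_def)
  have symbols: "set (map read_tape ts) \<subseteq> {..<tm_symbols M1}" using wf_config_read[OF wf] by simp
  obtain q' as where delta: "tm_delta M1 q (map read_tape ts) = (q', as)" by fastforce
  have len_as: "length as = length ts" using wf_tm_delta[OF wf_M1 state _ symbols delta] len by simp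
  have "\<not> halted (compose_tm M1 M2) (q, ts @ bs)"
    using state by (auto simp: halted_def)
  moreover have "compose_delta M1 M2 q (map read_tape (ts @ bs)) =
      (q', as @ map stay (map read_tape bs))"
    using running state delta len safe_delta_eq[OF symbols]
    by (simp add: compose_delta_def halted_def del: map_map)
  ultimately show ?thesis
    using running delta len_as by (simp add: tm_step_def del: map_map)
qed

lemma compose_tm_step_switch:
  assumes wf: "wf_config M1 (q, ts)" and halted: "halted M1 (q, ts)"
  shows "tm_step (compose_tm M1 M2) (q, ts @ bs) = (tm_states M1 + tm_start M2, ts @ bs)"
proof -
  have state: "q < tm_states M1" using wf by (auto simp: wf_config_def)
  then have "\<not> halted (compose_tm M1 M2) (q, ts @ bs)" by (auto simp: halted_def)
  moreover have "compose_delta M1 M2 q (map read_tape (ts @ bs)) =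
      (tm_states M1 + tm_start M2, map stay (map read_tape (ts @ bs)))"
    using halted state by (auto simp: compose_delta_def halted_def)
  ultimately show ?thesis
    by (simp add: tm_step_def del: map_map map_append)
qed

lemma compose_tm_step_second:
  assumes wf_M2: "wf_tm M2" and wf: "wf_config M2 (q, T # ts)"
    and running: "\<not> halted M2 (q, T # ts)"
    and idle: "length ms = tm_tapes M1 - 1" "1 \<le> tm_tapes M1"
    and step: "tm_step M2 (q, T # ts) = (q', T' # ts')"
  shows "tm_step (compose_tm M1 M2) (tm_states M1 + q, T # ms @ ts) =
    (tm_states M1 + q', T' # ms @ ts')"
proof -
  have len: "Suc (length ts) = tm_tapes M2" and state: "q < tm_states M2"
    using wf by (auto simp: wf_config_def)
  have symbols: "set (map read_tape (T # ts)) \<subseteq> {..<tm_symbols M2}"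
    using wf_config_read[OF wf] by simp
  obtain q'' as where delta: "tm_delta M2 q (map read_tape (T # ts)) = (q'', as)" by fastforce
  have "length as = Suc (length ts)" using wf_tm_delta[OF wf_M2 state _ symbols delta] len by simp
  then obtain a as' where as: "as = a # as'" "length as' = length ts" by (cases as) auto
  have results: "q'' = q'" "T' = act_tape a T" "ts' = map2 act_tape as' ts"
    using step running delta as by (auto simp: tm_step_def)
  have "\<not> halted (compose_tm M1 M2) (tm_states M1 + q, T # ms @ ts)"
    using running by (auto simp: halted_def)
  moreover have "drop (tm_tapes M1) (map read_tape (T # ms @ ts)) = map read_tape ts"
    using idle by (cases "tm_tapes M1") auto
  then have "compose_delta M1 M2 (tm_states M1 + q) (map read_tape (T # ms @ ts)) =
      (tm_states M1 + q', a # map stay (map read_tape ms) @ as')"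
    using delta as idle results safe_delta_eq[OF symbols] by (simp add: compose_delta_def)
  ultimately show ?thesis
    using results as by (simp add: tm_step_def del: map_map)
qed

lemma compose_tm_run_first:
  assumes wf_M1: "wf_tm M1" and wf_M2: "wf_tm M2" and symbols_w: "set w \<subseteq> {..<tm_symbols M1}"
  shows "\<exists>t'\<le>t. tm_run (compose_tm M1 M2) w t' =
    (fst (tm_run M1 w t), snd (tm_run M1 w t) @ replicate (tm_tapes M2 - 1) (word_tape []))"
proof (induction t)
  case 0
  have "tm_tapes M1 + (tm_tapes M2 - 1) - 1 = (tm_tapes M1 - 1) + (tm_tapes M2 - 1)"
    using wf_M1 by (simp add: wf_tm_def)
  then show ?case by (simp add: tm_init_def replicate_add)
next
  case (Suc t)
  let ?c = "tm_run M1 w t" and ?blank = "replicate (tm_tapes M2 - 1) (word_tape [])"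
  obtain t' where composed: "t' \<le> t" "tm_run (compose_tm M1 M2) w t' = (fst ?c, snd ?c @ ?blank)"
    using Suc by blast
  show ?case
  proof (cases "halted M1 ?c")
    case True
    then show ?thesis using composed by (auto simp: tm_run_Suc tm_step_halted intro: le_SucI)
  next
    case False
    then have "tm_run (compose_tm M1 M2) w (Suc t') =
        (fst (tm_run M1 w (Suc t)), snd (tm_run M1 w (Suc t)) @ ?blank)"
      using compose_tm_step_first[OF wf_M1, of "fst ?c" "snd ?c"]
        wf_config_run[OF wf_M1 symbols_w, of t] composed(2) by (simp add: tm_run_Suc)
    then show ?thesis using composed(1) by (intro exI[of _ "Suc t'"]) simp
  qed
qed

lemma compose_tm_run_second:
  assumes wf_M1: "wf_tm M1" and wf_M2: "wf_tm M2" and symbols_v: "set v \<subseteq> {..<tm_symbols M2}"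
    and idle: "length ms = tm_tapes M1 - 1"
    and start: "tm_run (compose_tm M1 M2) w t0 =
      (tm_states M1 + tm_start M2, word_tape v # ms @ replicate (tm_tapes M2 - 1) (word_tape []))"
  shows "\<exists>t'\<le>t0 + t. tm_run (compose_tm M1 M2) w t' =
    (tm_states M1 + fst (tm_run M2 v t), hd (snd (tm_run M2 v t)) # ms @ tl (snd (tm_run M2 v t)))"
proof (induction t)
  case 0
  then show ?case using start by (intro exI[of _ t0]) (simp add: tm_init_def)
next
  case (Suc t)
  have tapes: "1 \<le> tm_tapes M1" "1 \<le> tm_tapes M2" using wf_M1 wf_M2 by (auto simp: wf_tm_def)
  obtain t' where composed: "t' \<le> t0 + t" "tm_run (compose_tm M1 M2) w t' =
    (tm_states M1 + fst (tm_run M2 v t), hd (snd (tm_run M2 v t)) # ms @ tl (snd (tm_run M2 v t)))"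
    using Suc by blast
  show ?case
  proof (cases "halted M2 (tm_run M2 v t)")
    case True
    then show ?thesis using composed by (auto simp: tm_run_Suc tm_step_halted intro: le_SucI)
  next
    case False
    have split: "\<exists>q T ts. tm_run M2 v u = (q, T # ts)" for u
      using wf_config_run[OF wf_M2 symbols_v, of u] tapes(2)
      by (cases "tm_run M2 v u"; cases "snd (tm_run M2 v u)") (auto simp: wf_config_def)
    obtain q T ts where before: "tm_run M2 v t = (q, T # ts)" using split by blast
    obtain q' T' ts' where after: "tm_run M2 v (Suc t) = (q', T' # ts')" using split by blast
    have "tm_run (compose_tm M1 M2) w (Suc t') = (tm_states M1 + q', T' # ms @ ts')"
      using compose_tm_step_second[OF wf_M2 _ _ idle tapes(1)]
        wf_config_run[OF wf_M2 symbols_v, of t] False before after composed(2)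
      by (simp add: tm_run_Suc)
    then show ?thesis using composed(1) after by (intro exI[of _ "Suc t'"]) simp
  qed
qed

lemma compose_tm_run:
  assumes wf_M1: "wf_tm M1" and wf_M2: "wf_tm M2" and symbols_w: "set w \<subseteq> {..<tm_symbols M1}"
    and symbols_v: "set v \<subseteq> {..<tm_symbols M2}"
    and first: "halted M1 (tm_run M1 w t1)" "hd (snd (tm_run M1 w t1)) = word_tape v"
    and second: "halted M2 (tm_run M2 v t2)"
  obtains t where "t \<le> t1 + t2 + 1"
    and "halted (compose_tm M1 M2) (tm_run (compose_tm M1 M2) w t)"
    and "fst (tm_run (compose_tm M1 M2) w t) = tm_accept (compose_tm M1 M2) \<longleftrightarrow>
      fst (tm_run M2 v t2) = tm_accept M2"
    and "hd (snd (tm_run (compose_tm M1 M2) w t)) = hd (snd (tm_run M2 v t2))"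
proof -
  let ?M = "compose_tm M1 M2" and ?blank = "replicate (tm_tapes M2 - 1) (word_tape [])"
  obtain t' where first_phase: "t' \<le> t1"
    "tm_run ?M w t' = (fst (tm_run M1 w t1), snd (tm_run M1 w t1) @ ?blank)"
    using compose_tm_run_first[OF wf_M1 wf_M2 symbols_w] by blast
  obtain ms where ms: "snd (tm_run M1 w t1) = word_tape v # ms" "length ms = tm_tapes M1 - 1"
    using wf_config_run[OF wf_M1 symbols_w, of t1] wf_M1 first
    by (cases "snd (tm_run M1 w t1)") (auto simp: wf_config_def wf_tm_def)
  have "tm_run ?M w (Suc t') = (tm_states M1 + tm_start M2, word_tape v # ms @ ?blank)"
    using compose_tm_step_switch[of M1 "fst (tm_run M1 w t1)" "snd (tm_run M1 w t1)"]
      wf_config_run[OF wf_M1 symbols_w, of t1] first first_phase ms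
    by (metis append_Cons prod.collapse tm_run_Suc)
  from compose_tm_run_second[OF wf_M1 wf_M2 symbols_v ms(2) this, of t2]
  obtain t where "t \<le> Suc t' + t2" "tm_run ?M w t =
      (tm_states M1 + fst (tm_run M2 v t2), hd (snd (tm_run M2 v t2)) # ms @ tl (snd (tm_run M2 v t2)))"
    by blast
  with second first_phase(1) that[of t] show thesis by (auto simp: halted_def)
qed


section \<open>Polynomial and subexponential bounds\<close>

lemma poly_nat_mono: "m \<le> n \<Longrightarrow> poly (p :: nat poly) m \<le> poly p n"
  by (induction p) (auto intro: add_mono mult_le_mono)

definition poly_bounded :: "(nat \<Rightarrow> nat) \<Rightarrow> bool" where
  "poly_bounded f \<longleftrightarrow> (\<exists>p :: nat poly. \<forall>n. f n \<le> poly p n)"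

lemma poly_boundedI: "(\<And>n. f n \<le> poly p n) \<Longrightarrow> poly_bounded f"
  by (auto simp: poly_bounded_def)

lemma poly_bounded_const: "poly_bounded (\<lambda>_. c)"
  by (rule poly_boundedI[of _ "[:c:]"]) simp

lemma poly_bounded_id: "poly_bounded (\<lambda>n. n)"
  by (rule poly_boundedI[of _ "[:0, 1:]"]) simp

lemma poly_bounded_poly: "poly_bounded (poly p)"
  by (rule poly_boundedI) (rule order_refl)

lemma poly_bounded_add:
  assumes "poly_bounded f" "poly_bounded g" shows "poly_bounded (\<lambda>n. f n + g n)"
proof -
  obtain p q where "\<And>n. f n \<le> poly p n" "\<And>n. g n \<le> poly q n"
    using assms by (auto simp: poly_bounded_def)
  then show ?thesis by (intro poly_boundedI[of _ "p + q"]) (simp add: add_mono)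
qed

lemma poly_bounded_mult:
  assumes "poly_bounded f" "poly_bounded g" shows "poly_bounded (\<lambda>n. f n * g n)"
proof -
  obtain p q where "\<And>n. f n \<le> poly p n" "\<And>n. g n \<le> poly q n"
    using assms by (auto simp: poly_bounded_def)
  then show ?thesis by (intro poly_boundedI[of _ "p * q"]) (simp add: mult_le_mono)
qed

lemma poly_bounded_compose:
  assumes "poly_bounded f" "poly_bounded g" shows "poly_bounded (\<lambda>n. f (g n))"
proof -
  obtain p q where f_le: "\<And>n. f n \<le> poly p n" and g_le: "\<And>n. g n \<le> poly q n"
    using assms by (auto simp: poly_bounded_def)
  have "f (g n) \<le> poly (pcompose p q) n" for n
    using f_le[of "g n"] poly_nat_mono[OF g_le, of p n] by (simp add: poly_pcompose)
  then show ?thesis by (rule poly_boundedI)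
qed

lemmas poly_bounded_intros =
  poly_bounded_const poly_bounded_id poly_bounded_add poly_bounded_mult

lemma poly_nat_le_power: "\<exists>e. \<forall>n. poly (p :: nat poly) n \<le> (n + 2) ^ e"
proof (induction p)
  case (pCons a p)
  then obtain e where p_le: "\<And>n. poly p n \<le> (n + 2) ^ e" by blast
  have "poly (pCons a p) n \<le> (n + 2) ^ Suc (a + e)" for n
  proof -
    have "a \<le> (n + 2) ^ a"
      using less_exp[of a] power_mono[of 2 "n + 2" a] by linarith
    also have "\<dots> \<le> (n + 2) ^ (a + e)" by (rule power_increasing) simp_all
    finally have "a \<le> (n + 2) ^ (a + e)" .
    moreover have "poly p n \<le> (n + 2) ^ (a + e)"
      by (rule order_trans[OF p_le power_increasing]) simp_all
    then have "n * poly p n \<le> n * (n + 2) ^ (a + e)" by (rule mult_le_mono2)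
    moreover have "(n + 2) ^ Suc (a + e) = n * (n + 2) ^ (a + e) + 2 * (n + 2) ^ (a + e)"
      by (simp only: power_Suc add_mult_distrib)
    ultimately show ?thesis unfolding poly_pCons by linarith
  qed
  then show ?case by blast
qed simp

definition subexponential :: "(nat \<Rightarrow> real) \<Rightarrow> bool" where
  "subexponential T \<longleftrightarrow> (\<exists>h. h \<in> o(\<lambda>n. real n) \<and> (\<forall>n. T n \<le> 2 powr h n))"

lemma subexponential_poly_bounded:
  assumes "poly_bounded f"
  shows "subexponential (\<lambda>n. real (f n))"
proof -
  obtain p where f_le: "\<And>n. f n \<le> poly p n" using assms by (auto simp: poly_bounded_def)
  obtain e where p_le: "\<And>n. poly p n \<le> (n + 2) ^ e" using poly_nat_le_power[of p] by blast
  have "real (f n) \<le> 2 powr (real e * log 2 (real n + 2))" for n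
  proof -
    have "real (f n) \<le> real ((n + 2) ^ e)"
      using order_trans[OF f_le p_le] by (simp only: of_nat_le_iff)
    also have "\<dots> = (2 powr log 2 (real n + 2)) powr real e" by (simp add: powr_realpow add.commute)
    also have "\<dots> = 2 powr (real e * log 2 (real n + 2))" by (simp only: powr_powr mult.commute)
    finally show ?thesis .
  qed
  moreover have "(\<lambda>n. real e * log 2 (real n + 2)) \<in> o(\<lambda>n. real n)" by real_asymp
  ultimately show ?thesis unfolding subexponential_def by blast
qed

lemma subexponential_add:
  assumes "subexponential S" "subexponential T"
  shows "subexponential (\<lambda>n. S n + T n)"
proof -
  obtain g h where small: "g \<in> o(\<lambda>n. real n)" "h \<in> o(\<lambda>n. real n)"
    and bounds: "\<And>n. S n \<le> 2 powr g n" "\<And>n. T n \<le> 2 powr h n"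
    using assms by (auto simp: subexponential_def)
  have "S n + T n \<le> 2 powr (1 + \<bar>g n\<bar> + \<bar>h n\<bar>)" for n
  proof -
    have "2 powr g n \<le> 2 powr (\<bar>g n\<bar> + \<bar>h n\<bar>)" "2 powr h n \<le> 2 powr (\<bar>g n\<bar> + \<bar>h n\<bar>)"
      by (auto intro!: powr_mono)
    then have "S n + T n \<le> 2 * 2 powr (\<bar>g n\<bar> + \<bar>h n\<bar>)" using bounds[of n] by linarith
    then show ?thesis by (simp add: powr_add)
  qed
  moreover have "(\<lambda>_. 1) \<in> o(\<lambda>n. real n)" by real_asymp
  then have "(\<lambda>n. 1 + \<bar>g n\<bar> + \<bar>h n\<bar>) \<in> o(\<lambda>n. real n)"
    using small by (intro sum_in_smallo) simp_all
  ultimately show ?thesis unfolding subexponential_def by blast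
qed

lemma smallo_Max_linear:
  fixes f :: "nat \<Rightarrow> real"
  assumes small: "f \<in> o(\<lambda>n. real n)"
  shows "(\<lambda>s. max 0 (Max (f ` {..a + b * s}))) \<in> o(\<lambda>s. real s)"
proof (rule landau_o.smallI)
  fix \<epsilon> :: real assume eps_pos: "\<epsilon> > 0"
  define \<delta> where "\<delta> = \<epsilon> / real (a + b + 1)"
  have delta: "\<delta> > 0" "\<delta> * real (a + b) \<le> \<epsilon>" using eps_pos by (auto simp: \<delta>_def field_simps)
  obtain N where eventually_le: "\<And>n. n \<ge> N \<Longrightarrow> f n \<le> \<delta> * real n"
    using landau_o.smallD[OF small delta(1)] by (fastforce simp: eventually_at_top_linorder)
  define K where "K = Max (insert 0 (f ` {..N}))"
  have initially_le: "f n \<le> K" if "n \<le> N" for n unfolding K_def using that by (intro Max_ge) auto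
  have "max 0 (Max (f ` {..a + b * s})) \<le> \<epsilon> * real s" if large: "s \<ge> 1" "real s \<ge> K / \<epsilon>" for s
  proof -
    have "f n \<le> \<epsilon> * real s" if n_le: "n \<le> a + b * s" for n
    proof (cases "n \<le> N")
      case True
      then show ?thesis using initially_le[of n] large(2) eps_pos by (simp add: field_simps)
    next
      case False
      have "a \<le> a * s" using large(1) by simp
      then have "n \<le> (a + b) * s" unfolding add_mult_distrib using n_le by linarith
      then have "\<delta> * real n \<le> \<delta> * real ((a + b) * s)"
        using delta(1) by (intro mult_left_mono) (simp_all only: of_nat_le_iff less_imp_le)
      also have "\<dots> \<le> \<epsilon> * real s"
        using mult_right_mono[OF delta(2), of "real s"] by (simp add: mult.assoc)
      finally show ?thesis using eventually_le[of n] False by simp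
    qed
    then show ?thesis using eps_pos by (subst max.bounded_iff, subst Max_le_iff) auto
  qed
  moreover have "eventually (\<lambda>s. s \<ge> 1 \<and> real s \<ge> K / \<epsilon>) at_top"
    using eventually_ge_at_top filterlim_real_sequentially unfolding filterlim_at_top
    by (intro eventually_conj) blast+
  ultimately show "eventually (\<lambda>s. norm (max 0 (Max (f ` {..a + b * s}))) \<le> \<epsilon> * norm (real s)) at_top"
    by (auto elim!: eventually_mono)
qed

lemma subexponential_Max_linear:
  assumes "f \<in> o(\<lambda>n. real n)"
  shows "subexponential (\<lambda>s. 2 powr max 0 (Max (f ` {..a + b * s})))"
  unfolding subexponential_def using smallo_Max_linear[OF assms] by blast


section \<open>Reductions\<close>

lemma poly_time_computableI:
  assumes "wf_tm M" "poly_bounded b"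
    and "\<And>x. \<exists>t\<le>b (length x). halted M (tm_run M (bits x) t) \<and>
      hd (snd (tm_run M (bits x) t)) = word_tape (bits (f x))"
  shows "poly_time_computable f"
proof -
  obtain p where b_le: "\<And>n. b n \<le> poly p n" using assms(2) by (auto simp: poly_bounded_def)
  have "halted M (tm_run M (bits x) (poly p (length x))) \<and>
      hd (snd (tm_run M (bits x) (poly p (length x)))) = word_tape (bits (f x))" for x
    using assms(3)[of x] tm_run_halted_le order_trans[OF _ b_le] by metis
  then show ?thesis
    unfolding poly_time_computable_def Let_def using assms(1) by blast
qed

lemma poly_time_computableE:
  assumes "poly_time_computable f"
  obtains M p where "wf_tm M"
    and "\<And>x. halted M (tm_run M (bits x) (poly p (length x)))"
    and "\<And>x. hd (snd (tm_run M (bits x) (poly p (length x)))) = word_tape (bits (f x))"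
  using assms unfolding poly_time_computable_def Let_def by blast

lemma poly_time_computable_length:
  assumes "poly_time_computable f"
  shows "\<exists>p. \<forall>x. length (f x) \<le> poly p (length x)"
proof -
  obtain M p where "wf_tm M"
    "\<And>x. hd (snd (tm_run M (bits x) (poly p (length x)))) = word_tape (bits (f x))"
    using poly_time_computableE[OF assms] by metis
  then have "length (f x) \<le> poly ([:0, 1:] + p) (length x)" for x
    using length_tm_output_le by simp
  then show ?thesis by blast
qed

lemma poly_time_computable_compose_tm:
  assumes comp_f: "poly_time_computable f" and wf_M: "wf_tm M"
  obtains N p where "wf_tm N"
    and "\<And>x t. halted M (tm_run M (bits (f x)) t) \<Longrightarrow> \<exists>u\<le>poly p (length x) + t.
      halted N (tm_run N (bits x) u) \<and>
      (fst (tm_run N (bits x) u) = tm_accept N \<longleftrightarrow> fst (tm_run M (bits (f x)) t) = tm_accept M) \<and>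
      hd (snd (tm_run N (bits x) u)) = hd (snd (tm_run M (bits (f x)) t))"
proof -
  obtain K p where wf_K: "wf_tm K"
    and computes: "\<And>x. halted K (tm_run K (bits x) (poly p (length x)))"
      "\<And>x. hd (snd (tm_run K (bits x) (poly p (length x)))) = word_tape (bits (f x))"
    using poly_time_computableE[OF comp_f] by metis
  show thesis
  proof (rule that[of "compose_tm K M" "p + 1"])
    show "wf_tm (compose_tm K M)" by (rule wf_compose_tm[OF wf_K wf_M])
    show "\<exists>u\<le>poly (p + 1) (length x) + t.
        halted (compose_tm K M) (tm_run (compose_tm K M) (bits x) u) \<and>
        (fst (tm_run (compose_tm K M) (bits x) u) = tm_accept (compose_tm K M) \<longleftrightarrow>
          fst (tm_run M (bits (f x)) t) = tm_accept M) \<and>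
        hd (snd (tm_run (compose_tm K M) (bits x) u)) = hd (snd (tm_run M (bits (f x)) t))"
      if halt: "halted M (tm_run M (bits (f x)) t)" for x t
    proof (rule compose_tm_run[OF wf_K wf_M set_bits_symbols[OF wf_K] set_bits_symbols[OF wf_M]
          computes halt])
      fix u assume "u \<le> poly p (length x) + t + 1"
      then have "u \<le> poly (p + 1) (length x) + t" by simp
      moreover assume "halted (compose_tm K M) (tm_run (compose_tm K M) (bits x) u)"
        "fst (tm_run (compose_tm K M) (bits x) u) = tm_accept (compose_tm K M) \<longleftrightarrow>
          fst (tm_run M (bits (f x)) t) = tm_accept M"
        "hd (snd (tm_run (compose_tm K M) (bits x) u)) = hd (snd (tm_run M (bits (f x)) t))"
      ultimately show ?thesis by blast
    qed
  qed
qed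

lemma poly_time_computable_compose:
  assumes comp_f: "poly_time_computable f" and comp_g: "poly_time_computable g"
  shows "poly_time_computable (\<lambda>x. g (f x))"
proof -
  obtain M q where wf_M: "wf_tm M"
    and computes: "\<And>x. halted M (tm_run M (bits x) (poly q (length x)))"
    "\<And>x. hd (snd (tm_run M (bits x) (poly q (length x)))) = word_tape (bits (g x))"
    using poly_time_computableE[OF comp_g] by metis
  obtain N p where wf_N: "wf_tm N"
    and run: "\<And>x t. halted M (tm_run M (bits (f x)) t) \<Longrightarrow> \<exists>u\<le>poly p (length x) + t.
      halted N (tm_run N (bits x) u) \<and>
      hd (snd (tm_run N (bits x) u)) = hd (snd (tm_run M (bits (f x)) t))"
    using poly_time_computable_compose_tm[OF comp_f wf_M] by metis
  obtain l where length_le: "\<And>x. length (f x) \<le> poly l (length x)"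
    using poly_time_computable_length[OF comp_f] by blast
  show ?thesis
  proof (rule poly_time_computableI[OF wf_N])
    show "poly_bounded (\<lambda>n. poly p n + poly q (poly l n))"
      by (intro poly_bounded_intros poly_bounded_poly poly_bounded_compose[OF poly_bounded_poly])
    show "\<exists>t\<le>poly p (length x) + poly q (poly l (length x)).
        halted N (tm_run N (bits x) t) \<and>
        hd (snd (tm_run N (bits x) t)) = word_tape (bits (g (f x)))" for x
    proof -
      obtain t where "t \<le> poly p (length x) + poly q (length (f x))" "halted N (tm_run N (bits x) t)"
        "hd (snd (tm_run N (bits x) t)) = word_tape (bits (g (f x)))"
        using run[OF computes(1)] computes(2) by metis
      moreover have "poly q (length (f x)) \<le> poly q (poly l (length x))"
        by (rule poly_nat_mono[OF length_le])
      ultimately show ?thesis by (intro exI[of _ t]) simp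
    qed
  qed
qed

lemma NP_hard_reduction:
  assumes hard: "NP_hard enc I P" and comp_g: "poly_time_computable g"
    and reduction: "\<And>d. d \<in> I \<Longrightarrow> r d \<in> J \<and> g (enc d) = enc' (r d) \<and> (Q (r d) \<longleftrightarrow> P d)"
  shows "NP_hard enc' J Q"
  unfolding NP_hard_def
proof
  fix L assume "L \<in> NP"
  then obtain f where comp_f: "poly_time_computable f"
    and fL: "\<And>x. \<exists>d\<in>I. f x = enc d \<and> (x \<in> L \<longleftrightarrow> P d)"
    using hard unfolding NP_hard_def by blast
  have "\<exists>e\<in>J. g (f x) = enc' e \<and> (x \<in> L \<longleftrightarrow> Q e)" for x
    using fL[of x] reduction by metis
  then show "\<exists>f. poly_time_computable f \<and> (\<forall>x. \<exists>e\<in>J. f x = enc' e \<and> (x \<in> L \<longleftrightarrow> Q e))"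
    using poly_time_computable_compose[OF comp_f comp_g] by blast
qed

lemma solvable_subexpI:
  assumes "wf_tm M" and "subexponential T"
    and "\<And>d. d \<in> I \<Longrightarrow> \<exists>t. real t \<le> T (s d) \<and> halted M (tm_run M (bits (enc d)) t) \<and>
      (fst (tm_run M (bits (enc d)) t) = tm_accept M \<longleftrightarrow> P d)"
  shows "solvable_subexp enc I P s"
proof -
  obtain h where "h \<in> o(\<lambda>n. real n)" and T_le: "\<And>n. T n \<le> 2 powr h n"
    using assms(2) by (auto simp: subexponential_def)
  moreover have "solvable_in_time enc I P (\<lambda>d. 2 powr h (s d))"
    unfolding solvable_in_time_def using assms(1,3) order_trans[OF _ T_le] by blast
  ultimately show ?thesis unfolding solvable_subexp_def by blast
qed

lemma powr_le_powr_Max: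
  fixes f :: "nat \<Rightarrow> real"
  shows "k \<le> n \<Longrightarrow> 2 powr f k \<le> 2 powr max 0 (Max (f ` {..n}))"
  by (intro powr_mono max.coboundedI2 Max_ge) auto

lemma solvable_subexp_reduction:
  assumes solvable: "solvable_subexp enc' J Q s'" and comp_g: "poly_time_computable g"
    and reduction: "\<And>d. d \<in> I \<Longrightarrow> r d \<in> J \<and> g (enc d) = enc' (r d) \<and> (Q (r d) \<longleftrightarrow> P d)"
    and size: "\<And>d. d \<in> I \<Longrightarrow> s' (r d) \<le> a + b * s d"
    and length: "\<And>d. d \<in> I \<Longrightarrow> length (enc d) \<le> B (s d)" "poly_bounded B"
  shows "solvable_subexp enc I P s"
proof -
  obtain f M where small: "f \<in> o(\<lambda>n. real n)" and wf_M: "wf_tm M"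
    and solve: "\<And>e. e \<in> J \<Longrightarrow> \<exists>t. real t \<le> 2 powr f (s' e) \<and> halted M (tm_run M (bits (enc' e)) t) \<and>
      (fst (tm_run M (bits (enc' e)) t) = tm_accept M \<longleftrightarrow> Q e)"
    using solvable unfolding solvable_subexp_def solvable_in_time_def by blast
  obtain N p where wf_N: "wf_tm N"
    and run: "\<And>x t. halted M (tm_run M (bits (g x)) t) \<Longrightarrow> \<exists>u\<le>poly p (length x) + t.
      halted N (tm_run N (bits x) u) \<and>
      (fst (tm_run N (bits x) u) = tm_accept N \<longleftrightarrow> fst (tm_run M (bits (g x)) t) = tm_accept M)"
    using poly_time_computable_compose_tm[OF comp_g wf_M] by metis
  let ?T = "\<lambda>n. real (poly p (B n)) + 2 powr max 0 (Max (f ` {..a + b * n}))"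
  show ?thesis
  proof (rule solvable_subexpI[OF wf_N])
    have "poly_bounded (\<lambda>n. poly p (B n))"
      by (rule poly_bounded_compose[OF poly_bounded_poly length(2)])
    then show "subexponential ?T"
      by (rule subexponential_add[OF subexponential_poly_bounded
            subexponential_Max_linear[OF small]])
  next
    fix d assume d_in: "d \<in> I"
    obtain t where solver: "real t \<le> 2 powr f (s' (r d))" "halted M (tm_run M (bits (g (enc d))) t)"
      "fst (tm_run M (bits (g (enc d))) t) = tm_accept M \<longleftrightarrow> P d"
      using solve[of "r d"] reduction[OF d_in] by auto
    obtain u where composed: "u \<le> poly p (length (enc d)) + t"
      "halted N (tm_run N (bits (enc d)) u)" "fst (tm_run N (bits (enc d)) u) = tm_accept N \<longleftrightarrow> P d"
      using run[OF solver(2)] solver(3) by blast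
    have "u \<le> poly p (B (s d)) + t"
      using composed(1) poly_nat_mono[OF length(1)[OF d_in], of p] by linarith
    then have "real u \<le> ?T (s d)"
      using solver(1) powr_le_powr_Max[OF size[OF d_in], of f] by linarith
    with composed(2,3) show "\<exists>u. real u \<le> ?T (s d) \<and> halted N (tm_run N (bits (enc d)) u) \<and>
        (fst (tm_run N (bits (enc d)) u) = tm_accept N \<longleftrightarrow> P d)"
      by blast
  qed
qed


section \<open>Structured programs\<close>

datatype prog =
    Act "nat list \<Rightarrow> (nat \<times> move) list"
  | Seq prog prog
  | Branch "nat list \<Rightarrow> bool" prog prog
  | While "nat list \<Rightarrow> bool" prog

inductive exec :: "prog \<Rightarrow> tape list \<Rightarrow> nat \<Rightarrow> tape list \<Rightarrow> bool" where
  exec_Act: "exec (Act f) ts 1 (map2 act_tape (f (map read_tape ts)) ts)"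
| exec_Seq: "exec c ts t ts' \<Longrightarrow> exec d ts' u ts'' \<Longrightarrow> exec (Seq c d) ts (t + u) ts''"
| exec_Branch_True: "P (map read_tape ts) \<Longrightarrow> exec c ts t ts' \<Longrightarrow> exec (Branch P c d) ts (1 + t + 1) ts'"
| exec_Branch_False: "\<not> P (map read_tape ts) \<Longrightarrow> exec d ts t ts' \<Longrightarrow> exec (Branch P c d) ts (1 + t) ts'"
| exec_While_False: "\<not> P (map read_tape ts) \<Longrightarrow> exec (While P c) ts 1 ts"
| exec_While_True: "P (map read_tape ts) \<Longrightarrow> exec c ts t ts' \<Longrightarrow> exec (While P c) ts' u ts'' \<Longrightarrow>
    exec (While P c) ts (1 + t + 1 + u) ts''"

type_synonym instr = "nat list \<Rightarrow> nat \<times> (nat \<times> move) list"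

definition goto_instr :: "nat \<Rightarrow> instr" where
  "goto_instr b rs = (b, map stay rs)"

definition test_instr :: "(nat list \<Rightarrow> bool) \<Rightarrow> nat \<Rightarrow> nat \<Rightarrow> instr" where
  "test_instr P a b rs = (if P rs then a else b, map stay rs)"

fun psize :: "prog \<Rightarrow> nat" where
  "psize (Act f) = 1"
| "psize (Seq c d) = psize c + psize d"
| "psize (Branch P c d) = psize c + psize d + 2"
| "psize (While P c) = psize c + 2"

text \<open>Jump targets are absolute; \<open>a\<close> is the address at which the code is placed.\<close>
fun code :: "nat \<Rightarrow> prog \<Rightarrow> instr list" where
  "code a (Act f) = [\<lambda>rs. (a + 1, f rs)]"
| "code a (Seq c d) = code a c @ code (a + psize c) d"
| "code a (Branch P c d) =
     [test_instr P (a + 1) (a + psize c + 2)] @ code (a + 1) c @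
     [goto_instr (a + psize c + psize d + 2)] @ code (a + psize c + 2) d"
| "code a (While P c) =
     [test_instr P (a + 1) (a + psize c + 2)] @ code (a + 1) c @ [goto_instr a]"

lemma length_code [simp]: "length (code a c) = psize c"
  by (induction c arbitrary: a) auto

definition code_tm :: "nat \<Rightarrow> instr list \<Rightarrow> tm" where
  "code_tm K is = \<lparr> tm_tapes = K, tm_states = length is + 2, tm_symbols = 4, tm_start = 0,
     tm_accept = length is, tm_reject = length is + 1,
     tm_delta = (\<lambda>q rs. if q < length is then (is ! q) rs else (q, map stay rs)) \<rparr>"

fun wf_prog :: "nat \<Rightarrow> prog \<Rightarrow> bool" where
  "wf_prog K (Act f) \<longleftrightarrow> (\<forall>rs. length rs = K \<and> set rs \<subseteq> {..<4} \<longrightarrow>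
      length (f rs) = K \<and> fst ` set (f rs) \<subseteq> {..<4})"
| "wf_prog K (Seq c d) \<longleftrightarrow> wf_prog K c \<and> wf_prog K d"
| "wf_prog K (Branch P c d) \<longleftrightarrow> wf_prog K c \<and> wf_prog K d"
| "wf_prog K (While P c) \<longleftrightarrow> wf_prog K c"

definition wf_instr :: "nat \<Rightarrow> nat \<Rightarrow> instr \<Rightarrow> bool" where
  "wf_instr K n i \<longleftrightarrow> (\<forall>rs. length rs = K \<and> set rs \<subseteq> {..<4} \<longrightarrow>
     fst (i rs) \<le> n \<and> length (snd (i rs)) = K \<and> fst ` set (snd (i rs)) \<subseteq> {..<4})"

lemma wf_instr_mono: "wf_instr K m i \<Longrightarrow> m \<le> n \<Longrightarrow> wf_instr K n i"
  unfolding wf_instr_def using order_trans by blast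

lemma wf_goto_instr: "b \<le> n \<Longrightarrow> wf_instr K n (goto_instr b)"
  by (auto simp: wf_instr_def goto_instr_def)

lemma wf_test_instr: "a \<le> n \<Longrightarrow> b \<le> n \<Longrightarrow> wf_instr K n (test_instr P a b)"
  by (auto simp: wf_instr_def test_instr_def)

lemma wf_code: "wf_prog K c \<Longrightarrow> i \<in> set (code a c) \<Longrightarrow> wf_instr K (a + psize c) i"
proof (induction c arbitrary: a)
  case (Act f)
  then show ?case by (simp add: wf_instr_def)
next
  case (Seq c d)
  then show ?case
    by (auto intro: wf_instr_mono[OF Seq.IH(1)] wf_instr_mono[OF Seq.IH(2)])
next
  case (Branch P c d)
  then show ?case
    by (auto intro: wf_test_instr wf_goto_instr
        wf_instr_mono[OF Branch.IH(1)] wf_instr_mono[OF Branch.IH(2)])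
next
  case (While P c)
  then show ?case
    by (auto intro: wf_test_instr wf_goto_instr wf_instr_mono[OF While.IH])
qed

lemma wf_code_tm:
  assumes "1 \<le> K" "wf_prog K c"
  shows "wf_tm (code_tm K (code 0 c))"
proof -
  have "case tm_delta (code_tm K (code 0 c)) q rs of (q', as) \<Rightarrow>
      q' < psize c + 2 \<and> length as = K \<and> fst ` set as \<subseteq> {..<4}"
    if "q < psize c + 2" "length rs = K" "set rs \<subseteq> {..<4}" for q rs
  proof (cases "q < psize c")
    case True
    then have "wf_instr K (psize c) (code 0 c ! q)"
      using wf_code[OF assms(2), of "code 0 c ! q" 0] by simp
    then show ?thesis
      using True that by (simp add: code_tm_def wf_instr_def case_prod_beta less_Suc_eq_le le_SucI)
  next
    case False
    then show ?thesis using that by (auto simp: code_tm_def)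
  qed
  then show ?thesis
    using assms(1) unfolding wf_tm_def by (simp add: code_tm_def)
qed

fun placed :: "instr list \<Rightarrow> nat \<Rightarrow> instr list \<Rightarrow> bool" where
  "placed is a [] \<longleftrightarrow> True"
| "placed is a (i # js) \<longleftrightarrow> a < length is \<and> is ! a = i \<and> placed is (Suc a) js"

lemma placed_append: "placed is a (js @ ks) \<longleftrightarrow> placed is a js \<and> placed is (a + length js) ks"
  by (induction js arbitrary: a) auto

lemma placed_suffix: "placed (pre @ js) (length pre) js"
proof (induction js arbitrary: pre)
  case (Cons i js)
  then show ?case using Cons.IH[of "pre @ [i]"] by simp
qed simp

lemma code_tm_step:
  assumes "a < length is" "(is ! a) (map read_tape ts) = (b, as)"
  shows "tm_step (code_tm K is) (a, ts) = (b, map2 act_tape as ts)"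
  using assms by (simp add: tm_step_def halted_def code_tm_def)

lemma code_tm_goto:
  assumes "a < length is" "is ! a = goto_instr b"
  shows "tm_step (code_tm K is) (a, ts) = (b, ts)"
  using code_tm_step[OF assms(1)] map2_act_stay by (simp add: assms(2) goto_instr_def)

lemma code_tm_test:
  assumes "a < length is" "is ! a = test_instr P b b'"
  shows "tm_step (code_tm K is) (a, ts) = (if P (map read_tape ts) then b else b', ts)"
  using code_tm_step[OF assms(1)] map2_act_stay by (simp add: assms(2) test_instr_def)

lemma funpow_trans: "(f ^^ s) x = y \<Longrightarrow> (f ^^ t) y = z \<Longrightarrow> (f ^^ (s + t)) x = z"
  by (simp add: add.commute[of s t] funpow_add)

lemma exec_code:
  assumes "exec c ts t ts'" "placed is a (code a c)"
  shows "(tm_step (code_tm K is) ^^ t) (a, ts) = (a + psize c, ts')"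
  using assms
proof (induction arbitrary: a rule: exec.induct)
  case (exec_Act f ts)
  then show ?case using code_tm_step[of a "is" ts] by simp
next
  case (exec_Seq c ts t ts' d u ts'')
  then show ?case
    using funpow_trans[of t _ "(a, ts)" "(a + psize c, ts')"] by (simp add: placed_append add.assoc)
next
  case (exec_Branch_True P ts c t ts' d)
  let ?step = "tm_step (code_tm K is)"
  have enter: "(?step ^^ 1) (a, ts) = (a + 1, ts)"
    using exec_Branch_True code_tm_test[of a "is" P] by simp
  have body: "(?step ^^ t) (a + 1, ts) = (a + 1 + psize c, ts')"
    using exec_Branch_True by (simp add: placed_append)
  have leave: "(?step ^^ 1) (a + 1 + psize c, ts') = (a + psize (Branch P c d), ts')"
    using exec_Branch_True.prems code_tm_goto[of "a + 1 + psize c"] by (simp add: placed_append)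
  show ?case by (rule funpow_trans[OF funpow_trans[OF enter body] leave])
next
  case (exec_Branch_False P ts d t ts' c)
  let ?step = "tm_step (code_tm K is)"
  have enter: "(?step ^^ 1) (a, ts) = (a + psize c + 2, ts)"
    using exec_Branch_False code_tm_test[of a "is" P] by simp
  have body: "(?step ^^ t) (a + psize c + 2, ts) = (a + psize (Branch P c d), ts')"
    using exec_Branch_False.IH[of "a + psize c + 2"] exec_Branch_False.prems
    by (simp add: placed_append add_ac)
  show ?case by (rule funpow_trans[OF enter body])
next
  case (exec_While_False P ts c)
  then show ?case using code_tm_test[of a "is" P] by simp
next
  case (exec_While_True P ts c t ts' u ts'')
  let ?step = "tm_step (code_tm K is)"
  have enter: "(?step ^^ 1) (a, ts) = (a + 1, ts)"
    using exec_While_True code_tm_test[of a "is" P] by simp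
  have body: "(?step ^^ t) (a + 1, ts) = (a + 1 + psize c, ts')"
    using exec_While_True by (simp add: placed_append)
  have jump_back: "(?step ^^ 1) (a + 1 + psize c, ts') = (a, ts')"
    using exec_While_True.prems code_tm_goto[of "a + 1 + psize c"] by (simp add: placed_append)
  have rest: "(?step ^^ u) (a, ts') = (a + psize (While P c), ts'')"
    using exec_While_True by blast
  show ?case by (rule funpow_trans[OF funpow_trans[OF funpow_trans[OF enter body] jump_back] rest])
qed

lemma exec_tm_run:
  assumes "exec c (word_tape w # replicate (K - 1) (word_tape [])) t ts"
  shows "halted (code_tm K (code 0 c)) (tm_run (code_tm K (code 0 c)) w t)"
    "snd (tm_run (code_tm K (code 0 c)) w t) = ts"
  using exec_code[OF assms, of "code 0 c" 0 K] placed_suffix[of "[]" "code 0 c"]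
  by (auto simp: tm_run_def tm_init_def code_tm_def halted_def)

definition runs :: "prog \<Rightarrow> tape list \<Rightarrow> nat \<Rightarrow> tape list \<Rightarrow> bool" where
  "runs c ts b ts' \<longleftrightarrow> (\<exists>t\<le>b. exec c ts t ts')"

lemma runs_mono: "runs c ts b ts' \<Longrightarrow> b \<le> b' \<Longrightarrow> runs c ts b' ts'"
  unfolding runs_def by (meson order_trans)

lemma runs_Seq: "runs c ts b ts' \<Longrightarrow> runs d ts' b' ts'' \<Longrightarrow> runs (Seq c d) ts (b + b') ts''"
  unfolding runs_def by (meson add_mono exec_Seq)

lemma runs_Branch_True:
  "P (map read_tape ts) \<Longrightarrow> runs c ts b ts' \<Longrightarrow> runs (Branch P c d) ts (b + 2) ts'"
  unfolding runs_def using exec_Branch_True[of P ts c _ ts' d] by fastforce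

lemma runs_Branch_False:
  "\<not> P (map read_tape ts) \<Longrightarrow> runs d ts b ts' \<Longrightarrow> runs (Branch P c d) ts (b + 2) ts'"
  unfolding runs_def by (metis exec_Branch_False add.commute add_le_mono one_le_numeral)

lemma runs_While:
  assumes "\<And>j. j < n \<Longrightarrow> P (map read_tape (S j))"
    and "\<And>j. j < n \<Longrightarrow> runs c (S j) b (S (Suc j))"
    and "\<not> P (map read_tape (S n))"
  shows "runs (While P c) (S 0) (n * (b + 2) + 1) (S n)"
  using assms
proof (induction n arbitrary: S)
  case 0
  then show ?case using exec_While_False[of P "S 0" c] by (auto simp: runs_def)
next
  case (Suc n)
  have "runs (While P c) (S (Suc 0)) (n * (b + 2) + 1) (S (Suc n))"
    using Suc.prems by (intro Suc.IH[of "\<lambda>j. S (Suc j)"]) simp_all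
  then obtain t u where round: "t \<le> b" "exec c (S 0) t (S (Suc 0))"
    and rest: "u \<le> n * (b + 2) + 1" "exec (While P c) (S (Suc 0)) u (S (Suc n))"
    using Suc.prems(2)[of 0] by (auto simp: runs_def)
  have "exec (While P c) (S 0) (1 + t + 1 + u) (S (Suc n))"
    using exec_While_True[OF Suc.prems(1) round(2) rest(2)] by simp
  moreover have "1 + t + 1 + u \<le> Suc n * (b + 2) + 1" using round(1) rest(1) by simp
  ultimately show ?case unfolding runs_def by blast
qed


section \<open>Counters\<close>

definition word_cells :: "bool list \<Rightarrow> int \<Rightarrow> nat" where
  "word_cells x = fst (word_tape (bits x))"

lemma word_tape_bits: "word_tape (bits x) = (word_cells x, 0)"
  by (simp add: word_cells_def word_tape_def)

lemma word_cells_Nil [simp]: "word_cells [] = (\<lambda>_. 0)"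
  by (auto simp: word_cells_def word_tape_def)

lemma word_cells_eq_0_iff: "word_cells x p = 0 \<longleftrightarrow> \<not> (0 \<le> p \<and> p < int (length x))"
  by (auto simp: word_cells_def word_tape_def bits_def nat_less_iff)

lemma word_cells_le: "word_cells x p \<le> 2"
  by (auto simp: word_cells_def word_tape_def bits_def nat_less_iff)

lemma word_cells_nth: "i < length x \<Longrightarrow> word_cells x (int i) = (if x ! i then 2 else 1)"
  by (simp add: word_cells_def word_tape_def bits_def)

lemma word_cells_snoc:
  "word_cells (x @ [b]) = (word_cells x)(int (length x) := if b then 2 else 1)"
  by (auto simp: word_cells_def word_tape_def bits_def nth_append fun_eq_iff nat_less_iff)

definition symbol_tape :: "nat \<Rightarrow> tape" where
  "symbol_tape s = (\<lambda>p. if p = 0 then s else 0, 0)"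

definition counter_tape :: "nat \<Rightarrow> tape" where
  "counter_tape v = (\<lambda>p. if p = 0 then 3 else 0, int v)"

text \<open>
  A counter is a tape whose cell 0 carries the mark 3; its value is the position of its head, so
  that increment, decrement and zero test take one step each. Tape 0 is the output, tape 1
  holds the input, tape 2 stores a single symbol in cell 0, and tape \<open>r + 3\<close> is counter \<open>r\<close>.
\<close>
definition mem :: "nat \<Rightarrow> bool list \<Rightarrow> nat \<Rightarrow> nat \<Rightarrow> (nat \<Rightarrow> nat) \<Rightarrow> bool list \<Rightarrow> tape list" where
  "mem R x h s \<rho> out = (word_cells out, int (length out)) # (word_cells x, int h) #
     symbol_tape s # map (\<lambda>r. counter_tape (\<rho> r)) [0..<R]"

lemma length_mem [simp]: "length (mem R x h s \<rho> out) = R + 3"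
  by (simp add: mem_def)

lemma nth_Cons3: "(a # b # c # xs) ! (r + 3) = xs ! r"
  by (simp add: numeral_3_eq_3)

lemma mem_nth [simp]:
  "mem R x h s \<rho> out ! 0 = (word_cells out, int (length out))"
  "mem R x h s \<rho> out ! Suc 0 = (word_cells x, int h)"
  "mem R x h s \<rho> out ! 2 = symbol_tape s"
  "r < R \<Longrightarrow> mem R x h s \<rho> out ! (r + 3) = counter_tape (\<rho> r)"
  by (simp_all add: mem_def nth_Cons3)

lemma tape_index_cases:
  assumes "i < R + 3"
  obtains "i = 0" | "i = Suc 0" | "i = 2" | r where "r < R" "i = r + 3"
proof -
  consider "i = 0" | "i = Suc 0" | "i = 2" | "3 \<le> i" by linarith
  then show thesis
  proof cases
    case 4
    then have "i - 3 < R" "i = i - 3 + 3" using assms by auto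
    then show thesis by (rule that(4))
  qed (rule that; assumption)+
qed

definition act_tapes :: "(nat list \<Rightarrow> nat \<Rightarrow> nat \<times> move) \<Rightarrow> prog" where
  "act_tapes f = Act (\<lambda>rs. map (f rs) [0..<length rs])"

lemma runs_act_tapes:
  assumes "\<And>i. i < length ts \<Longrightarrow> act_tape (f (map read_tape ts) i) (ts ! i) = ts' ! i"
    and "length ts' = length ts"
  shows "runs (act_tapes f) ts 1 ts'"
proof -
  have "map2 act_tape (map (f (map read_tape ts)) [0..<length (map read_tape ts)]) ts = ts'"
    using assms by (intro nth_equalityI) auto
  then show ?thesis
    using exec_Act[of "\<lambda>rs. map (f rs) [0..<length rs]" ts] by (auto simp: runs_def act_tapes_def)
qed

lemma wf_act_tapes:
  "(\<And>rs i. set rs \<subseteq> {..<4} \<Longrightarrow> length rs = K \<Longrightarrow> i < K \<Longrightarrow> fst (f rs i) < 4) \<Longrightarrow>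
    wf_prog K (act_tapes f)"
  by (auto simp: act_tapes_def)

definition moves :: "(nat \<times> move) list \<Rightarrow> nat \<Rightarrow> move" where
  "moves ms i = (case map_of ms i of None \<Rightarrow> Stay | Some m \<Rightarrow> m)"

definition move_heads :: "(nat \<Rightarrow> move) \<Rightarrow> prog" where
  "move_heads F = act_tapes (\<lambda>rs i. (rs ! i, F i))"

lemma wf_move_heads [simp]: "wf_prog K (move_heads F)"
  unfolding move_heads_def by (rule wf_act_tapes) (auto simp: subset_iff)

definition shift_heads :: "(nat \<Rightarrow> int) \<Rightarrow> tape list \<Rightarrow> tape list" where
  "shift_heads \<delta> ts = map (\<lambda>i. (fst (ts ! i), snd (ts ! i) + \<delta> i)) [0..<length ts]"

lemma length_shift_heads [simp]: "length (shift_heads \<delta> ts) = length ts"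
  by (simp add: shift_heads_def)

lemma nth_shift_heads [simp]:
  "i < length ts \<Longrightarrow> shift_heads \<delta> ts ! i = (fst (ts ! i), snd (ts ! i) + \<delta> i)"
  by (simp add: shift_heads_def)

lemma shift_heads_shift_heads: "shift_heads \<delta> (shift_heads \<epsilon> ts) = shift_heads (\<lambda>i. \<epsilon> i + \<delta> i) ts"
  by (rule nth_equalityI) (auto simp: add.assoc)

lemma runs_move_heads: "runs (move_heads F) ts 1 (shift_heads (\<lambda>i. move_offset (F i)) ts)"
  unfolding move_heads_def by (rule runs_act_tapes) (auto simp: act_tape_eq read_tape_eq)

lemma runs_While_move_heads:
  assumes "\<And>j. j < n \<Longrightarrow> P (map read_tape (shift_heads (\<lambda>i. int j * move_offset (F i)) ts))"
    and "\<not> P (map read_tape (shift_heads (\<lambda>i. int n * move_offset (F i)) ts))"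
  shows "runs (While P (move_heads F)) ts (3 * n + 1) (shift_heads (\<lambda>i. int n * move_offset (F i)) ts)"
proof -
  define S where "S j = shift_heads (\<lambda>i. int j * move_offset (F i)) ts" for j
  have "runs (move_heads F) (S j) 1 (S (Suc j))" for j
    using runs_move_heads[of F "S j"]
    by (simp add: S_def shift_heads_shift_heads distrib_right add.commute)
  then have "runs (While P (move_heads F)) (S 0) (n * (1 + 2) + 1) (S n)"
    using assms by (intro runs_While) (simp_all add: S_def)
  from runs_mono[OF this, of "3 * n + 1"] have "runs (While P (move_heads F)) (S 0) (3 * n + 1) (S n)"
    by simp
  moreover have "S 0 = ts" by (auto simp: S_def intro: nth_equalityI)
  ultimately show ?thesis by (simp add: S_def)
qed

lemma shift_heads_mem:
  assumes "\<delta> 0 = 0" "\<delta> 2 = 0" "int h' = int h + \<delta> 1"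
    and "\<And>r. r < R \<Longrightarrow> int (\<rho>' r) = int (\<rho> r) + \<delta> (r + 3)"
  shows "shift_heads \<delta> (mem R x h s \<rho> out) = mem R x h' s \<rho>' out"
proof (rule nth_equalityI)
  fix i assume "i < length (shift_heads \<delta> (mem R x h s \<rho> out))"
  then have "i < R + 3" by simp
  then show "shift_heads \<delta> (mem R x h s \<rho> out) ! i = mem R x h' s \<rho>' out ! i"
    using assms by (cases rule: tape_index_cases) (auto simp: symbol_tape_def counter_tape_def)
qed simp

lemma runs_move_heads_mem:
  assumes "F 0 = Stay" "F 2 = Stay" "int h' = int h + move_offset (F 1)"
    and "\<And>r. r < R \<Longrightarrow> int (\<rho>' r) = int (\<rho> r) + move_offset (F (r + 3))"
  shows "runs (move_heads F) (mem R x h s \<rho> out) 1 (mem R x h' s \<rho>' out)"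
  using runs_move_heads[of F "mem R x h s \<rho> out"] assms by (subst (asm) shift_heads_mem) auto

definition skip :: prog where
  "skip = move_heads (\<lambda>_. Stay)"

lemma wf_skip [simp]: "wf_prog K skip"
  by (simp add: skip_def)

lemma runs_skip: "runs skip (mem R x h s \<rho> out) 1 (mem R x h s \<rho> out)"
  unfolding skip_def by (rule runs_move_heads_mem) auto

definition nonzero :: "nat set \<Rightarrow> nat list \<Rightarrow> bool" where
  "nonzero D rs \<longleftrightarrow> (\<forall>d\<in>D. rs ! (d + 3) \<noteq> 3)"

lemma nonzero_mem: "D \<subseteq> {..<R} \<Longrightarrow>
    nonzero D (map read_tape (mem R x h s \<rho> out)) \<longleftrightarrow> (\<forall>d\<in>D. \<rho> d \<noteq> 0)"
  by (auto simp: nonzero_def counter_tape_def subset_iff)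

definition move_loop :: "nat set \<Rightarrow> (nat \<Rightarrow> move) \<Rightarrow> prog" where
  "move_loop D F = While (nonzero D) (move_heads F)"

lemma wf_move_loop [simp]: "wf_prog K (move_loop D F)"
  by (simp add: move_loop_def)

text \<open>The loop stops as soon as one of the counters in \<open>D\<close>, which all decrease, is zero.\<close>
lemma runs_move_loop:
  assumes counters: "D \<subseteq> {..<R}" "\<And>d. d \<in> D \<Longrightarrow> F (d + 3) = Left \<and> n \<le> \<rho> d" "d \<in> D" "\<rho> d = n"
    and fixed: "F 0 = Stay" "F 2 = Stay" "int h' = int h + int n * move_offset (F 1)"
    and moved: "\<And>r. r < R \<Longrightarrow> int (\<rho>' r) = int (\<rho> r) + int n * move_offset (F (r + 3))"
  shows "runs (move_loop D F) (mem R x h s \<rho> out) (3 * n + 1) (mem R x h' s \<rho>' out)"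
proof -
  let ?S = "\<lambda>j. shift_heads (\<lambda>i. int j * move_offset (F i)) (mem R x h s \<rho> out)"
  have marked: "read_tape (?S j ! (e + 3)) = 3 \<longleftrightarrow> \<rho> e = j" if "e \<in> D" for e j
    using counters(1,2) that by (auto simp: counter_tape_def subset_iff)
  have "runs (move_loop D F) (mem R x h s \<rho> out) (3 * n + 1) (?S n)"
    unfolding move_loop_def
  proof (rule runs_While_move_heads)
    show "nonzero D (map read_tape (?S j))" if "j < n" for j
      using marked counters(1,2) that by (force simp: nonzero_def subset_iff)
    show "\<not> nonzero D (map read_tape (?S n))"
      using marked counters(1,3,4) by (force simp: nonzero_def subset_iff)
  qed
  moreover have "?S n = mem R x h' s \<rho>' out"
    using fixed moved by (intro shift_heads_mem) auto
  ultimately show ?thesis by simp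
qed

definition inc :: "nat \<Rightarrow> prog" where
  "inc r = move_heads (moves [(r + 3, Right)])"

definition dec :: "nat \<Rightarrow> prog" where
  "dec r = move_heads (moves [(r + 3, Left)])"

definition transfer :: "nat \<Rightarrow> nat \<Rightarrow> prog" where
  "transfer d e = move_loop {d} (moves [(d + 3, Left), (e + 3, Right)])"

definition clear :: "nat \<Rightarrow> prog" where
  "clear d = move_loop {d} (moves [(d + 3, Left)])"

lemma wf_counter_ops [simp]: "wf_prog K (inc r)" "wf_prog K (dec r)"
  "wf_prog K (transfer d e)" "wf_prog K (clear d)"
  by (simp_all add: inc_def dec_def transfer_def clear_def)

lemma runs_inc: "runs (inc r) (mem R x h s \<rho> out) 1 (mem R x h s (\<rho>(r := \<rho> r + 1)) out)"
  unfolding inc_def by (intro runs_move_heads_mem) (auto simp: moves_def)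

lemma runs_dec:
  "\<rho> r \<noteq> 0 \<Longrightarrow> runs (dec r) (mem R x h s \<rho> out) 1 (mem R x h s (\<rho>(r := \<rho> r - 1)) out)"
  unfolding dec_def by (intro runs_move_heads_mem) (auto simp: moves_def)

lemma runs_transfer:
  assumes "d < R" "e < R" "d \<noteq> e" "\<rho>' = \<rho>(d := 0, e := \<rho> e + \<rho> d)"
  shows "runs (transfer d e) (mem R x h s \<rho> out) (3 * \<rho> d + 1) (mem R x h s \<rho>' out)"
  unfolding transfer_def using assms
  by (intro runs_move_loop[where d = d]) (auto simp: moves_def)

lemma runs_clear:
  assumes "d < R"
  shows "runs (clear d) (mem R x h s \<rho> out) (3 * \<rho> d + 1) (mem R x h s (\<rho>(d := 0)) out)"
  unfolding clear_def using assms
  by (intro runs_move_loop[where d = d]) (auto simp: moves_def)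

definition emit_bit :: "bool \<Rightarrow> prog" where
  "emit_bit b = act_tapes (\<lambda>rs i. if i = 0 then (if b then 2 else 1, Right) else stay (rs ! i))"

lemma wf_emit_bit [simp]: "wf_prog K (emit_bit b)"
  unfolding emit_bit_def by (rule wf_act_tapes) (auto simp: subset_iff)

lemma runs_emit_bit: "runs (emit_bit b) (mem R x h s \<rho> out) 1 (mem R x h s \<rho> (out @ [b]))"
  unfolding emit_bit_def
proof (rule runs_act_tapes)
  fix i assume "i < length (mem R x h s \<rho> out)"
  then have "i < R + 3" by simp
  then show "act_tape (if i = 0 then (if b then 2 else 1, Right)
      else stay (map read_tape (mem R x h s \<rho> out) ! i)) (mem R x h s \<rho> out ! i) =
      mem R x h s \<rho> (out @ [b]) ! i"
    by (cases rule: tape_index_cases) (auto simp: word_cells_snoc stay_def act_tape_eq read_tape_eq)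
qed simp

text \<open>Symbols are capped at 3, the largest tape symbol.\<close>
definition update_symbol :: "(nat list \<Rightarrow> nat) \<Rightarrow> (nat \<Rightarrow> move) \<Rightarrow> prog" where
  "update_symbol f F =
     act_tapes (\<lambda>rs i. if i = 2 then (min 3 (f rs), Stay) else (rs ! i, F i))"

lemma wf_update_symbol [simp]: "wf_prog K (update_symbol f F)"
  unfolding update_symbol_def by (rule wf_act_tapes) (auto simp: subset_iff)

lemma runs_update_symbol:
  assumes "F 0 = Stay" "int h' = int h + move_offset (F 1)"
    and "\<And>r. r < R \<Longrightarrow> int (\<rho>' r) = int (\<rho> r) + move_offset (F (r + 3))"
    and "s' = min 3 (f (map read_tape (mem R x h s \<rho> out)))"
  shows "runs (update_symbol f F) (mem R x h s \<rho> out) 1 (mem R x h' s' \<rho>' out)"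
  unfolding update_symbol_def
proof (rule runs_act_tapes)
  fix i assume "i < length (mem R x h s \<rho> out)"
  then have "i < R + 3" by simp
  then show "act_tape (if i = 2 then (min 3 (f (map read_tape (mem R x h s \<rho> out))), Stay)
      else (map read_tape (mem R x h s \<rho> out) ! i, F i)) (mem R x h s \<rho> out ! i) =
      mem R x h' s' \<rho>' out ! i"
    using assms
    by (cases rule: tape_index_cases) (auto simp: symbol_tape_def counter_tape_def act_tape_eq)
qed simp

definition automaton_loop :: "(nat \<Rightarrow> nat \<Rightarrow> nat) \<Rightarrow> nat \<Rightarrow> prog" where
  "automaton_loop \<delta> d = While (nonzero {d})
     (update_symbol (\<lambda>rs. \<delta> (rs ! 2) (rs ! 1)) (moves [(1, Right), (d + 3, Left), (d + 4, Right)]))"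

definition unload_symbol :: "nat \<Rightarrow> prog" where
  "unload_symbol d =
     While (\<lambda>rs. rs ! 2 \<noteq> 0) (update_symbol (\<lambda>rs. rs ! 2 - 1) (moves [(d + 3, Right)]))"

definition automaton_prog :: "(nat \<Rightarrow> nat \<Rightarrow> nat) \<Rightarrow> nat \<Rightarrow> nat \<Rightarrow> prog" where
  "automaton_prog \<delta> q d = Seq (update_symbol (\<lambda>_. q) (\<lambda>_. Stay)) (Seq (automaton_loop \<delta> d)
     (Seq (move_loop {d + 1} (moves [(1, Left), (d + 4, Left)])) (unload_symbol d)))"

lemma wf_automaton_prog [simp]: "wf_prog K (automaton_prog \<delta> q d)"
  by (simp add: automaton_prog_def automaton_loop_def unload_symbol_def)

text \<open>
  States are capped at 3 since the current one is stored as a tape symbol. Beyond the end of the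
  input the automaton reads blanks.
\<close>
fun automaton :: "(nat \<Rightarrow> nat \<Rightarrow> nat) \<Rightarrow> nat \<Rightarrow> bool list \<Rightarrow> nat \<Rightarrow> nat" where
  "automaton \<delta> q x 0 = min 3 q"
| "automaton \<delta> q x (Suc n) = min 3 (\<delta> (automaton \<delta> q x n) (word_cells x (int n)))"

lemma automaton_le: "automaton \<delta> q x n \<le> 3"
  by (cases n) auto

lemma runs_automaton_loop:
  assumes regs: "d + 1 < R" and zero: "\<rho> (d + 1) = 0"
  shows "runs (automaton_loop \<delta> d) (mem R x 0 (automaton \<delta> q x 0) \<rho> out) (3 * \<rho> d + 1)
    (mem R x (\<rho> d) (automaton \<delta> q x (\<rho> d)) (\<rho>(d := 0, d + 1 := \<rho> d)) out)"
proof -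
  let ?S = "\<lambda>j. mem R x j (automaton \<delta> q x j) (\<rho>(d := \<rho> d - j, d + 1 := j)) out"
  have "runs (automaton_loop \<delta> d) (?S 0) (\<rho> d * (1 + 2) + 1) (?S (\<rho> d))"
    unfolding automaton_loop_def
  proof (rule runs_While[where S = ?S])
    show "nonzero {d} (map read_tape (?S j))" if "j < \<rho> d" for j
      using that regs by (simp add: nonzero_mem)
    show "runs (update_symbol (\<lambda>rs. \<delta> (rs ! 2) (rs ! 1))
        (moves [(1, Right), (d + 3, Left), (d + 4, Right)])) (?S j) 1 (?S (Suc j))" if "j < \<rho> d" for j
      using that by (intro runs_update_symbol) (auto simp: moves_def symbol_tape_def)
    show "\<not> nonzero {d} (map read_tape (?S (\<rho> d)))"
      using regs by (simp add: nonzero_mem)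
  qed
  from runs_mono[OF this, of "3 * \<rho> d + 1"]
  have "runs (automaton_loop \<delta> d) (?S 0) (3 * \<rho> d + 1) (?S (\<rho> d))"
    by simp
  moreover have "\<rho>(d := \<rho> d, d + 1 := 0) = \<rho>" using zero by auto
  ultimately show ?thesis by simp
qed

lemma runs_unload_symbol:
  assumes "\<rho> d = 0" "s \<le> 3"
  shows "runs (unload_symbol d) (mem R x h s \<rho> out) (3 * s + 1) (mem R x h 0 (\<rho>(d := s)) out)"
proof -
  let ?S = "\<lambda>j. mem R x h (s - j) (\<rho>(d := j)) out"
  have "runs (unload_symbol d) (?S 0) (s * (1 + 2) + 1) (?S s)"
    unfolding unload_symbol_def
  proof (rule runs_While[where S = ?S])
    show "map read_tape (?S j) ! 2 \<noteq> 0" if "j < s" for j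
      using that by (simp add: symbol_tape_def)
    show "runs (update_symbol (\<lambda>rs. rs ! 2 - 1) (moves [(d + 3, Right)])) (?S j) 1 (?S (Suc j))"
      if "j < s" for j
      using assms(2) that by (intro runs_update_symbol) (auto simp: moves_def symbol_tape_def)
    show "\<not> map read_tape (?S s) ! 2 \<noteq> 0"
      by (simp add: symbol_tape_def)
  qed
  from runs_mono[OF this, of "3 * s + 1"] have "runs (unload_symbol d) (?S 0) (3 * s + 1) (?S s)"
    by simp
  moreover have "\<rho>(d := 0) = \<rho>" using assms(1) by auto
  ultimately show ?thesis by simp
qed

lemma runs_automaton_prog:
  assumes regs: "d + 1 < R" and zero: "\<rho> (d + 1) = 0"
  shows "runs (automaton_prog \<delta> q d) (mem R x 0 0 \<rho> out) (6 * \<rho> d + 13)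
    (mem R x 0 0 (\<rho>(d := automaton \<delta> q x (\<rho> d))) out)"
proof -
  let ?a = "automaton \<delta> q x (\<rho> d)"
  have start: "runs (update_symbol (\<lambda>_. q) (\<lambda>_. Stay)) (mem R x 0 0 \<rho> out) 1
      (mem R x 0 (automaton \<delta> q x 0) \<rho> out)"
    by (rule runs_update_symbol) auto
  have loop: "runs (automaton_loop \<delta> d) (mem R x 0 (automaton \<delta> q x 0) \<rho> out) (3 * \<rho> d + 1)
      (mem R x (\<rho> d) ?a (\<rho>(d := 0, d + 1 := \<rho> d)) out)"
    using regs zero by (rule runs_automaton_loop)
  have rewind: "runs (move_loop {d + 1} (moves [(1, Left), (d + 4, Left)]))
      (mem R x (\<rho> d) ?a (\<rho>(d := 0, d + 1 := \<rho> d)) out) (3 * \<rho> d + 1) (mem R x 0 ?a (\<rho>(d := 0)) out)"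
    using regs zero by (intro runs_move_loop[where d = "d + 1"]) (auto simp: moves_def)
  have unload: "runs (unload_symbol d) (mem R x 0 ?a (\<rho>(d := 0)) out) (3 * ?a + 1)
      (mem R x 0 0 (\<rho>(d := ?a)) out)"
    using runs_unload_symbol[of "\<rho>(d := 0)" d ?a] automaton_le by simp
  show ?thesis
    unfolding automaton_prog_def
    by (rule runs_mono[OF runs_Seq[OF start
          runs_Seq[OF loop runs_Seq[OF rewind unload]]]])
      (use automaton_le[of \<delta> q x "\<rho> d"] in simp)
qed


section \<open>Compiling arithmetic expressions\<close>

datatype nexp =
    Var nat
  | Num nat
  | Add nexp nexp
  | Sub nexp nexp
  | Cond nexp nexp nexp
  | Sum nat nexp nexp
  | Aut "nat \<Rightarrow> nat \<Rightarrow> nat" nat nexp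

fun nval :: "bool list \<Rightarrow> (nat \<Rightarrow> nat) \<Rightarrow> nexp \<Rightarrow> nat" where
  "nval x \<rho> (Var i) = \<rho> i"
| "nval x \<rho> (Num n) = n"
| "nval x \<rho> (Add a b) = nval x \<rho> a + nval x \<rho> b"
| "nval x \<rho> (Sub a b) = nval x \<rho> a - nval x \<rho> b"
| "nval x \<rho> (Cond c a b) = (if nval x \<rho> c \<noteq> 0 then nval x \<rho> a else nval x \<rho> b)"
| "nval x \<rho> (Sum i e b) = (\<Sum>k<nval x \<rho> e. nval x (\<rho>(i := k)) b)"
| "nval x \<rho> (Aut \<delta> q e) = automaton \<delta> q x (nval x \<rho> e)"

fun nvars :: "nexp \<Rightarrow> nat set" where
  "nvars (Var i) = {i}"
| "nvars (Num n) = {}"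
| "nvars (Add a b) = nvars a \<union> nvars b"
| "nvars (Sub a b) = nvars a \<union> nvars b"
| "nvars (Cond c a b) = nvars c \<union> nvars a \<union> nvars b"
| "nvars (Sum i e b) = insert i (nvars e \<union> nvars b)"
| "nvars (Aut \<delta> q e) = nvars e"

lemma finite_nvars [simp]: "finite (nvars e)"
  by (induction e) auto

fun nregs :: "nexp \<Rightarrow> nat" where
  "nregs (Var i) = 2"
| "nregs (Num n) = 1"
| "nregs (Add a b) = nregs a + nregs b + 2"
| "nregs (Sub a b) = nregs a + nregs b + 2"
| "nregs (Cond c a b) = nregs c + nregs a + nregs b + 1"
| "nregs (Sum i e b) = nregs e + nregs b + 4"
| "nregs (Aut \<delta> q e) = nregs e + 2"

lemma nval_cong: "(\<And>i. i \<in> nvars e \<Longrightarrow> \<rho> i = \<rho>' i) \<Longrightarrow> nval x \<rho> e = nval x \<rho>' e"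
proof (induction e arbitrary: \<rho> \<rho>')
  case (Add a b)
  then show ?case by (metis UnCI nval.simps(3) nvars.simps(3))
next
  case (Sub a b)
  then show ?case by (metis UnCI nval.simps(4) nvars.simps(4))
next
  case (Cond c a b)
  then show ?case by (metis UnCI nval.simps(5) nvars.simps(5))
next
  case (Sum i e b)
  have "nval x \<rho> e = nval x \<rho>' e" using Sum.prems by (intro Sum.IH(1)) simp
  moreover have "nval x (\<rho>(i := k)) b = nval x (\<rho>'(i := k)) b" for k
    using Sum.prems by (intro Sum.IH(2)) simp
  ultimately show ?case by simp
next
  case (Aut \<delta> q e)
  then show ?case by (metis nval.simps(7) nvars.simps(7))
qed simp_all

fun add_const :: "nat \<Rightarrow> nat \<Rightarrow> prog" where
  "add_const d 0 = skip"
| "add_const d (Suc n) = Seq (add_const d n) (inc d)"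

definition if_prog :: "nat \<Rightarrow> prog \<Rightarrow> prog \<Rightarrow> prog \<Rightarrow> prog" where
  "if_prog d test c c' = Seq test (Branch (nonzero {d}) (Seq (clear d) c) c')"

text \<open>
  Counter \<open>d\<close> holds the number of remaining rounds, and counter \<open>d + 1\<close> saves the value of the loop
  variable \<open>i\<close>.
\<close>
definition for_loop :: "nat \<Rightarrow> nat \<Rightarrow> prog \<Rightarrow> prog" where
  "for_loop d i c = Seq (transfer i (d + 1))
     (Seq (While (nonzero {d}) (Seq (dec d) (Seq c (inc i))))
     (Seq (clear i) (transfer (d + 1) i)))"

text \<open>
  The program stores the value in counter \<open>d\<close> and leaves all other counters unchanged; it
  needs the counters from \<open>d\<close> on to be zero and uses them as a stack.
\<close>
fun nprog :: "nat \<Rightarrow> nexp \<Rightarrow> prog" where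
  "nprog d (Var i) = Seq (move_loop {i} (moves [(i + 3, Left), (d + 3, Right), (d + 4, Right)]))
     (transfer (d + 1) i)"
| "nprog d (Num n) = add_const d n"
| "nprog d (Add a b) = Seq (nprog d a) (Seq (nprog (d + 1) b) (transfer (d + 1) d))"
| "nprog d (Sub a b) = Seq (nprog d a) (Seq (nprog (d + 1) b)
     (Seq (move_loop {d, d + 1} (moves [(d + 3, Left), (d + 4, Left)])) (clear (d + 1))))"
| "nprog d (Cond c a b) = if_prog d (nprog d c) (nprog d a) (nprog d b)"
| "nprog d (Sum i e b) = Seq (nprog d e)
     (Seq (for_loop d i (Seq (nprog (d + 3) b) (transfer (d + 3) (d + 2)))) (transfer (d + 2) d))"
| "nprog d (Aut \<delta> q e) = Seq (nprog d e) (automaton_prog \<delta> q d)"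

lemma wf_add_const [simp]: "wf_prog K (add_const d n)"
  by (induction n) auto

lemma wf_if_prog [simp]:
  "wf_prog K (if_prog d test c c') \<longleftrightarrow> wf_prog K test \<and> wf_prog K c \<and> wf_prog K c'"
  by (simp add: if_prog_def)

lemma wf_for_loop [simp]: "wf_prog K (for_loop d i c) \<longleftrightarrow> wf_prog K c"
  by (simp add: for_loop_def)

lemma wf_nprog [simp]: "wf_prog K (nprog d e)"
  by (induction e arbitrary: d) auto

lemma runs_add_const:
  "runs (add_const d n) (mem R x h s \<rho> out) (n + 1) (mem R x h s (\<rho>(d := \<rho> d + n)) out)"
proof (induction n)
  case 0
  show ?case using runs_skip by simp
next
  case (Suc n)
  have "runs (inc d) (mem R x h s (\<rho>(d := \<rho> d + n)) out) 1 (mem R x h s (\<rho>(d := \<rho> d + Suc n)) out)"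
    using runs_inc[of d R x h s "\<rho>(d := \<rho> d + n)" out] by simp
  then show ?case
    unfolding add_const.simps by (rule runs_mono[OF runs_Seq[OF Suc]]) simp
qed

lemma runs_for_loop_rounds:
  fixes \<sigma> :: "nat \<Rightarrow> nat \<Rightarrow> nat" and out :: "nat \<Rightarrow> bool list"
  assumes i_less: "i < d" and regs: "d + 1 < R"
    and body: "\<And>j. j < n \<Longrightarrow>
      runs c (mem R x 0 0 ((\<sigma> j)(i := j, d := n - Suc j, d + 1 := v)) (out j)) b
        (mem R x 0 0 ((\<sigma> (Suc j))(i := j, d := n - Suc j, d + 1 := v)) (out (Suc j)))"
  shows "runs (While (nonzero {d}) (Seq (dec d) (Seq c (inc i))))
    (mem R x 0 0 ((\<sigma> 0)(i := 0, d := n, d + 1 := v)) (out 0)) (n * (b + 4) + 1)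
    (mem R x 0 0 ((\<sigma> n)(i := n, d := 0, d + 1 := v)) (out n))"
proof -
  let ?S = "\<lambda>j. mem R x 0 0 ((\<sigma> j)(i := j, d := n - j, d + 1 := v)) (out j)"
  have "runs (While (nonzero {d}) (Seq (dec d) (Seq c (inc i)))) (?S 0) (n * (b + 2 + 2) + 1) (?S n)"
  proof (rule runs_While[where S = ?S])
    fix j assume j_less: "j < n"
    show "nonzero {d} (map read_tape (?S j))"
      using i_less regs j_less by (subst nonzero_mem) auto
    have "runs (dec d) (?S j) 1 (mem R x 0 0 ((\<sigma> j)(i := j, d := n - Suc j, d + 1 := v)) (out j))"
      using runs_dec[of "(\<sigma> j)(i := j, d := n - j, d + 1 := v)" d] i_less j_less
      by (simp add: fun_upd_twist)
    moreover have "runs (inc i)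
        (mem R x 0 0 ((\<sigma> (Suc j))(i := j, d := n - Suc j, d + 1 := v)) (out (Suc j))) 1 (?S (Suc j))"
      using runs_inc[of i R x 0 0 "(\<sigma> (Suc j))(i := j, d := n - Suc j, d + 1 := v)"] i_less
      by (simp add: fun_upd_twist)
    ultimately have "runs (Seq (dec d) (Seq c (inc i))) (?S j) (1 + (b + 1)) (?S (Suc j))"
      using body[OF j_less] by (intro runs_Seq)
    then show "runs (Seq (dec d) (Seq c (inc i))) (?S j) (b + 2) (?S (Suc j))" by simp
  next
    show "\<not> nonzero {d} (map read_tape (?S n))"
      using i_less regs by (subst nonzero_mem) auto
  qed
  moreover have "b + 2 + 2 = b + 4" by simp
  ultimately show ?thesis by (simp only: diff_zero diff_self_eq_0)
qed

lemma runs_for_loop: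
  fixes \<sigma> :: "nat \<Rightarrow> nat \<Rightarrow> nat" and out :: "nat \<Rightarrow> bool list"
  assumes i_less: "i < d" and regs: "d + 1 < R"
    and saved: "\<And>j. j \<le> n \<Longrightarrow> \<sigma> j i = v" and zero: "\<And>j. j \<le> n \<Longrightarrow> \<sigma> j (d + 1) = 0"
    and body: "\<And>j. j < n \<Longrightarrow>
      runs c (mem R x 0 0 ((\<sigma> j)(i := j, d := n - Suc j, d + 1 := v)) (out j)) b
        (mem R x 0 0 ((\<sigma> (Suc j))(i := j, d := n - Suc j, d + 1 := v)) (out (Suc j)))"
  shows "runs (for_loop d i c) (mem R x 0 0 ((\<sigma> 0)(d := n)) (out 0))
    (6 * v + 3 * n + n * (b + 4) + 4) (mem R x 0 0 ((\<sigma> n)(d := 0)) (out n))"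
proof -
  have save: "runs (transfer i (d + 1)) (mem R x 0 0 ((\<sigma> 0)(d := n)) (out 0)) (3 * v + 1)
      (mem R x 0 0 ((\<sigma> 0)(i := 0, d := n, d + 1 := v)) (out 0))"
    using runs_transfer[of i R "d + 1" "(\<sigma> 0)(i := 0, d := n, d + 1 := v)" "(\<sigma> 0)(d := n)"]
      i_less regs saved[of 0] zero[of 0] by (simp add: fun_upd_twist)
  have reset: "runs (clear i) (mem R x 0 0 ((\<sigma> n)(i := n, d := 0, d + 1 := v)) (out n)) (3 * n + 1)
      (mem R x 0 0 ((\<sigma> n)(i := 0, d := 0, d + 1 := v)) (out n))"
    using runs_clear[of i R x 0 0 "(\<sigma> n)(i := n, d := 0, d + 1 := v)"] i_less regs
    by (simp add: fun_upd_twist)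
  have restore: "runs (transfer (d + 1) i) (mem R x 0 0 ((\<sigma> n)(i := 0, d := 0, d + 1 := v)) (out n))
      (3 * v + 1) (mem R x 0 0 ((\<sigma> n)(d := 0)) (out n))"
    using runs_transfer[of "d + 1" R i "(\<sigma> n)(d := 0)" "(\<sigma> n)(i := 0, d := 0, d + 1 := v)"]
      i_less regs saved[of n] zero[of n] by (simp add: fun_eq_iff)
  note rounds = runs_for_loop_rounds[where \<sigma> = \<sigma> and out = out, OF i_less regs body]
  show ?thesis
    unfolding for_loop_def
    by (rule runs_mono[OF runs_Seq[OF save runs_Seq[OF rounds runs_Seq[OF reset restore]]]])
      (simp_all add: algebra_simps)
qed

definition admissible :: "nat set \<Rightarrow> nat \<Rightarrow> nat \<Rightarrow> (nat \<Rightarrow> nat) \<Rightarrow> bool" where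
  "admissible V d m \<rho> \<longleftrightarrow> (\<forall>r\<in>V. \<rho> r \<le> m) \<and> (\<forall>r\<ge>d. \<rho> r = 0)"

lemma admissible_Un:
  "admissible (V \<union> W) d m \<rho> \<longleftrightarrow> admissible V d m \<rho> \<and> admissible W d m \<rho>"
  by (auto simp: admissible_def)

lemma admissible_loop_body:
  assumes "admissible V d m \<rho>" "W \<subseteq> V" "V \<subseteq> {..<d}" "j \<le> n" "d \<le> d'"
    and "\<And>r. r < d \<Longrightarrow> \<sigma> r = (\<rho>(i := j)) r" "\<And>r. d' \<le> r \<Longrightarrow> \<sigma> r = 0"
  shows "admissible W d' (m + n) \<sigma>"
  using assms unfolding admissible_def by (auto simp: subset_iff intro: trans_le_add1)

definition nprog_within :: "nat \<Rightarrow> nat \<Rightarrow> nexp \<Rightarrow> (nat \<Rightarrow> nat) \<Rightarrow> bool" where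
  "nprog_within R d e f \<longleftrightarrow> (\<forall>x \<rho> out m. admissible (nvars e) d m \<rho> \<longrightarrow> nval x \<rho> e \<le> f m \<and>
     runs (nprog d e) (mem R x 0 0 \<rho> out) (f m) (mem R x 0 0 (\<rho>(d := nval x \<rho> e)) out))"

lemma nprog_withinI:
  assumes "\<And>x \<rho> out m. admissible (nvars e) d m \<rho> \<Longrightarrow> nval x \<rho> e \<le> f m"
    and "\<And>x \<rho> out m. admissible (nvars e) d m \<rho> \<Longrightarrow>
      runs (nprog d e) (mem R x 0 0 \<rho> out) (f m) (mem R x 0 0 (\<rho>(d := nval x \<rho> e)) out)"
  shows "nprog_within R d e f"
  using assms by (simp add: nprog_within_def)

lemma nprog_withinD:
  assumes "nprog_within R d e f" "admissible (nvars e) d m \<rho>"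
  shows "nval x \<rho> e \<le> f m"
    "runs (nprog d e) (mem R x 0 0 \<rho> out) (f m) (mem R x 0 0 (\<rho>(d := nval x \<rho> e)) out)"
  using assms by (simp_all add: nprog_within_def)

lemma nprog_within_Var:
  assumes "i < d" "d + 2 \<le> R"
  shows "nprog_within R d (Var i) (\<lambda>m. 6 * m + 2)"
proof (rule nprog_withinI)
  fix x out m and \<rho> :: "nat \<Rightarrow> nat"
  assume adm: "admissible (nvars (Var i)) d m \<rho>"
  then show "nval x \<rho> (Var i) \<le> 6 * m + 2" by (simp add: admissible_def)
  have zero: "\<rho> d = 0" "\<rho> (d + 1) = 0" using adm by (auto simp: admissible_def)
  have copy: "runs (move_loop {i} (moves [(i + 3, Left), (d + 3, Right), (d + 4, Right)]))
      (mem R x 0 0 \<rho> out) (3 * \<rho> i + 1) (mem R x 0 0 (\<rho>(i := 0, d := \<rho> i, d + 1 := \<rho> i)) out)"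
    using assms zero by (intro runs_move_loop[where d = i]) (auto simp: moves_def)
  have restore: "runs (transfer (d + 1) i) (mem R x 0 0 (\<rho>(i := 0, d := \<rho> i, d + 1 := \<rho> i)) out)
      (3 * (\<rho>(i := 0, d := \<rho> i, d + 1 := \<rho> i)) (d + 1) + 1) (mem R x 0 0 (\<rho>(d := \<rho> i)) out)"
    using assms zero by (intro runs_transfer) (auto simp: fun_eq_iff)
  show "runs (nprog d (Var i)) (mem R x 0 0 \<rho> out) (6 * m + 2)
      (mem R x 0 0 (\<rho>(d := nval x \<rho> (Var i))) out)"
    using runs_mono[OF runs_Seq[OF copy restore]] adm by (simp add: admissible_def)
qed

lemma nprog_within_Num: "nprog_within R d (Num n) (\<lambda>_. n + 1)"
proof (rule nprog_withinI)
  fix x out m and \<rho> :: "nat \<Rightarrow> nat"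
  assume "admissible (nvars (Num n)) d m \<rho>"
  then show "runs (nprog d (Num n)) (mem R x 0 0 \<rho> out) (n + 1)
      (mem R x 0 0 (\<rho>(d := nval x \<rho> (Num n))) out)"
    using runs_add_const[of d n R x 0 0 \<rho> out] by (simp add: admissible_def)
qed simp

lemma nprog_within_pushD:
  assumes within_e: "nprog_within R (d + 1) e f" and adm: "admissible (nvars e) d m \<rho>"
    and vars: "nvars e \<subseteq> {..<d}"
  shows "nval x \<rho> e \<le> f m"
    "runs (nprog (d + 1) e) (mem R x 0 0 (\<rho>(d := v)) out) (f m)
      (mem R x 0 0 (\<rho>(d := v, d + 1 := nval x \<rho> e)) out)"
proof -
  have eq: "nval x (\<rho>(d := v)) e = nval x \<rho> e" using vars by (intro nval_cong) auto
  have "admissible (nvars e) (d + 1) m (\<rho>(d := v))"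
    using adm vars by (auto simp: admissible_def)
  from nprog_withinD[OF within_e this, of x, unfolded eq] show "nval x \<rho> e \<le> f m"
    "runs (nprog (d + 1) e) (mem R x 0 0 (\<rho>(d := v)) out) (f m)
      (mem R x 0 0 (\<rho>(d := v, d + 1 := nval x \<rho> e)) out)" .
qed

lemma nprog_within_Add:
  assumes within_a: "nprog_within R d a f" and within_b: "nprog_within R (d + 1) b g"
    and regs: "d + 2 \<le> R" and vars: "nvars b \<subseteq> {..<d}"
  shows "nprog_within R d (Add a b) (\<lambda>m. f m + (g m + (3 * g m + 1)))"
proof (rule nprog_withinI)
  fix x out m and \<rho> :: "nat \<Rightarrow> nat"
  assume adm: "admissible (nvars (Add a b)) d m \<rho>"
  have left: "nval x \<rho> a \<le> f m"
    "runs (nprog d a) (mem R x 0 0 \<rho> out) (f m) (mem R x 0 0 (\<rho>(d := nval x \<rho> a)) out)"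
    using nprog_withinD[OF within_a] adm by (simp_all add: admissible_Un)
  have right: "nval x \<rho> b \<le> g m" "runs (nprog (d + 1) b) (mem R x 0 0 (\<rho>(d := nval x \<rho> a)) out)
      (g m) (mem R x 0 0 (\<rho>(d := nval x \<rho> a, d + 1 := nval x \<rho> b)) out)"
    using nprog_within_pushD[OF within_b _ vars] adm by (simp_all add: admissible_Un)
  show "nval x \<rho> (Add a b) \<le> f m + (g m + (3 * g m + 1))"
    using left(1) right(1) by simp
  have add: "runs (transfer (d + 1) d) (mem R x 0 0 (\<rho>(d := nval x \<rho> a, d + 1 := nval x \<rho> b)) out)
      (3 * (\<rho>(d := nval x \<rho> a, d + 1 := nval x \<rho> b)) (d + 1) + 1)
      (mem R x 0 0 (\<rho>(d := nval x \<rho> a + nval x \<rho> b)) out)"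
    using regs adm by (intro runs_transfer) (auto simp: admissible_def)
  show "runs (nprog d (Add a b)) (mem R x 0 0 \<rho> out) (f m + (g m + (3 * g m + 1)))
      (mem R x 0 0 (\<rho>(d := nval x \<rho> (Add a b))) out)"
    using runs_mono[OF runs_Seq[OF left(2) runs_Seq[OF right(2) add]]] right(1) by simp
qed

lemma nprog_within_Sub:
  assumes within_a: "nprog_within R d a f" and within_b: "nprog_within R (d + 1) b g"
    and regs: "d + 2 \<le> R" and vars: "nvars b \<subseteq> {..<d}"
  shows "nprog_within R d (Sub a b) (\<lambda>m. f m + (g m + (3 * f m + 1 + (3 * g m + 1))))"
proof (rule nprog_withinI)
  fix x out m and \<rho> :: "nat \<Rightarrow> nat"
  assume adm: "admissible (nvars (Sub a b)) d m \<rho>"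
  let ?a = "nval x \<rho> a" and ?b = "nval x \<rho> b"
  let ?\<rho> = "\<rho>(d := ?a - ?b, d + 1 := ?b - min ?a ?b)"
  have left: "?a \<le> f m" "runs (nprog d a) (mem R x 0 0 \<rho> out) (f m) (mem R x 0 0 (\<rho>(d := ?a)) out)"
    using nprog_withinD[OF within_a] adm by (simp_all add: admissible_Un)
  have right: "?b \<le> g m" "runs (nprog (d + 1) b) (mem R x 0 0 (\<rho>(d := ?a)) out) (g m)
      (mem R x 0 0 (\<rho>(d := ?a, d + 1 := ?b)) out)"
    using nprog_within_pushD[OF within_b _ vars] adm by (simp_all add: admissible_Un)
  show "nval x \<rho> (Sub a b) \<le> f m + (g m + (3 * f m + 1 + (3 * g m + 1)))"
    using left(1) by simp
  have subtract: "runs (move_loop {d, d + 1} (moves [(d + 3, Left), (d + 4, Left)]))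
      (mem R x 0 0 (\<rho>(d := ?a, d + 1 := ?b)) out) (3 * min ?a ?b + 1) (mem R x 0 0 ?\<rho> out)"
    using regs
    by (intro runs_move_loop[where d = "if ?a \<le> ?b then d else d + 1"]) (auto simp: moves_def)
  have "?\<rho>(d + 1 := 0) = \<rho>(d := ?a - ?b)" using adm by (auto simp: admissible_def)
  then have clear: "runs (clear (d + 1)) (mem R x 0 0 ?\<rho> out) (3 * (?b - min ?a ?b) + 1)
      (mem R x 0 0 (\<rho>(d := ?a - ?b)) out)"
    using runs_clear[of "d + 1" R x 0 0 ?\<rho> out] regs by simp
  show "runs (nprog d (Sub a b)) (mem R x 0 0 \<rho> out) (f m + (g m + (3 * f m + 1 + (3 * g m + 1))))
      (mem R x 0 0 (\<rho>(d := nval x \<rho> (Sub a b))) out)"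
    unfolding nprog.simps nval.simps
    by (rule runs_mono[OF runs_Seq[OF left(2) runs_Seq[OF right(2) runs_Seq[OF subtract clear]]]])
      (use left(1) right(1) in simp)
qed

lemma runs_if_prog:
  assumes within_e: "nprog_within R d e f" and regs: "d < R" and adm: "admissible (nvars e) d m \<rho>"
    and true: "nval x \<rho> e \<noteq> 0 \<Longrightarrow> runs c (mem R x 0 0 \<rho> out) t ts"
    and false: "nval x \<rho> e = 0 \<Longrightarrow> runs c' (mem R x 0 0 \<rho> out) t ts"
  shows "runs (if_prog d (nprog d e) c c') (mem R x 0 0 \<rho> out) (4 * f m + t + 3) ts"
proof -
  let ?e = "nval x \<rho> e"
  have zero: "\<rho> d = 0" using adm by (simp add: admissible_def)
  have test: "?e \<le> f m" "runs (nprog d e) (mem R x 0 0 \<rho> out) (f m) (mem R x 0 0 (\<rho>(d := ?e)) out)"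
    using nprog_withinD[OF within_e adm] by auto
  have "runs (Branch (nonzero {d}) (Seq (clear d) c) c') (mem R x 0 0 (\<rho>(d := ?e)) out)
      (3 * f m + 1 + t + 2) ts"
  proof (cases "?e = 0")
    case True
    then have "\<rho>(d := ?e) = \<rho>" using zero by auto
    moreover have "\<not> nonzero {d} (map read_tape (mem R x 0 0 \<rho> out))"
      using zero regs by (subst nonzero_mem) auto
    ultimately show ?thesis
      using runs_mono[OF runs_Branch_False[where P = "nonzero {d}", OF _ false[OF True]]] by simp
  next
    case False
    have "nonzero {d} (map read_tape (mem R x 0 0 (\<rho>(d := ?e)) out))"
      using False regs by (subst nonzero_mem) auto
    moreover have "\<rho>(d := ?e, d := 0) = \<rho>" using zero by auto
    then have "runs (clear d) (mem R x 0 0 (\<rho>(d := ?e)) out) (3 * ?e + 1) (mem R x 0 0 \<rho> out)"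
      using runs_clear[OF regs, of x 0 0 "\<rho>(d := ?e)" out] by simp
    then have "runs (Seq (clear d) c) (mem R x 0 0 (\<rho>(d := ?e)) out) (3 * f m + 1 + t) ts"
      using test(1) by (intro runs_mono[OF runs_Seq[OF _ true[OF False]]]) auto
    ultimately show ?thesis by (rule runs_Branch_True)
  qed
  then show ?thesis
    unfolding if_prog_def by (rule runs_mono[OF runs_Seq[OF test(2)]]) simp
qed

lemma nprog_within_Cond:
  assumes within_c: "nprog_within R d c f" and within_a: "nprog_within R d a g"
    and within_b: "nprog_within R d b h" and regs: "d < R"
  shows "nprog_within R d (Cond c a b) (\<lambda>m. 4 * f m + (g m + h m) + 3)"
proof (rule nprog_withinI)
  fix x out m and \<rho> :: "nat \<Rightarrow> nat"
  assume adm: "admissible (nvars (Cond c a b)) d m \<rho>"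
  have true: "nval x \<rho> a \<le> g m"
    "runs (nprog d a) (mem R x 0 0 \<rho> out) (g m) (mem R x 0 0 (\<rho>(d := nval x \<rho> a)) out)"
    using nprog_withinD[OF within_a] adm by (simp_all add: admissible_Un)
  have false: "nval x \<rho> b \<le> h m"
    "runs (nprog d b) (mem R x 0 0 \<rho> out) (h m) (mem R x 0 0 (\<rho>(d := nval x \<rho> b)) out)"
    using nprog_withinD[OF within_b] adm by (simp_all add: admissible_Un)
  show "nval x \<rho> (Cond c a b) \<le> 4 * f m + (g m + h m) + 3"
    using true(1) false(1) by simp
  show "runs (nprog d (Cond c a b)) (mem R x 0 0 \<rho> out) (4 * f m + (g m + h m) + 3)
      (mem R x 0 0 (\<rho>(d := nval x \<rho> (Cond c a b))) out)"
    unfolding nprog.simps using adm regs runs_mono[OF true(2)] runs_mono[OF false(2)]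
    by (intro runs_if_prog[OF within_c]) (auto simp: admissible_Un)
qed

lemma nprog_within_Aut:
  assumes within_e: "nprog_within R d e f" and regs: "d + 1 < R"
  shows "nprog_within R d (Aut \<delta> q e) (\<lambda>m. f m + (6 * f m + 13))"
proof (rule nprog_withinI)
  fix x out m and \<rho> :: "nat \<Rightarrow> nat"
  assume "admissible (nvars (Aut \<delta> q e)) d m \<rho>"
  then have adm: "admissible (nvars e) d m \<rho>" by simp
  let ?e = "nval x \<rho> e"
  show "nval x \<rho> (Aut \<delta> q e) \<le> f m + (6 * f m + 13)"
    using automaton_le[of \<delta> q x ?e] by simp
  have "runs (automaton_prog \<delta> q d) (mem R x 0 0 (\<rho>(d := ?e)) out) (6 * ?e + 13)
      (mem R x 0 0 (\<rho>(d := automaton \<delta> q x ?e)) out)"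
    using runs_automaton_prog[OF regs, of "\<rho>(d := ?e)"] adm by (simp add: admissible_def)
  then show "runs (nprog d (Aut \<delta> q e)) (mem R x 0 0 \<rho> out) (f m + (6 * f m + 13))
      (mem R x 0 0 (\<rho>(d := nval x \<rho> (Aut \<delta> q e))) out)"
    using runs_mono[OF runs_Seq[OF nprog_withinD(2)[OF within_e adm]]]
      nprog_withinD(1)[OF within_e adm] by simp
qed

lemma runs_sum_body:
  assumes within_b: "nprog_within R (d + 3) b g" and regs: "d + 4 \<le> R" and i_less: "i < d"
    and adm: "admissible (insert i (nvars b)) d m \<rho>" and vars: "nvars b \<subseteq> {..<d}"
    and j_less: "j < n" "n \<le> k"
  shows "nval x (\<rho>(i := j)) b \<le> g (m + k)"
    "runs (Seq (nprog (d + 3) b) (transfer (d + 3) (d + 2)))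
      (mem R x 0 0 (\<rho>(d + 2 := s, i := j, d := n - Suc j, d + 1 := v)) out) (4 * g (m + k) + 1)
      (mem R x 0 0 (\<rho>(d + 2 := s + nval x (\<rho>(i := j)) b, i := j, d := n - Suc j, d + 1 := v)) out)"
proof -
  let ?\<rho> = "\<rho>(d + 2 := s, i := j, d := n - Suc j, d + 1 := v)" and ?b = "nval x (\<rho>(i := j)) b"
  have "nval x ?\<rho> b = ?b" using vars i_less by (intro nval_cong) auto
  moreover have "admissible (nvars b) (d + 3) (m + k) ?\<rho>"
    using adm vars i_less j_less
    by (intro admissible_loop_body[OF adm, where j = j]) (auto simp: admissible_def)
  ultimately have body: "?b \<le> g (m + k)" "runs (nprog (d + 3) b) (mem R x 0 0 ?\<rho> out) (g (m + k))
      (mem R x 0 0 (?\<rho>(d + 3 := ?b)) out)"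
    using nprog_withinD[OF within_b, of "m + k" ?\<rho> x] by auto
  show "?b \<le> g (m + k)" by (rule body)
  have add: "runs (transfer (d + 3) (d + 2)) (mem R x 0 0 (?\<rho>(d + 3 := ?b)) out)
      (3 * (?\<rho>(d + 3 := ?b)) (d + 3) + 1)
      (mem R x 0 0 (\<rho>(d + 2 := s + ?b, i := j, d := n - Suc j, d + 1 := v)) out)"
    using regs i_less adm by (intro runs_transfer) (auto simp: fun_eq_iff admissible_def)
  show "runs (Seq (nprog (d + 3) b) (transfer (d + 3) (d + 2))) (mem R x 0 0 ?\<rho> out)
      (4 * g (m + k) + 1) (mem R x 0 0 (\<rho>(d + 2 := s + ?b, i := j, d := n - Suc j, d + 1 := v)) out)"
    by (rule runs_mono[OF runs_Seq[OF body(2) add]]) (use body(1) in simp)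
qed

lemma runs_sum_loop:
  assumes within_b: "nprog_within R (d + 3) b g" and regs: "d + 4 \<le> R" and i_less: "i < d"
    and adm: "admissible (insert i (nvars b)) d m \<rho>" and vars: "nvars b \<subseteq> {..<d}" and n_le: "n \<le> k"
  shows "(\<Sum>j<n. nval x (\<rho>(i := j)) b) \<le> k * g (m + k)"
    "runs (for_loop d i (Seq (nprog (d + 3) b) (transfer (d + 3) (d + 2))))
      (mem R x 0 0 (\<rho>(d := n)) out) (6 * m + 3 * k + k * (4 * g (m + k) + 1 + 4) + 4)
      (mem R x 0 0 (\<rho>(d + 2 := \<Sum>j<n. nval x (\<rho>(i := j)) b)) out)"
proof -
  define s where "s j = (\<Sum>k<j. nval x (\<rho>(i := k)) b)" for j
  note body = runs_sum_body[OF within_b regs i_less adm vars _ n_le]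
  have "(\<Sum>j<n. nval x (\<rho>(i := j)) b) \<le> (\<Sum>j<n. g (m + k))"
    using body(1) by (intro sum_mono) simp
  also have "\<dots> \<le> k * g (m + k)" using n_le by simp
  finally show "(\<Sum>j<n. nval x (\<rho>(i := j)) b) \<le> k * g (m + k)" .
  have "runs (Seq (nprog (d + 3) b) (transfer (d + 3) (d + 2)))
      (mem R x 0 0 (\<rho>(d + 2 := s j, i := j, d := n - Suc j, d + 1 := \<rho> i)) out)
      (4 * g (m + k) + 1)
      (mem R x 0 0 (\<rho>(d + 2 := s (Suc j), i := j, d := n - Suc j, d + 1 := \<rho> i)) out)"
    if "j < n" for j
    using body(2)[OF that, where s = "s j" and v = "\<rho> i" and out = out] by (simp add: s_def)
  then have rounds: "runs (for_loop d i (Seq (nprog (d + 3) b) (transfer (d + 3) (d + 2))))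
      (mem R x 0 0 (\<rho>(d + 2 := s 0, d := n)) out)
      (6 * \<rho> i + 3 * n + n * (4 * g (m + k) + 1 + 4) + 4)
      (mem R x 0 0 (\<rho>(d + 2 := s n, d := 0)) out)"
    using i_less regs adm
    by (intro runs_for_loop[where \<sigma> = "\<lambda>j. \<rho>(d + 2 := s j)" and out = "\<lambda>_. out"])
      (auto simp: admissible_def)
  have bound: "6 * \<rho> i + 3 * n + n * (4 * g (m + k) + 1 + 4) + 4 \<le>
      6 * m + 3 * k + k * (4 * g (m + k) + 1 + 4) + 4"
    using n_le adm by (intro add_mono mult_le_mono order_refl) (auto simp: admissible_def)
  have "\<rho>(d + 2 := s 0, d := n) = \<rho>(d := n)" "\<rho>(d + 2 := s n, d := 0) = \<rho>(d + 2 := s n)"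
    using adm by (auto simp: admissible_def s_def)
  from runs_mono[OF rounds bound, unfolded this]
  show "runs (for_loop d i (Seq (nprog (d + 3) b) (transfer (d + 3) (d + 2))))
      (mem R x 0 0 (\<rho>(d := n)) out) (6 * m + 3 * k + k * (4 * g (m + k) + 1 + 4) + 4)
      (mem R x 0 0 (\<rho>(d + 2 := \<Sum>j<n. nval x (\<rho>(i := j)) b)) out)"
    by (simp only: s_def)
qed

lemma nprog_within_Sum:
  assumes within_e: "nprog_within R d e f" and within_b: "nprog_within R (d + 3) b g"
    and regs: "d + 4 \<le> R" and vars: "i < d" "nvars b \<subseteq> {..<d}"
  shows "nprog_within R d (Sum i e b) (\<lambda>m. f m +
    (6 * m + 3 * f m + f m * (4 * g (m + f m) + 1 + 4) + 4 + (3 * (f m * g (m + f m)) + 1)))"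
proof (rule nprog_withinI)
  fix x out m and \<rho> :: "nat \<Rightarrow> nat"
  assume adm: "admissible (nvars (Sum i e b)) d m \<rho>"
  let ?n = "nval x \<rho> e" and ?s = "nval x \<rho> (Sum i e b)"
  have count: "?n \<le> f m" "runs (nprog d e) (mem R x 0 0 \<rho> out) (f m) (mem R x 0 0 (\<rho>(d := ?n)) out)"
    using nprog_withinD[OF within_e, of m \<rho> x] adm by (simp_all add: admissible_def)
  have "admissible (insert i (nvars b)) d m \<rho>" using adm by (simp add: admissible_def)
  note loop = runs_sum_loop[OF within_b regs vars(1) this vars(2) count(1)]
  have sum: "?s \<le> f m * g (m + f m)" using loop(1)[of x] by simp
  then show "?s \<le> f m +
      (6 * m + 3 * f m + f m * (4 * g (m + f m) + 1 + 4) + 4 + (3 * (f m * g (m + f m)) + 1))"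
    by linarith
  have collect: "runs (transfer (d + 2) d) (mem R x 0 0 (\<rho>(d + 2 := ?s)) out)
      (3 * (\<rho>(d + 2 := ?s)) (d + 2) + 1) (mem R x 0 0 (\<rho>(d := ?s)) out)"
    using regs adm by (intro runs_transfer) (auto simp: admissible_def fun_eq_iff)
  show "runs (nprog d (Sum i e b)) (mem R x 0 0 \<rho> out) (f m +
      (6 * m + 3 * f m + f m * (4 * g (m + f m) + 1 + 4) + 4 + (3 * (f m * g (m + f m)) + 1)))
      (mem R x 0 0 (\<rho>(d := ?s)) out)"
    unfolding nprog.simps nval.simps
    by (rule runs_mono[OF runs_Seq[OF count(2) runs_Seq[OF loop(2) collect[unfolded nval.simps]]]])
      (use sum in simp)
qed

definition nprog_poly :: "nat \<Rightarrow> nat \<Rightarrow> nexp \<Rightarrow> bool" where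
  "nprog_poly R d e \<longleftrightarrow> (\<exists>f. poly_bounded f \<and> nprog_within R d e f)"

lemma nprog_polyI: "nprog_within R d e f \<Longrightarrow> poly_bounded f \<Longrightarrow> nprog_poly R d e"
  by (auto simp: nprog_poly_def)

lemma nprog_polyE:
  assumes "nprog_poly R d e"
  obtains f where "poly_bounded f" "nprog_within R d e f"
  using assms by (auto simp: nprog_poly_def)

lemma nprog_poly_Add:
  assumes "nprog_poly R d a" "nprog_poly R (d + 1) b" "d + 2 \<le> R" "nvars b \<subseteq> {..<d}"
  shows "nprog_poly R d (Add a b)"
  using assms
  by (elim nprog_polyE)
    (rule nprog_polyI[OF nprog_within_Add], assumption+, (intro poly_bounded_intros | assumption)+)

lemma nprog_poly_Sub:
  assumes "nprog_poly R d a" "nprog_poly R (d + 1) b" "d + 2 \<le> R" "nvars b \<subseteq> {..<d}"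
  shows "nprog_poly R d (Sub a b)"
  using assms
  by (elim nprog_polyE)
    (rule nprog_polyI[OF nprog_within_Sub], assumption+, (intro poly_bounded_intros | assumption)+)

lemma nprog_poly_Cond:
  assumes "nprog_poly R d c" "nprog_poly R d a" "nprog_poly R d b" "d < R"
  shows "nprog_poly R d (Cond c a b)"
  using assms
  by (elim nprog_polyE)
    (rule nprog_polyI[OF nprog_within_Cond], assumption+, (intro poly_bounded_intros | assumption)+)

lemma nprog_poly_Sum:
  assumes "nprog_poly R d e" "nprog_poly R (d + 3) b" "d + 4 \<le> R" "i < d" "nvars b \<subseteq> {..<d}"
  shows "nprog_poly R d (Sum i e b)"
proof -
  obtain f where within_e: "poly_bounded f" "nprog_within R d e f"
    using assms(1) by (rule nprog_polyE)
  obtain g where within_b: "poly_bounded g" "nprog_within R (d + 3) b g"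
    using assms(2) by (rule nprog_polyE)
  have "poly_bounded (\<lambda>m. g (m + f m))"
    by (intro poly_bounded_compose[OF within_b(1)] poly_bounded_intros within_e(1))
  then show ?thesis
    by (intro nprog_polyI[OF nprog_within_Sum[OF within_e(2) within_b(2) assms(3-5)]]
        poly_bounded_intros within_e(1))
qed

lemma nprog_poly_Aut: "nprog_poly R d e \<Longrightarrow> d + 1 < R \<Longrightarrow> nprog_poly R d (Aut \<delta> q e)"
  by (elim nprog_polyE)
    (rule nprog_polyI[OF nprog_within_Aut], assumption+, (intro poly_bounded_intros | assumption)+)

lemma nprog_poly_nregs: "nvars e \<subseteq> {..<d} \<Longrightarrow> d + nregs e \<le> R \<Longrightarrow> nprog_poly R d e"
proof (induction e arbitrary: d)
  case (Var i)
  then show ?case by (intro nprog_polyI[OF nprog_within_Var] poly_bounded_intros) auto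
next
  case (Num n)
  show ?case by (rule nprog_polyI[OF nprog_within_Num poly_bounded_const])
next
  case (Add a b)
  then have "nprog_poly R (d + 1) b" by (intro Add.IH(2)) auto
  with Add show ?case by (intro nprog_poly_Add) auto
next
  case (Sub a b)
  then have "nprog_poly R (d + 1) b" by (intro Sub.IH(2)) auto
  with Sub show ?case by (intro nprog_poly_Sub) auto
next
  case (Cond c a b)
  then show ?case by (intro nprog_poly_Cond) auto
next
  case (Sum i e b)
  then have "nprog_poly R (d + 3) b" by (intro Sum.IH(2)) auto
  with Sum show ?case by (intro nprog_poly_Sum) auto
next
  case (Aut \<delta> q e)
  then show ?case by (intro nprog_poly_Aut) auto
qed


section \<open>Compiling word expressions\<close>

datatype wexp =
    Bit nexp
  | Empty
  | Cat wexp wexp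
  | When nexp wexp
  | For nat nexp wexp

fun wval :: "bool list \<Rightarrow> (nat \<Rightarrow> nat) \<Rightarrow> wexp \<Rightarrow> bool list" where
  "wval x \<rho> (Bit e) = [nval x \<rho> e \<noteq> 0]"
| "wval x \<rho> Empty = []"
| "wval x \<rho> (Cat a b) = wval x \<rho> a @ wval x \<rho> b"
| "wval x \<rho> (When c a) = (if nval x \<rho> c \<noteq> 0 then wval x \<rho> a else [])"
| "wval x \<rho> (For i e a) = concat (map (\<lambda>k. wval x (\<rho>(i := k)) a) [0..<nval x \<rho> e])"

fun wvars :: "wexp \<Rightarrow> nat set" where
  "wvars (Bit e) = nvars e"
| "wvars Empty = {}"
| "wvars (Cat a b) = wvars a \<union> wvars b"
| "wvars (When c a) = nvars c \<union> wvars a"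
| "wvars (For i e a) = insert i (nvars e \<union> wvars a)"

lemma finite_wvars [simp]: "finite (wvars w)"
  by (induction w) auto

fun wregs :: "wexp \<Rightarrow> nat" where
  "wregs (Bit e) = nregs e + 1"
| "wregs Empty = 0"
| "wregs (Cat a b) = wregs a + wregs b"
| "wregs (When c a) = nregs c + wregs a + 1"
| "wregs (For i e a) = nregs e + wregs a + 2"

lemma wval_cong: "(\<And>i. i \<in> wvars w \<Longrightarrow> \<rho> i = \<rho>' i) \<Longrightarrow> wval x \<rho> w = wval x \<rho>' w"
proof (induction w arbitrary: \<rho> \<rho>')
  case (Bit e)
  then show ?case by (metis nval_cong wval.simps(1) wvars.simps(1))
next
  case (Cat a b)
  then show ?case by (metis UnCI wval.simps(3) wvars.simps(3))
next
  case (When c a)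
  then show ?case by (metis UnCI nval_cong wval.simps(4) wvars.simps(4))
next
  case (For i e a)
  have "nval x \<rho> e = nval x \<rho>' e" using For.prems by (intro nval_cong) simp
  moreover have "wval x (\<rho>(i := k)) a = wval x (\<rho>'(i := k)) a" for k
    using For.prems by (intro For.IH) simp
  ultimately show ?case by simp
qed simp

fun wprog :: "nat \<Rightarrow> wexp \<Rightarrow> prog" where
  "wprog d (Bit e) = if_prog d (nprog d e) (emit_bit True) (emit_bit False)"
| "wprog d Empty = skip"
| "wprog d (Cat a b) = Seq (wprog d a) (wprog d b)"
| "wprog d (When c a) = if_prog d (nprog d c) (wprog d a) skip"
| "wprog d (For i e a) = Seq (nprog d e) (for_loop d i (wprog (d + 2) a))"

lemma wf_wprog [simp]: "wf_prog K (wprog d w)"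
  by (induction w arbitrary: d) auto

definition wprog_within :: "nat \<Rightarrow> nat \<Rightarrow> wexp \<Rightarrow> (nat \<Rightarrow> nat) \<Rightarrow> bool" where
  "wprog_within R d w f \<longleftrightarrow> (\<forall>x \<rho> out m. admissible (wvars w) d m \<rho> \<longrightarrow>
     runs (wprog d w) (mem R x 0 0 \<rho> out) (f m) (mem R x 0 0 \<rho> (out @ wval x \<rho> w)))"

lemma wprog_withinI:
  assumes "\<And>x \<rho> out m. admissible (wvars w) d m \<rho> \<Longrightarrow>
    runs (wprog d w) (mem R x 0 0 \<rho> out) (f m) (mem R x 0 0 \<rho> (out @ wval x \<rho> w))"
  shows "wprog_within R d w f"
  using assms by (simp add: wprog_within_def)

lemma wprog_withinD:
  assumes "wprog_within R d w f" "admissible (wvars w) d m \<rho>"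
  shows "runs (wprog d w) (mem R x 0 0 \<rho> out) (f m) (mem R x 0 0 \<rho> (out @ wval x \<rho> w))"
  using assms by (simp add: wprog_within_def)

lemma wprog_within_Bit:
  assumes within_e: "nprog_within R d e f" and regs: "d < R"
  shows "wprog_within R d (Bit e) (\<lambda>m. 4 * f m + 1 + 3)"
proof (rule wprog_withinI)
  fix x out m and \<rho> :: "nat \<Rightarrow> nat"
  assume adm: "admissible (wvars (Bit e)) d m \<rho>"
  then show "runs (wprog d (Bit e)) (mem R x 0 0 \<rho> out) (4 * f m + 1 + 3)
      (mem R x 0 0 \<rho> (out @ wval x \<rho> (Bit e)))"
    unfolding wprog.simps wval.simps
    by (intro runs_if_prog[OF within_e regs]) (simp_all add: runs_emit_bit[unfolded One_nat_def])
qed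

lemma wprog_within_Empty: "wprog_within R d Empty (\<lambda>_. 1)"
  by (rule wprog_withinI) (simp add: runs_skip[unfolded One_nat_def])

lemma wprog_within_Cat:
  assumes "wprog_within R d a f" "wprog_within R d b g"
  shows "wprog_within R d (Cat a b) (\<lambda>m. f m + g m)"
proof (rule wprog_withinI)
  fix x out m and \<rho> :: "nat \<Rightarrow> nat"
  assume "admissible (wvars (Cat a b)) d m \<rho>"
  then have "admissible (wvars a) d m \<rho>" "admissible (wvars b) d m \<rho>"
    by (simp_all add: admissible_Un)
  then show "runs (wprog d (Cat a b)) (mem R x 0 0 \<rho> out) (f m + g m)
      (mem R x 0 0 \<rho> (out @ wval x \<rho> (Cat a b)))"
    using runs_Seq[OF wprog_withinD[OF assms(1)] wprog_withinD[OF assms(2)]] by simp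
qed

lemma wprog_within_When:
  assumes within_c: "nprog_within R d c f" and within_a: "wprog_within R d a g" and regs: "d < R"
  shows "wprog_within R d (When c a) (\<lambda>m. 4 * f m + (g m + 1) + 3)"
proof (rule wprog_withinI)
  fix x out m and \<rho> :: "nat \<Rightarrow> nat"
  assume "admissible (wvars (When c a)) d m \<rho>"
  then have adm: "admissible (nvars c) d m \<rho>" "admissible (wvars a) d m \<rho>"
    by (simp_all add: admissible_Un)
  show "runs (wprog d (When c a)) (mem R x 0 0 \<rho> out) (4 * f m + (g m + 1) + 3)
      (mem R x 0 0 \<rho> (out @ wval x \<rho> (When c a)))"
    unfolding wprog.simps
    using runs_mono[OF wprog_withinD[OF within_a adm(2)]] runs_mono[OF runs_skip]
    by (intro runs_if_prog[OF within_c regs adm(1)]) simp_all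
qed

lemma runs_word_loop:
  assumes within_a: "wprog_within R (d + 2) a g" and regs: "d + 2 \<le> R" and i_less: "i < d"
    and adm: "admissible (insert i (wvars a)) d m \<rho>" and vars: "wvars a \<subseteq> {..<d}" and n_le: "n \<le> k"
  shows "runs (for_loop d i (wprog (d + 2) a)) (mem R x 0 0 (\<rho>(d := n)) out)
    (6 * m + 3 * k + k * (g (m + k) + 4) + 4)
    (mem R x 0 0 \<rho> (out @ concat (map (\<lambda>j. wval x (\<rho>(i := j)) a) [0..<n])))"
proof -
  define out' where "out' j = out @ concat (map (\<lambda>j. wval x (\<rho>(i := j)) a) [0..<j])" for j
  have "runs (wprog (d + 2) a) (mem R x 0 0 (\<rho>(i := j, d := n - Suc j, d + 1 := \<rho> i)) (out' j))
      (g (m + k)) (mem R x 0 0 (\<rho>(i := j, d := n - Suc j, d + 1 := \<rho> i)) (out' (Suc j)))"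
    if j_less: "j < n" for j
  proof -
    let ?\<rho> = "\<rho>(i := j, d := n - Suc j, d + 1 := \<rho> i)"
    have "wval x ?\<rho> a = wval x (\<rho>(i := j)) a" using vars i_less by (intro wval_cong) auto
    moreover have "admissible (wvars a) (d + 2) (m + k) ?\<rho>"
      by (rule admissible_loop_body[OF adm, where j = j])
        (use adm vars i_less j_less n_le in \<open>auto simp: admissible_def\<close>)
    ultimately show ?thesis
      using wprog_withinD[OF within_a, of "m + k" ?\<rho> x "out' j"] by (simp add: out'_def)
  qed
  then have rounds: "runs (for_loop d i (wprog (d + 2) a)) (mem R x 0 0 (\<rho>(d := n)) (out' 0))
      (6 * \<rho> i + 3 * n + n * (g (m + k) + 4) + 4) (mem R x 0 0 (\<rho>(d := 0)) (out' n))"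
    using i_less regs adm by (intro runs_for_loop) (auto simp: admissible_def)
  have "\<rho>(d := 0) = \<rho>" using adm by (auto simp: admissible_def)
  moreover have "6 * \<rho> i + 3 * n + n * (g (m + k) + 4) + 4 \<le> 6 * m + 3 * k + k * (g (m + k) + 4) + 4"
    using n_le adm by (intro add_mono mult_le_mono order_refl) (auto simp: admissible_def)
  ultimately show ?thesis using runs_mono[OF rounds] by (simp add: out'_def)
qed

lemma wprog_within_For:
  assumes within_e: "nprog_within R d e f" and within_a: "wprog_within R (d + 2) a g"
    and regs: "d + 2 \<le> R" and vars: "i < d" "wvars a \<subseteq> {..<d}"
  shows "wprog_within R d (For i e a)
    (\<lambda>m. f m + (6 * m + 3 * f m + f m * (g (m + f m) + 4) + 4))"
proof (rule wprog_withinI)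
  fix x out m and \<rho> :: "nat \<Rightarrow> nat"
  assume "admissible (wvars (For i e a)) d m \<rho>"
  then have adm: "admissible (nvars e) d m \<rho>" "admissible (insert i (wvars a)) d m \<rho>"
    by (simp_all add: admissible_def)
  note count = nprog_withinD[OF within_e adm(1)]
  show "runs (wprog d (For i e a)) (mem R x 0 0 \<rho> out)
      (f m + (6 * m + 3 * f m + f m * (g (m + f m) + 4) + 4))
      (mem R x 0 0 \<rho> (out @ wval x \<rho> (For i e a)))"
    unfolding wprog.simps wval.simps
    by (rule runs_Seq[OF count(2) runs_word_loop[OF within_a regs vars(1) adm(2) vars(2) count(1)]])
qed

definition wprog_poly :: "nat \<Rightarrow> nat \<Rightarrow> wexp \<Rightarrow> bool" where
  "wprog_poly R d w \<longleftrightarrow> (\<exists>f. poly_bounded f \<and> wprog_within R d w f)"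

lemma wprog_polyI: "wprog_within R d w f \<Longrightarrow> poly_bounded f \<Longrightarrow> wprog_poly R d w"
  by (auto simp: wprog_poly_def)

lemma wprog_polyE:
  assumes "wprog_poly R d w"
  obtains f where "poly_bounded f" "wprog_within R d w f"
  using assms by (auto simp: wprog_poly_def)

lemma wprog_poly_Bit: "nprog_poly R d e \<Longrightarrow> d < R \<Longrightarrow> wprog_poly R d (Bit e)"
  by (elim nprog_polyE)
    (rule wprog_polyI[OF wprog_within_Bit], assumption+, (intro poly_bounded_intros | assumption)+)

lemma wprog_poly_Cat: "wprog_poly R d a \<Longrightarrow> wprog_poly R d b \<Longrightarrow> wprog_poly R d (Cat a b)"
  by (elim wprog_polyE)
    (rule wprog_polyI[OF wprog_within_Cat], assumption+, (intro poly_bounded_intros | assumption)+)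

lemma wprog_poly_When:
  assumes "nprog_poly R d c" "wprog_poly R d a" "d < R"
  shows "wprog_poly R d (When c a)"
  using assms
  by (elim nprog_polyE wprog_polyE)
    (rule wprog_polyI[OF wprog_within_When], assumption+, (intro poly_bounded_intros | assumption)+)

lemma wprog_poly_For:
  assumes "nprog_poly R d e" "wprog_poly R (d + 2) a" "d + 2 \<le> R" "i < d" "wvars a \<subseteq> {..<d}"
  shows "wprog_poly R d (For i e a)"
proof -
  obtain f where within_e: "poly_bounded f" "nprog_within R d e f"
    using assms(1) by (rule nprog_polyE)
  obtain g where within_a: "poly_bounded g" "wprog_within R (d + 2) a g"
    using assms(2) by (rule wprog_polyE)
  have "poly_bounded (\<lambda>m. g (m + f m))"
    by (intro poly_bounded_compose[OF within_a(1)] poly_bounded_intros within_e(1))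
  then show ?thesis
    by (intro wprog_polyI[OF wprog_within_For[OF within_e(2) within_a(2) assms(3-5)]]
        poly_bounded_intros within_e(1))
qed

lemma wprog_poly_wregs: "wvars w \<subseteq> {..<d} \<Longrightarrow> d + wregs w \<le> R \<Longrightarrow> wprog_poly R d w"
proof (induction w arbitrary: d)
  case (Bit e)
  then show ?case by (intro wprog_poly_Bit nprog_poly_nregs) auto
next
  case Empty
  show ?case by (rule wprog_polyI[OF wprog_within_Empty poly_bounded_const])
next
  case (Cat a b)
  then show ?case by (intro wprog_poly_Cat) auto
next
  case (When c a)
  then show ?case by (intro wprog_poly_When nprog_poly_nregs) auto
next
  case (For i e a)
  then have "wprog_poly R (d + 2) a" by (intro For.IH) auto
  with For show ?case by (intro wprog_poly_For nprog_poly_nregs) auto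
qed


section \<open>Word expressions as polynomial-time functions\<close>

definition rewind :: "nat set \<Rightarrow> nat \<Rightarrow> prog" where
  "rewind J i = Seq (move_heads (\<lambda>j. if j \<in> J then Left else Stay))
     (Seq (While (\<lambda>rs. rs ! i \<noteq> 0) (move_heads (\<lambda>j. if j \<in> J then Left else Stay)))
       (move_heads (\<lambda>j. if j \<in> J then Right else Stay)))"

lemma wf_rewind [simp]: "wf_prog K (rewind J i)"
  by (simp add: rewind_def)

lemma runs_rewind:
  assumes at_end: "i \<in> J" "i < length ts" "ts ! i = (word_cells x, int (length x))"
  shows "runs (rewind J i) ts (3 * length x + 3)
    (shift_heads (\<lambda>j. if j \<in> J then - int (length x) else 0) ts)"
proof -
  let ?left = "\<lambda>j. if j \<in> J then Left else Stay" and ?n = "length x"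
  let ?ts = "shift_heads (\<lambda>j. move_offset (?left j)) ts"
  let ?blank = "shift_heads (\<lambda>j. int ?n * move_offset (?left j)) ?ts"
  have loop: "runs (While (\<lambda>rs. rs ! i \<noteq> 0) (move_heads ?left)) ?ts (3 * ?n + 1) ?blank"
    by (rule runs_While_move_heads) (use at_end in \<open>auto simp: word_cells_eq_0_iff\<close>)
  have "shift_heads (\<lambda>j. move_offset (if j \<in> J then Right else Stay)) ?blank =
      shift_heads (\<lambda>j. if j \<in> J then - int ?n else 0) ts"
    unfolding shift_heads_shift_heads by (rule arg_cong[where f = "\<lambda>\<delta>. shift_heads \<delta> ts"]) auto
  then have return: "runs (move_heads (\<lambda>j. if j \<in> J then Right else Stay)) ?blank 1
      (shift_heads (\<lambda>j. if j \<in> J then - int ?n else 0) ts)"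
    using runs_move_heads[of "\<lambda>j. if j \<in> J then Right else Stay" ?blank] by simp
  show ?thesis
    unfolding rewind_def
    by (rule runs_mono[OF runs_Seq[OF runs_move_heads runs_Seq[OF loop return]]]) simp
qed

definition copy_loop :: prog where
  "copy_loop = While (\<lambda>rs. rs ! 0 \<noteq> 0) (act_tapes (\<lambda>rs i.
     if i = 0 then (0, Right) else if i = 1 then (rs ! 0, Right) else (rs ! i, moves [(3, Right)] i)))"

definition load_prog :: prog where
  "load_prog = Seq (act_tapes (\<lambda>rs i. if i < 3 then stay (rs ! i) else (3, Stay)))
     (Seq copy_loop (rewind {0, 1} 1))"

lemma wf_load_prog [simp]:
  assumes "1 \<le> K"
  shows "wf_prog K load_prog"
proof -
  have "rs ! 0 < 4" if "set rs \<subseteq> {..<4::nat}" "length rs = K" for rs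
  proof -
    have "rs ! 0 \<in> set rs" using assms that(2) by (intro nth_mem) simp
    then show ?thesis using that(1) by auto
  qed
  then show ?thesis
    unfolding load_prog_def copy_loop_def
    by (auto intro!: wf_act_tapes simp: subset_iff)
qed

definition copied :: "nat \<Rightarrow> bool list \<Rightarrow> nat \<Rightarrow> tape list" where
  "copied R x j = (\<lambda>p. if p < int j then 0 else word_cells x p, int j) #
     (\<lambda>p. if p < int j then word_cells x p else 0, int j) # symbol_tape 0 #
     map (\<lambda>r. counter_tape (if r = 0 then j else 0)) [0..<R]"

lemma copied_nth [simp]:
  "length (copied R x j) = R + 3"
  "copied R x j ! 0 = (\<lambda>p. if p < int j then 0 else word_cells x p, int j)"
  "copied R x j ! Suc 0 = (\<lambda>p. if p < int j then word_cells x p else 0, int j)"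
  "copied R x j ! 2 = symbol_tape 0"
  "r < R \<Longrightarrow> copied R x j ! (r + 3) = counter_tape (if r = 0 then j else 0)"
  by (simp_all add: copied_def nth_Cons3)

lemma runs_mark_counters:
  "runs (act_tapes (\<lambda>rs i. if i < 3 then stay (rs ! i) else (3, Stay)))
    (word_tape (bits x) # replicate (R + 2) (word_tape [])) 1 (copied R x 0)"
proof (rule runs_act_tapes)
  have blank: "word_tape [] = (\<lambda>_. 0, 0)" by (auto simp: word_tape_def)
  have input: "(\<lambda>p. if p < 0 then 0 else word_cells x p) = word_cells x"
    "(\<lambda>p. if p < 0 then word_cells x p else 0) = (\<lambda>_. 0)"
    by (auto simp: fun_eq_iff word_cells_eq_0_iff)
  let ?ts = "word_tape (bits x) # replicate (R + 2) (word_tape [])"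
  fix i assume "i < length ?ts"
  then have "i < R + 3" by simp
  then show "act_tape (if i < 3 then stay (map read_tape ?ts ! i) else (3, Stay)) (?ts ! i) =
      copied R x 0 ! i"
    by (cases rule: tape_index_cases)
      (auto simp: word_tape_bits blank input symbol_tape_def counter_tape_def stay_def nth_Cons')
qed simp

lemma runs_copy_step:
  assumes "j < length x"
  shows "runs (act_tapes (\<lambda>rs i. if i = 0 then (0, Right) else if i = 1 then (rs ! 0, Right)
    else (rs ! i, moves [(3, Right)] i))) (copied R x j) 1 (copied R x (Suc j))"
proof (rule runs_act_tapes)
  fix i assume "i < length (copied R x j)"
  then have "i < R + 3" by simp
  then show "act_tape (if i = 0 then (0, Right)
      else if i = 1 then (map read_tape (copied R x j) ! 0, Right)
      else (map read_tape (copied R x j) ! i, moves [(3, Right)] i)) (copied R x j ! i) =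
      copied R x (Suc j) ! i"
    by (cases rule: tape_index_cases)
      (auto simp: fun_eq_iff moves_def symbol_tape_def counter_tape_def)
qed simp

lemma rewind_copied:
  "shift_heads (\<lambda>i. if i \<in> {0, 1} then - int (length x) else 0) (copied R x (length x)) =
    mem R x 0 0 ((\<lambda>_. 0)(0 := length x)) []"
proof (rule nth_equalityI)
  have copied: "(\<lambda>p. if p < int (length x) then 0 else word_cells x p) = (\<lambda>_. 0)"
    "(\<lambda>p. if p < int (length x) then word_cells x p else 0) = word_cells x"
    by (auto simp: fun_eq_iff word_cells_eq_0_iff)
  let ?ts = "shift_heads (\<lambda>i. if i \<in> {0, 1} then - int (length x) else 0) (copied R x (length x))"
  fix i assume "i < length ?ts"
  then have "i < R + 3" by simp
  then show "?ts ! i = mem R x 0 0 ((\<lambda>_. 0)(0 := length x)) [] ! i"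
    by (cases rule: tape_index_cases) (auto simp: copied)
qed simp

lemma runs_load_prog:
  "runs load_prog (word_tape (bits x) # replicate (R + 2) (word_tape [])) (6 * length x + 5)
    (mem R x 0 0 ((\<lambda>_. 0)(0 := length x)) [])"
proof -
  let ?n = "length x"
  have copy: "runs copy_loop (copied R x 0) (?n * (1 + 2) + 1) (copied R x ?n)"
    unfolding copy_loop_def
    by (rule runs_While[where S = "copied R x"])
      (auto simp: word_cells_eq_0_iff runs_copy_step[simplified])
  have "copied R x ?n ! 1 = (word_cells x, int ?n)"
    by (auto simp: fun_eq_iff word_cells_eq_0_iff)
  then have to_start: "runs (rewind {0, 1} 1) (copied R x ?n) (3 * ?n + 3)
      (mem R x 0 0 ((\<lambda>_. 0)(0 := ?n)) [])"
    using runs_rewind[of 1 "{0, 1}" "copied R x ?n" x] rewind_copied[of x R] by simp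
  show ?thesis
    unfolding load_prog_def
    by (rule runs_mono[OF runs_Seq[OF runs_mark_counters runs_Seq[OF copy to_start]]]) simp
qed

lemma runs_rewind_output:
  "\<exists>ts. runs (rewind {0} 0) (mem R x h s \<rho> out) (3 * length out + 3) ts \<and> hd ts = word_tape (bits out)"
proof (intro exI conjI)
  let ?ts = "shift_heads (\<lambda>j. if j \<in> {0} then - int (length out) else 0) (mem R x h s \<rho> out)"
  show "runs (rewind {0} 0) (mem R x h s \<rho> out) (3 * length out + 3) ?ts"
    by (rule runs_rewind) auto
  have "?ts \<noteq> []"
    using length_mem by (metis add_is_0 length_shift_heads list.size(3) zero_neq_numeral)
  then show "hd ?ts = word_tape (bits out)"
    by (simp add: hd_conv_nth word_tape_bits)
qed

lemma exec_length_output_le: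
  assumes "exec c (word_tape w # replicate (R + 2) (word_tape [])) t (mem R x h s \<rho> out)"
  shows "length out \<le> t"
proof -
  have "snd (tm_run (code_tm (R + 3) (code 0 c)) w t) = mem R x h s \<rho> out"
    using assms by (intro exec_tm_run) simp
  then have "\<forall>T\<in>set (mem R x h s \<rho> out). snd T \<le> int t"
    using tm_run_tapes_bounded[of "code_tm (R + 3) (code 0 c)" w t] by auto
  then show ?thesis by (simp add: mem_def)
qed

definition word_fun :: "wexp \<Rightarrow> bool list \<Rightarrow> bool list" where
  "word_fun w x = wval x ((\<lambda>_. 0)(0 := length x)) w"

theorem poly_time_computable_word_fun: "poly_time_computable (word_fun w)"
proof -
  define d where "d = Suc (Max (insert 0 (wvars w)))"
  have vars: "wvars w \<subseteq> {..<d}" by (auto simp: d_def less_Suc_eq_le)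
  define R where "R = d + wregs w"
  obtain f where bound_f: "poly_bounded f" "wprog_within R d w f"
    using wprog_polyE[OF wprog_poly_wregs[OF vars]] by (metis R_def order_refl)
  define load_and_write where "load_and_write = Seq load_prog (wprog d w)"
  let ?c = "Seq load_and_write (rewind {0} 0)"
  let ?M = "code_tm (R + 3) (code 0 ?c)" and ?b = "\<lambda>n. 4 * (6 * n + 5 + f n) + 3"
  have "\<exists>t\<le>?b (length x). halted ?M (tm_run ?M (bits x) t) \<and>
      hd (snd (tm_run ?M (bits x) t)) = word_tape (bits (word_fun w x))" for x
  proof -
    let ?init = "word_tape (bits x) # replicate (R + 2) (word_tape [])"
    let ?\<rho> = "(\<lambda>_. 0)(0 := length x)"
    have "admissible (wvars w) d (length x) ?\<rho>" by (auto simp: admissible_def d_def)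
    from runs_Seq[OF runs_load_prog wprog_withinD[OF bound_f(2) this, of x "[]"]]
    obtain t where writing: "t \<le> 6 * length x + 5 + f (length x)"
      "exec load_and_write ?init t (mem R x 0 0 ?\<rho> (word_fun w x))"
      by (auto simp: runs_def load_and_write_def word_fun_def)
    have "length (word_fun w x) \<le> t" by (rule exec_length_output_le[OF writing(2)])
    moreover obtain ts u where rewinding: "u \<le> 3 * length (word_fun w x) + 3"
      "exec (rewind {0} 0) (mem R x 0 0 ?\<rho> (word_fun w x)) u ts"
      "hd ts = word_tape (bits (word_fun w x))"
      using runs_rewind_output unfolding runs_def by blast
    ultimately have "t + u \<le> ?b (length x)" using writing(1) by simp
    moreover have "exec ?c (word_tape (bits x) # replicate (R + 3 - 1) (word_tape [])) (t + u) ts"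
      using exec_Seq[OF writing(2) rewinding(2)] by simp
    ultimately show ?thesis using exec_tm_run rewinding(3) by metis
  qed
  moreover have "wf_tm ?M"
    by (rule wf_code_tm) (simp_all add: load_and_write_def)
  moreover have "poly_bounded ?b"
    by (intro poly_bounded_intros bound_f(1))
  ultimately show ?thesis by (intro poly_time_computableI[of ?M ?b])
qed


section \<open>Colorings as monochromatic arcs\<close>

lemma acyclic_digraph_induce:
  fixes D :: "'a pair_pre_digraph"
  shows "acyclic_digraph (with_proj D \<restriction> A) \<longleftrightarrow> acyclic (Restr (parcs D) A)"
proof -
  interpret wf_digraph "with_proj D \<restriction> A" by unfold_locales auto
  have ends: "arcs_ends (with_proj D \<restriction> A) = Restr (parcs D) A"
    by (force simp: arcs_ends_conv)
  have "(\<exists>p. cycle p) \<longleftrightarrow> (\<exists>v. (v, v) \<in> (arcs_ends (with_proj D \<restriction> A))\<^sup>+)"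
  proof
    assume "\<exists>p. cycle p"
    then obtain u p where "awalk u p u" "p \<noteq> []" by (auto simp: cycle_def)
    then show "\<exists>v. (v, v) \<in> (arcs_ends (with_proj D \<restriction> A))\<^sup>+" using reachable1_awalk by blast
  next
    assume "\<exists>v. (v, v) \<in> (arcs_ends (with_proj D \<restriction> A))\<^sup>+"
    then obtain v p where "awalk v p v" "p \<noteq> []" using reachable1_awalk by blast
    then have "closed_w p" by (auto simp: closed_w_def)
    then show "\<exists>p. cycle p" by (rule closed_w_imp_cycle)
  qed
  then show ?thesis
    unfolding acyclic_digraph_def acyclic_def ends by blast
qed

lemma acyclic_inv_image:
  assumes "acyclic r"
  shows "acyclic (inv_image r f)"
proof -
  have "(f a, f b) \<in> r\<^sup>+" if "(a, b) \<in> (inv_image r f)\<^sup>+" for a b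
    using that by induction (auto simp: inv_image_def intro: r_into_trancl trancl_into_trancl)
  then show ?thesis using assms unfolding acyclic_def by blast
qed

lemma acyclic_increasing:
  fixes f :: "'a \<Rightarrow> nat"
  assumes "\<And>a b. (a, b) \<in> r \<Longrightarrow> f a < f b"
  shows "acyclic r"
  using assms by (intro acyclicI_order[where f = "\<lambda>a. - int (f a)"]) simp

definition monochromatic :: "('a \<Rightarrow> 'b) \<Rightarrow> 'a rel \<Rightarrow> 'a rel" where
  "monochromatic c r = {(a, b) \<in> r. c a = c b}"

lemma monochromatic_trancl:
  assumes "(a, b) \<in> (monochromatic c r)\<^sup>+"
  shows "c a = c b \<and> (a, b) \<in> (Restr r {v. c v = c a})\<^sup>+"
  using assms
proof induction
  case (base b)
  then show ?case by (auto simp: monochromatic_def intro: r_into_trancl)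
next
  case (step b d)
  then have "(b, d) \<in> Restr r {v. c v = c a}" by (simp add: monochromatic_def)
  with step show ?case by (auto simp: monochromatic_def intro: trancl_into_trancl)
qed

lemma acyclic_monochromatic_iff:
  "acyclic (monochromatic c r) \<longleftrightarrow> (\<forall>i. acyclic (Restr r {v. c v = i}))"
proof
  assume "acyclic (monochromatic c r)"
  then show "\<forall>i. acyclic (Restr r {v. c v = i})"
    by (intro allI, elim acyclic_subset) (auto simp: monochromatic_def)
next
  assume classes: "\<forall>i. acyclic (Restr r {v. c v = i})"
  show "acyclic (monochromatic c r)"
  proof (intro acyclicI allI notI)
    fix a assume "(a, a) \<in> (monochromatic c r)\<^sup>+"
    then have "(a, a) \<in> (Restr r {v. c v = c a})\<^sup>+"
      by (rule monochromatic_trancl[THEN conjunct2])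
    moreover have "acyclic (Restr r {v. c v = c a})" using classes by (rule spec)
    ultimately show False by (simp add: acyclic_def)
  qed
qed

lemma k_colorable_pair:
  fixes D :: "'a pair_pre_digraph"
  shows "k_colorable k (with_proj D) \<longleftrightarrow>
    (\<exists>c. c ` pverts D \<subseteq> {..<k} \<and> acyclic (monochromatic c (Restr (parcs D) (pverts D))))"
proof -
  have "(\<forall>i<k. acyclic_digraph (with_proj D \<restriction> {v \<in> pverts D. c v = i})) \<longleftrightarrow>
      acyclic (monochromatic c (Restr (parcs D) (pverts D)))"
    if colors: "c ` pverts D \<subseteq> {..<k}" for c
  proof -
    have all_less_iff: "(\<And>i. \<not> i < k \<Longrightarrow> P i) \<Longrightarrow> (\<forall>i<k. P i) \<longleftrightarrow> (\<forall>i. P i)" for P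
      by blast
    have restr: "Restr (parcs D) {v \<in> pverts D. c v = i} =
        Restr (Restr (parcs D) (pverts D)) {v. c v = i}" for i by auto
    have "acyclic (Restr (Restr (parcs D) (pverts D)) {v. c v = i})" if "\<not> i < k" for i
    proof -
      have "Restr (Restr (parcs D) (pverts D)) {v. c v = i} = {}" using colors that by auto
      then show ?thesis by (simp add: acyclic_def)
    qed
    then have "(\<forall>i<k. acyclic (Restr (Restr (parcs D) (pverts D)) {v. c v = i})) \<longleftrightarrow>
        (\<forall>i. acyclic (Restr (Restr (parcs D) (pverts D)) {v. c v = i}))"
      by (rule all_less_iff)
    then show ?thesis
      unfolding acyclic_digraph_induce acyclic_monochromatic_iff restr .
  qed
  then show ?thesis
    unfolding k_colorable_def with_proj_simps by (intro iff_exI conj_cong refl)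
qed

definition list_digraph :: "'a list \<Rightarrow> ('a \<Rightarrow> 'a \<Rightarrow> bool) \<Rightarrow> nat pair_pre_digraph" where
  "list_digraph vs adj = \<lparr> pverts = {..<length vs},
     parcs = {(u, v). u < length vs \<and> v < length vs \<and> adj (vs ! u) (vs ! v)} \<rparr>"

lemma list_digraph_simps [simp]:
  "pverts (list_digraph vs adj) = {..<length vs}"
  "(u, v) \<in> parcs (list_digraph vs adj) \<longleftrightarrow>
     u < length vs \<and> v < length vs \<and> adj (vs ! u) (vs ! v)"
  by (simp_all add: list_digraph_def)

lemma list_digraph_instance:
  assumes "\<And>a. a \<in> set vs \<Longrightarrow> \<not> adj a a"
  shows "list_digraph vs adj \<in> digraph_instances"
proof -
  have "finite (parcs (list_digraph vs adj))"
    by (rule finite_subset[of _ "{..<length vs} \<times> {..<length vs}"]) auto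
  moreover have "fst e \<noteq> snd e" if "e \<in> parcs (list_digraph vs adj)" for e
    using that assms by (cases e) auto
  ultimately have "pair_digraph (list_digraph vs adj)"
    by unfold_locales auto
  then show ?thesis by (simp add: digraph_instances_def)
qed

lemma encode_list_digraph:
  "encode_digraph (list_digraph vs adj) =
     replicate (length vs) True @ [False] @ concat (map (\<lambda>a. map (adj a) vs) vs)"
proof -
  have row: "map (\<lambda>v. (u, v) \<in> parcs (list_digraph vs adj)) [0..<length vs] = map (adj (vs ! u)) vs"
    if "u < length vs" for u
    using that by (intro nth_equalityI) auto
  have "map (\<lambda>u. map (\<lambda>v. (u, v) \<in> parcs (list_digraph vs adj)) [0..<length vs]) [0..<length vs] =
      map (\<lambda>a. map (adj a) vs) vs"
    by (rule nth_equalityI) (simp_all add: row del: list_digraph_simps)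
  then show ?thesis
    by (simp add: encode_digraph_def Let_def del: list_digraph_simps(2))
qed

definition arcs_on :: "'a set \<Rightarrow> ('a \<Rightarrow> 'a \<Rightarrow> bool) \<Rightarrow> 'a rel" where
  "arcs_on V adj = {(a, b). a \<in> V \<and> b \<in> V \<and> adj a b}"

lemma k_colorable_list_digraph:
  assumes "distinct vs"
  shows "k_colorable k (with_proj (list_digraph vs adj)) \<longleftrightarrow>
    (\<exists>c. (\<forall>a\<in>set vs. c a < k) \<and> acyclic (monochromatic c (arcs_on (set vs) adj)))"
proof
  let ?D = "list_digraph vs adj"
  let ?index = "the_inv_into {..<length vs} ((!) vs)"
  assume "k_colorable k (with_proj ?D)"
  then obtain c where colors: "c ` {..<length vs} \<subseteq> {..<k}"
    and acyclic: "acyclic (monochromatic c (Restr (parcs ?D) {..<length vs}))"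
    unfolding k_colorable_pair by auto
  have index: "?index (vs ! i) = i" if "i < length vs" for i
    using that assms by (intro the_inv_into_f_f) (auto simp: inj_on_nth)
  have "monochromatic (c \<circ> ?index) (arcs_on (set vs) adj) \<subseteq>
      inv_image (monochromatic c (Restr (parcs ?D) {..<length vs})) ?index"
    by (auto simp: monochromatic_def arcs_on_def in_set_conv_nth index)
  then have "acyclic (monochromatic (c \<circ> ?index) (arcs_on (set vs) adj))"
    by (rule acyclic_subset[OF acyclic_inv_image[OF acyclic]])
  moreover have "\<forall>a\<in>set vs. (c \<circ> ?index) a < k"
    using colors by (auto simp: in_set_conv_nth index image_subset_iff)
  ultimately show "\<exists>c. (\<forall>a\<in>set vs. c a < k) \<and> acyclic (monochromatic c (arcs_on (set vs) adj))"
    by blast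
next
  let ?D = "list_digraph vs adj"
  assume "\<exists>c. (\<forall>a\<in>set vs. c a < k) \<and> acyclic (monochromatic c (arcs_on (set vs) adj))"
  then obtain c where colors: "\<forall>a\<in>set vs. c a < k"
    and acyclic: "acyclic (monochromatic c (arcs_on (set vs) adj))" by blast
  have "monochromatic (c \<circ> (!) vs) (Restr (parcs ?D) (pverts ?D)) \<subseteq>
      inv_image (monochromatic c (arcs_on (set vs) adj)) ((!) vs)"
    by (auto simp: monochromatic_def arcs_on_def)
  then have "acyclic (monochromatic (c \<circ> (!) vs) (Restr (parcs ?D) (pverts ?D)))"
    by (rule acyclic_subset[OF acyclic_inv_image[OF acyclic]])
  then show "k_colorable k (with_proj ?D)"
    unfolding k_colorable_pair using colors by (intro exI[of _ "c \<circ> (!) vs"]) auto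
qed


section \<open>The coloring gadget\<close>

text \<open>A clause is written as its literals followed by an end token.\<close>
type_synonym token = "literal option"

definition tokens :: "literal list list \<Rightarrow> token list" where
  "tokens cs = concat (map (\<lambda>C. map Some C @ [None]) cs)"

definition clause_start :: "token list \<Rightarrow> nat \<Rightarrow> bool" where
  "clause_start ts t \<longleftrightarrow> t = 0 \<or> ts ! (t - 1) = None"

definition same_clause :: "token list \<Rightarrow> nat \<Rightarrow> nat \<Rightarrow> bool" where
  "same_clause ts s e \<longleftrightarrow> s \<le> e \<and> (\<forall>r. s \<le> r \<and> r < e \<longrightarrow> ts ! r \<noteq> None)"

definition true_before :: "(nat \<Rightarrow> bool) \<Rightarrow> token list \<Rightarrow> nat \<Rightarrow> bool" where
  "true_before \<sigma> ts e \<longleftrightarrow> (\<exists>s<e. same_clause ts s e \<and> (\<exists>v. ts ! s = Some (v, \<sigma> v)))"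

definition tokens_true :: "(nat \<Rightarrow> bool) \<Rightarrow> token list \<Rightarrow> bool" where
  "tokens_true \<sigma> ts \<longleftrightarrow> (\<forall>e<length ts. ts ! e = None \<longrightarrow> true_before \<sigma> ts e)"

lemma obtain_clause_start:
  obtains s where "clause_start ts s" "same_clause ts s e"
proof -
  have "\<exists>s. clause_start ts s \<and> same_clause ts s e"
  proof (induction e)
    case 0
    show ?case by (intro exI[of _ 0]) (simp add: clause_start_def same_clause_def)
  next
    case (Suc e)
    then obtain s where start: "clause_start ts s" "same_clause ts s e" by blast
    show ?case
    proof (cases "ts ! e = None")
      case True
      then show ?thesis by (intro exI[of _ "Suc e"]) (auto simp: clause_start_def same_clause_def)
    next
      case False
      then show ?thesis using start by (intro exI[of _ s]) (auto simp: same_clause_def less_Suc_eq)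
    qed
  qed
  then show thesis using that by blast
qed

lemma same_clause_append:
  "same_clause (us @ ts) (length us + s) (length us + e) \<longleftrightarrow> same_clause ts s e"
proof
  assume clause: "same_clause (us @ ts) (length us + s) (length us + e)"
  have "ts ! r \<noteq> None" if "s \<le> r" "r < e" for r
  proof -
    have "(us @ ts) ! (length us + r) \<noteq> None"
      using clause that unfolding same_clause_def by (metis add_le_cancel_left add_less_cancel_left)
    then show ?thesis by simp
  qed
  with clause show "same_clause ts s e" by (simp add: same_clause_def)
next
  assume "same_clause ts s e"
  then show "same_clause (us @ ts) (length us + s) (length us + e)"
    unfolding same_clause_def by (auto dest!: le_Suc_ex simp: add.assoc)
qed

lemma true_before_append_left: "e < length us \<Longrightarrow> true_before \<sigma> (us @ ts) e \<longleftrightarrow> true_before \<sigma> us e"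
  by (auto simp: true_before_def same_clause_def nth_append)

lemma true_before_append_right:
  assumes "us \<noteq> []" "last us = None"
  shows "true_before \<sigma> (us @ ts) (length us + e) \<longleftrightarrow> true_before \<sigma> ts e"
proof
  assume "true_before \<sigma> (us @ ts) (length us + e)"
  then obtain s v where true_token: "s < length us + e" "same_clause (us @ ts) s (length us + e)"
    "(us @ ts) ! s = Some (v, \<sigma> v)" by (auto simp: true_before_def)
  have "length us \<le> s"
  proof (rule ccontr)
    assume "\<not> length us \<le> s"
    then have "s \<le> length us - 1" "length us - 1 < length us + e" by auto
    then have "(us @ ts) ! (length us - 1) \<noteq> None"
      using true_token(2) unfolding same_clause_def by blast
    then show False using assms by (simp add: nth_append last_conv_nth)
  qed
  then obtain s' where shifted: "s = length us + s'" by (auto simp: le_iff_add)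
  then show "true_before \<sigma> ts e"
    using true_token by (auto simp: true_before_def same_clause_append)
next
  assume "true_before \<sigma> ts e"
  then obtain s v where "s < e" "same_clause ts s e" "ts ! s = Some (v, \<sigma> v)"
    by (auto simp: true_before_def)
  then show "true_before \<sigma> (us @ ts) (length us + e)"
    unfolding true_before_def
    by (intro exI[of _ "length us + s"]) (auto simp: same_clause_append)
qed

lemma tokens_true_append:
  assumes "us \<noteq> []" "last us = None"
  shows "tokens_true \<sigma> (us @ ts) \<longleftrightarrow> tokens_true \<sigma> us \<and> tokens_true \<sigma> ts"
proof -
  have split: "(\<forall>e<length us + length ts. P e) \<longleftrightarrow>
      (\<forall>e<length us. P e) \<and> (\<forall>e<length ts. P (length us + e))" for P
  proof safe
    fix e assume "\<forall>e<length us. P e" "\<forall>e<length ts. P (length us + e)" "e < length us + length ts"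
    then show "P e" by (cases "e < length us") (auto dest: spec[of _ "e - length us"])
  qed auto
  show ?thesis
    unfolding tokens_true_def length_append split
    by (simp add: true_before_append_left true_before_append_right[OF assms] nth_append)
qed

lemma tokens_true_clause: "tokens_true \<sigma> (map Some C @ [None]) \<longleftrightarrow> (\<exists>v. (v, \<sigma> v) \<in> set C)"
proof -
  have "tokens_true \<sigma> (map Some C @ [None]) \<longleftrightarrow> true_before \<sigma> (map Some C @ [None]) (length C)"
    by (auto simp: tokens_true_def nth_append less_Suc_eq)
  also have "\<dots> \<longleftrightarrow> (\<exists>s<length C. \<exists>v. C ! s = (v, \<sigma> v))"
    by (auto simp: true_before_def same_clause_def nth_append)
  also have "\<dots> \<longleftrightarrow> (\<exists>v. (v, \<sigma> v) \<in> set C)" by (auto simp: in_set_conv_nth)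
  finally show ?thesis .
qed

lemma tokens_true_tokens:
  "tokens_true \<sigma> (tokens cs) \<longleftrightarrow> (\<forall>C\<in>set cs. \<exists>v. (v, \<sigma> v) \<in> set C)"
proof (induction cs)
  case Nil
  show ?case by (simp add: tokens_def tokens_true_def)
next
  case (Cons C cs)
  have "tokens (C # cs) = (map Some C @ [None]) @ tokens cs" by (simp add: tokens_def)
  then show ?case
    using Cons tokens_true_append[of "map Some C @ [None]"] tokens_true_clause by simp
qed

lemma satisfiable_iff_tokens_true: "satisfiable \<phi> \<longleftrightarrow> (\<exists>\<sigma>. tokens_true \<sigma> (tokens (snd \<phi>)))"
proof -
  have "(\<exists>(v, b)\<in>set C. \<sigma> v = b) \<longleftrightarrow> (\<exists>v. (v, \<sigma> v) \<in> set C)" for \<sigma> and C :: "literal list" by auto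
  then show ?thesis by (simp add: satisfiable_def tokens_true_tokens)
qed

datatype vertex = Special nat | Pos nat | Neg nat | Tok nat

text \<open>\<open>Special 0\<close> and \<open>Special 1\<close> carry the colors that stand for false and true.\<close>
fun gadget :: "token list \<Rightarrow> vertex \<Rightarrow> vertex \<Rightarrow> bool" where
  "gadget ts (Special i) (Special j) \<longleftrightarrow> i \<noteq> j"
| "gadget ts (Special i) (Pos v) \<longleftrightarrow> True"
| "gadget ts (Special i) (Neg v) \<longleftrightarrow> i \<noteq> 0"
| "gadget ts (Special i) (Tok t) \<longleftrightarrow> i \<ge> 2 \<or> i = 0 \<and> clause_start ts t \<or> i = 1 \<and> ts ! t = None"
| "gadget ts (Pos v) (Special i) \<longleftrightarrow> i \<ge> 2"
| "gadget ts (Neg v) (Special i) \<longleftrightarrow> i \<noteq> 1"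
| "gadget ts (Tok t) (Special i) \<longleftrightarrow> i \<noteq> 0 \<or> ts ! t = None"
| "gadget ts (Pos v) (Neg w) \<longleftrightarrow> v = w"
| "gadget ts (Pos v) (Tok t) \<longleftrightarrow> ts ! t = Some (v, False)"
| "gadget ts (Neg v) (Tok t) \<longleftrightarrow> ts ! t = Some (v, True)"
| "gadget ts (Tok s) (Tok t) \<longleftrightarrow> ts ! s \<noteq> None \<and> t = Suc s"
| "gadget ts _ _ \<longleftrightarrow> False"

lemma gadget_irrefl: "\<not> gadget ts a a"
  by (cases a) auto

definition gadget_vertices :: "nat \<Rightarrow> nat \<Rightarrow> token list \<Rightarrow> vertex list" where
  "gadget_vertices k n ts =
     map Special [0..<k] @ map Pos [0..<n] @ map Neg [0..<n] @ map Tok [0..<length ts]"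

lemma set_gadget_vertices: "set (gadget_vertices k n ts) =
    Special ` {..<k} \<union> Pos ` {..<n} \<union> Neg ` {..<n} \<union> Tok ` {..<length ts}"
  by (auto simp: gadget_vertices_def)

lemma in_gadget_vertices [simp]:
  "Special i \<in> set (gadget_vertices k n ts) \<longleftrightarrow> i < k"
  "Pos v \<in> set (gadget_vertices k n ts) \<longleftrightarrow> v < n"
  "Neg v \<in> set (gadget_vertices k n ts) \<longleftrightarrow> v < n"
  "Tok t \<in> set (gadget_vertices k n ts) \<longleftrightarrow> t < length ts"
  by (auto simp: set_gadget_vertices)

lemma distinct_gadget_vertices: "distinct (gadget_vertices k n ts)"
  by (auto simp: gadget_vertices_def distinct_map inj_on_def)

definition gadget_digraph :: "nat \<Rightarrow> cnf \<Rightarrow> nat pair_pre_digraph" where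
  "gadget_digraph k \<phi> =
     list_digraph (gadget_vertices k (fst \<phi>) (tokens (snd \<phi>))) (gadget (tokens (snd \<phi>)))"

locale gadget_colored =
  fixes k n :: nat and ts :: "token list" and c :: "vertex \<Rightarrow> nat"
  assumes k_ge_2: "2 \<le> k"
    and literals: "\<And>t v b. t < length ts \<Longrightarrow> ts ! t = Some (v, b) \<Longrightarrow> v < n"
    and colors: "\<And>a. a \<in> set (gadget_vertices k n ts) \<Longrightarrow> c a < k"
    and acyclic: "acyclic (monochromatic c (arcs_on (set (gadget_vertices k n ts)) (gadget ts)))"
begin

abbreviation "V \<equiv> set (gadget_vertices k n ts)"
abbreviation "mono_arcs \<equiv> monochromatic c (arcs_on V (gadget ts))"
abbreviation "false_color \<equiv> c (Special 0)"
abbreviation "true_color \<equiv> c (Special 1)"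

lemma mono_arcsI: "a \<in> V \<Longrightarrow> b \<in> V \<Longrightarrow> gadget ts a b \<Longrightarrow> c a = c b \<Longrightarrow> (a, b) \<in> mono_arcs"
  by (simp add: monochromatic_def arcs_on_def)

lemma digon_colors:
  assumes "a \<in> V" "b \<in> V" "gadget ts a b" "gadget ts b a"
  shows "c a \<noteq> c b"
proof
  assume "c a = c b"
  then have "(a, b) \<in> mono_arcs" "(b, a) \<in> mono_arcs" using assms by (auto intro: mono_arcsI)
  then have "(a, a) \<in> mono_arcs\<^sup>+" by (meson r_into_trancl trancl_into_trancl)
  then show False using acyclic by (auto simp: acyclic_def)
qed

lemma triangle_colors:
  assumes "a \<in> V" "b \<in> V" "d \<in> V" "gadget ts a b" "gadget ts b d" "gadget ts d a"
  shows "\<not> (c a = c b \<and> c b = c d)"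
proof
  assume "c a = c b \<and> c b = c d"
  then have "(a, b) \<in> mono_arcs" "(b, d) \<in> mono_arcs" "(d, a) \<in> mono_arcs"
    using assms by (auto intro: mono_arcsI)
  then have "(a, a) \<in> mono_arcs\<^sup>+" by (meson r_into_trancl trancl_into_trancl)
  then show False using acyclic by (auto simp: acyclic_def)
qed

lemma special_colors: "(\<lambda>i. c (Special i)) ` {..<k} = {..<k}"
proof (rule endo_inj_surj)
  show "inj_on (\<lambda>i. c (Special i)) {..<k}"
    using digon_colors by (intro inj_onI) (metis in_gadget_vertices(1) gadget.simps(1) lessThan_iff)
  show "(\<lambda>i. c (Special i)) ` {..<k} \<subseteq> {..<k}" using colors by auto
qed simp

lemma two_colors:
  assumes a_in: "a \<in> V" and joined: "\<And>i. i \<ge> 2 \<Longrightarrow> gadget ts a (Special i) \<and> gadget ts (Special i) a"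
  shows "c a = false_color \<or> c a = true_color"
proof -
  have "c a \<in> (\<lambda>i. c (Special i)) ` {..<k}" unfolding special_colors using colors a_in by simp
  then obtain i where special: "i < k" "c a = c (Special i)" by auto
  have "\<not> i \<ge> 2" using digon_colors[of a "Special i"] a_in special joined by auto
  then have "i = 0 \<or> i = 1" by linarith
  then show ?thesis using special by auto
qed

lemma true_token_literal:
  assumes true_token: "t < length ts" "ts ! t = Some (v, b)" "c (Tok t) = true_color"
  shows "c (Pos v) = true_color \<longleftrightarrow> b"
proof -
  have v_less: "v < n" using literals true_token by blast
  show ?thesis
  proof (cases b)
    case True
    have "c (Neg v) \<noteq> true_color"
      using triangle_colors[of "Neg v" "Tok t" "Special 1"] true_token v_less k_ge_2 True by auto
    then have "c (Neg v) = false_color" using two_colors[of "Neg v"] v_less by auto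
    then have "c (Pos v) \<noteq> false_color"
      using triangle_colors[of "Special 0" "Pos v" "Neg v"] v_less k_ge_2 by auto
    then show ?thesis using two_colors[of "Pos v"] v_less True by auto
  next
    case False
    have "c (Pos v) \<noteq> true_color"
      using triangle_colors[of "Pos v" "Tok t" "Special 1"] true_token v_less k_ge_2 False by auto
    then show ?thesis using False by blast
  qed
qed

lemma token_false:
  assumes "r < length ts" and "\<And>v. ts ! r \<noteq> Some (v, c (Pos v) = true_color)"
  shows "c (Tok r) = false_color"
proof -
  have "c (Tok r) \<noteq> true_color"
  proof (cases "ts ! r")
    case None
    then show ?thesis using digon_colors[of "Tok r" "Special 1"] assms(1) k_ge_2 by auto
  next
    case (Some l)
    then show ?thesis using true_token_literal[of r] assms by (cases l) auto
  qed
  then show ?thesis using two_colors[of "Tok r"] assms(1) by auto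
qed

lemma clause_path:
  assumes start: "clause_start ts s" and clause: "same_clause ts s e" and e_less: "e < length ts"
    and false: "\<And>r. s \<le> r \<Longrightarrow> r \<le> e \<Longrightarrow> c (Tok r) = false_color" and r_bounds: "s \<le> r" "r \<le> e"
  shows "(Special 0, Tok r) \<in> mono_arcs\<^sup>+"
  using r_bounds
proof (induction r rule: dec_induct)
  case base
  have "(Special 0, Tok s) \<in> mono_arcs"
    using start base e_less k_ge_2 false[of s] by (intro mono_arcsI) auto
  then show ?case by blast
next
  case (step r)
  have "(Tok r, Tok (Suc r)) \<in> mono_arcs"
    using step e_less clause false[of r] false[of "Suc r"]
    by (intro mono_arcsI) (auto simp: same_clause_def)
  then show ?case using step by (meson trancl_into_trancl Suc_leD)
qed

lemma tokens_true_coloring: "tokens_true (\<lambda>v. c (Pos v) = true_color) ts"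
  unfolding tokens_true_def
proof (intro allI impI, rule ccontr)
  fix e assume end_token: "e < length ts" "ts ! e = None"
    and not_true: "\<not> true_before (\<lambda>v. c (Pos v) = true_color) ts e"
  obtain s where start: "clause_start ts s" "same_clause ts s e" by (rule obtain_clause_start)
  have false: "c (Tok r) = false_color" if "s \<le> r" "r \<le> e" for r
  proof (rule token_false)
    show "r < length ts" using that end_token by simp
    have "same_clause ts r e" using start(2) that by (auto simp: same_clause_def)
    then show "ts ! r \<noteq> Some (v, c (Pos v) = true_color)" for v
      using not_true end_token(2) that by (cases "r = e") (auto simp: true_before_def)
  qed
  have s_le: "s \<le> e" using start(2) by (simp add: same_clause_def)
  have "(Tok e, Special 0) \<in> mono_arcs"
    using end_token k_ge_2 false[OF s_le] by (intro mono_arcsI) auto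
  with clause_path[OF start end_token(1) false s_le order_refl]
  have "(Special 0, Special 0) \<in> mono_arcs\<^sup>+" by (rule trancl_into_trancl)
  then show False using acyclic by (auto simp: acyclic_def)
qed

end

fun gadget_coloring :: "(nat \<Rightarrow> bool) \<Rightarrow> token list \<Rightarrow> vertex \<Rightarrow> nat" where
  "gadget_coloring \<sigma> ts (Special i) = i"
| "gadget_coloring \<sigma> ts (Pos v) = (if \<sigma> v then 1 else 0)"
| "gadget_coloring \<sigma> ts (Neg v) = (if \<sigma> v then 0 else 1)"
| "gadget_coloring \<sigma> ts (Tok t) =
     (case ts ! t of None \<Rightarrow> 0 | Some (v, b) \<Rightarrow> if \<sigma> v = b then 1 else 0)"

definition false_to_end :: "(nat \<Rightarrow> bool) \<Rightarrow> token list \<Rightarrow> nat \<Rightarrow> bool" where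
  "false_to_end \<sigma> ts t \<longleftrightarrow> (\<exists>e<length ts. ts ! e = None \<and> same_clause ts t e \<and>
     (\<forall>r. t \<le> r \<and> r \<le> e \<longrightarrow> gadget_coloring \<sigma> ts (Tok r) = 0))"

lemma false_to_end_None: "t < length ts \<Longrightarrow> ts ! t = None \<Longrightarrow> false_to_end \<sigma> ts t"
  unfolding false_to_end_def by (intro exI[of _ t]) (auto simp: same_clause_def)

lemma false_to_end_Suc:
  assumes "false_to_end \<sigma> ts (Suc t)" "ts ! t \<noteq> None" "gadget_coloring \<sigma> ts (Tok t) = 0"
  shows "false_to_end \<sigma> ts t"
proof -
  obtain e where end_token: "e < length ts" "ts ! e = None" "same_clause ts (Suc t) e"
    and false: "\<And>r. Suc t \<le> r \<Longrightarrow> r \<le> e \<Longrightarrow> gadget_coloring \<sigma> ts (Tok r) = 0"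
    using assms(1) by (auto simp: false_to_end_def)
  have "gadget_coloring \<sigma> ts (Tok r) = 0" if "t \<le> r" "r \<le> e" for r
    using false[of r] assms(3) that by (cases "r = t") auto
  moreover have "same_clause ts t e"
    using end_token(3) assms(2) unfolding same_clause_def
    by (metis Suc_leD Suc_leI le_neq_implies_less)
  ultimately show ?thesis unfolding false_to_end_def using end_token by blast
qed

lemma not_false_to_end_clause_start:
  assumes "tokens_true \<sigma> ts" "clause_start ts t"
  shows "\<not> false_to_end \<sigma> ts t"
proof
  assume "false_to_end \<sigma> ts t"
  then obtain e where end_token: "e < length ts" "ts ! e = None" "same_clause ts t e"
    and false: "\<And>r. t \<le> r \<Longrightarrow> r \<le> e \<Longrightarrow> gadget_coloring \<sigma> ts (Tok r) = 0"
    by (auto simp: false_to_end_def)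
  obtain s v where true_token: "s < e" "same_clause ts s e" "ts ! s = Some (v, \<sigma> v)"
    using assms(1) end_token(1,2) by (auto simp: tokens_true_def true_before_def)
  have "t \<le> s"
  proof (rule ccontr)
    assume "\<not> t \<le> s"
    then have "s \<le> t - 1" "t - 1 < e" "t \<noteq> 0" using end_token(3) by (auto simp: same_clause_def)
    then show False using true_token(2) assms(2) by (auto simp: clause_start_def same_clause_def)
  qed
  then show False using false[of s] true_token(1,3) by simp
qed

text \<open>
  Monochromatic arcs increase the rank: those of color 0 lead from \<open>Neg v\<close> and from tokens that
  are false up to the end of their clause to \<open>Special 0\<close>, and from there to all other vertices.
\<close>
fun gadget_rank :: "(nat \<Rightarrow> bool) \<Rightarrow> token list \<Rightarrow> vertex \<Rightarrow> nat" where
  "gadget_rank \<sigma> ts (Special i) = length ts + 1"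
| "gadget_rank \<sigma> ts (Pos v) = 3 * length ts + 5"
| "gadget_rank \<sigma> ts (Neg v) = (if \<sigma> v then 0 else 3 * length ts + 5)"
| "gadget_rank \<sigma> ts (Tok t) =
     (if gadget_coloring \<sigma> ts (Tok t) = 1 \<or> false_to_end \<sigma> ts t then t else length ts + 2 + t)"

lemma gadget_rank_less_Special:
  assumes "tokens_true \<sigma> ts" "gadget ts (Special i) b"
    and "gadget_coloring \<sigma> ts (Special i) = gadget_coloring \<sigma> ts b"
  shows "gadget_rank \<sigma> ts (Special i) < gadget_rank \<sigma> ts b"
proof (cases b)
  case (Tok t)
  then show ?thesis
    using assms not_false_to_end_clause_start[OF assms(1), of t]
    by (auto split: option.splits if_splits)
qed (use assms in \<open>auto split: if_splits\<close>)

lemma gadget_rank_less_Tok: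
  assumes t_less: "t < length ts" and arc: "gadget ts (Tok t) b"
    and mono: "gadget_coloring \<sigma> ts (Tok t) = gadget_coloring \<sigma> ts b"
  shows "gadget_rank \<sigma> ts (Tok t) < gadget_rank \<sigma> ts b"
proof (cases b)
  case (Special i)
  then have "gadget_coloring \<sigma> ts (Tok t) = 1 \<or> ts ! t = None"
    using arc mono by (auto split: option.splits if_splits)
  then have "gadget_coloring \<sigma> ts (Tok t) = 1 \<or> false_to_end \<sigma> ts t"
    using false_to_end_None[OF t_less] by blast
  then show ?thesis using Special t_less by (simp del: gadget_coloring.simps)
next
  case (Tok s)
  then have "s = Suc t" "ts ! t \<noteq> None" using arc by auto
  moreover have "gadget_coloring \<sigma> ts (Tok t) = 0 \<or> gadget_coloring \<sigma> ts (Tok t) = 1"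
    by (auto split: option.split)
  ultimately show ?thesis
    using Tok mono t_less false_to_end_Suc[of \<sigma> ts t] by (auto simp del: gadget_coloring.simps)
qed (use arc in auto)

lemma acyclic_gadget_coloring:
  assumes "tokens_true \<sigma> ts"
  shows "acyclic (monochromatic (gadget_coloring \<sigma> ts)
    (arcs_on (set (gadget_vertices k n ts)) (gadget ts)))"
proof (rule acyclic_increasing)
  fix a b assume "(a, b) \<in> monochromatic (gadget_coloring \<sigma> ts)
    (arcs_on (set (gadget_vertices k n ts)) (gadget ts))"
  then have a_in: "a \<in> set (gadget_vertices k n ts)" and arc: "gadget ts a b"
    and mono: "gadget_coloring \<sigma> ts a = gadget_coloring \<sigma> ts b"
    by (auto simp: monochromatic_def arcs_on_def)
  show "gadget_rank \<sigma> ts a < gadget_rank \<sigma> ts b"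
  proof (cases a)
    case (Special i)
    then show ?thesis using gadget_rank_less_Special[OF assms] arc mono by blast
  next
    case (Tok t)
    then show ?thesis using gadget_rank_less_Tok a_in arc mono by simp
  qed (use arc mono in \<open>cases b; auto split: if_splits\<close>)+
qed

definition wf_cnf :: "cnf set" where
  "wf_cnf = {\<phi>. \<forall>C\<in>set (snd \<phi>). fst ` set C \<subseteq> {..<fst \<phi>}}"

lemma three_cnf_subset_wf_cnf: "three_cnf \<subseteq> wf_cnf"
  by (force simp: three_cnf_def wf_cnf_def image_subset_iff)

lemma wf_cnf_token:
  assumes "\<phi> \<in> wf_cnf" "t < length (tokens (snd \<phi>))" "tokens (snd \<phi>) ! t = Some (v, b)"
  shows "v < fst \<phi>"
proof -
  have "Some (v, b) \<in> set (tokens (snd \<phi>))" using assms(2,3) by (metis nth_mem)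
  then obtain C where "C \<in> set (snd \<phi>)" "(v, b) \<in> set C"
    by (auto simp: tokens_def split: if_splits)
  then show ?thesis using assms(1) by (fastforce simp: wf_cnf_def)
qed

theorem k_colorable_gadget_digraph:
  assumes k_ge_2: "k \<ge> 2" and wf: "\<phi> \<in> wf_cnf"
  shows "k_colorable k (with_proj (gadget_digraph k \<phi>)) \<longleftrightarrow> satisfiable \<phi>"
proof -
  let ?ts = "tokens (snd \<phi>)" and ?V = "set (gadget_vertices k (fst \<phi>) (tokens (snd \<phi>)))"
  let ?colored = "\<lambda>c. (\<forall>a\<in>?V. c a < k) \<and> acyclic (monochromatic c (arcs_on ?V (gadget ?ts)))"
  have "\<exists>\<sigma>. tokens_true \<sigma> ?ts" if colored: "?colored c" for c
  proof -
    have "gadget_colored k (fst \<phi>) ?ts c"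
      using k_ge_2 wf_cnf_token[OF wf] colored by unfold_locales blast+
    then show ?thesis using gadget_colored.tokens_true_coloring by blast
  qed
  moreover have "?colored (gadget_coloring \<sigma> ?ts)" if "tokens_true \<sigma> ?ts" for \<sigma>
    using acyclic_gadget_coloring[OF that] k_ge_2
    by (auto simp: set_gadget_vertices split: option.split)
  ultimately show ?thesis
    unfolding gadget_digraph_def k_colorable_list_digraph[OF distinct_gadget_vertices]
      satisfiable_iff_tokens_true by blast
qed

fun nonspecial_rank :: "vertex \<Rightarrow> nat" where
  "nonspecial_rank (Tok t) = 2 + t"
| "nonspecial_rank (Neg v) = 1"
| "nonspecial_rank _ = 0"

lemma nonspecial_rank_less:
  "gadget ts a b \<Longrightarrow> a \<notin> range Special \<Longrightarrow> b \<notin> range Special \<Longrightarrow> nonspecial_rank a < nonspecial_rank b"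
  by (cases a; cases b) auto

lemma gadget_digraph_fvs: "gadget_digraph k \<phi> \<in> digraphs_with_fvs k"
proof -
  let ?D = "gadget_digraph k \<phi>"
  let ?n = "fst \<phi>" and ?ts = "tokens (snd \<phi>)"
  let ?vs = "gadget_vertices k ?n ?ts" and ?A = "pverts ?D - {..<k}"
  have nonspecial: "?vs ! u \<notin> range Special" if "u \<in> ?A" for u
  proof -
    let ?rest = "map Pos [0..<?n] @ map Neg [0..<?n] @ map Tok [0..<length ?ts]"
    have "?vs ! u = ?rest ! (u - k)" "u - k < length ?rest"
      using that by (auto simp: gadget_digraph_def gadget_vertices_def nth_append)
    then have "?vs ! u \<in> set ?rest" by (metis nth_mem)
    then show ?thesis by auto
  qed
  have "acyclic (Restr (parcs ?D) ?A)"
  proof (rule acyclic_increasing)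
    fix u v assume "(u, v) \<in> Restr (parcs ?D) ?A"
    then show "nonspecial_rank (?vs ! u) < nonspecial_rank (?vs ! v)"
      using nonspecial by (intro nonspecial_rank_less[of ?ts]) (auto simp: gadget_digraph_def)
  qed
  moreover have "{..<k} \<subseteq> pverts ?D"
    by (auto simp: gadget_digraph_def gadget_vertices_def)
  ultimately have "feedback_vertex_set (with_proj ?D) {..<k}"
    unfolding feedback_vertex_set_def with_proj_simps acyclic_digraph_induce by blast
  moreover have "?D \<in> digraph_instances"
    unfolding gadget_digraph_def by (rule list_digraph_instance) (rule gadget_irrefl)
  ultimately show ?thesis unfolding digraphs_with_fvs_def by (auto intro!: exI[of _ "{..<k}"])
qed

lemma card_gadget_digraph_le:
  assumes "\<phi> \<in> three_cnf"
  shows "card (pverts (gadget_digraph k \<phi>)) \<le> k + 4 * cnf_size \<phi>"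
proof -
  have "length (tokens (snd \<phi>)) = sum_list (map (\<lambda>C. length C + 1) (snd \<phi>))"
    by (simp add: tokens_def length_concat comp_def)
  also have "\<dots> \<le> sum_list (map (\<lambda>_. 4) (snd \<phi>))"
    using assms by (intro sum_list_mono) (auto simp: three_cnf_def)
  finally show ?thesis
    by (simp add: gadget_digraph_def gadget_vertices_def cnf_size_def sum_list_triv)
qed


section \<open>Computing the gadget digraph\<close>

fun encode_token :: "token \<Rightarrow> bool list" where
  "encode_token None = [False]"
| "encode_token (Some l) = encode_literal l"

definition token_word :: "token list \<Rightarrow> bool list" where
  "token_word ts = concat (map encode_token ts)"

lemma token_word_simps [simp]:
  "token_word [] = []" "token_word (t # ts) = encode_token t @ token_word ts"
  "token_word (ts @ us) = token_word ts @ token_word us"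
  by (simp_all add: token_word_def)

lemma encode_cnf_tokens:
  "encode_cnf (n, cs) = replicate n True @ False # token_word (tokens cs)"
proof -
  have "encode_clause C = token_word (map Some C @ [None])" for C
    by (simp add: encode_clause_def token_word_def comp_def)
  then have "concat (map encode_clause cs) = token_word (tokens cs)"
    by (induction cs) (simp_all add: tokens_def)
  then show ?thesis by simp
qed

text \<open>
  State 0: reading the number of variables; 1: at the start of a token; 2: at the sign of a
  literal; 3: inside the variable of a literal. The bits \<open>False\<close> and \<open>True\<close> are the symbols 1 and 2.
\<close>
definition parse :: "nat \<Rightarrow> nat \<Rightarrow> nat" where
  "parse q s = (if q = 0 then (if s = 1 then 1 else 0)
     else if q = 1 then (if s = 2 then 2 else 1)
     else if q = 2 then 3
     else if s = 1 then 1 else 3)"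

definition parse_word :: "nat \<Rightarrow> bool list \<Rightarrow> nat" where
  "parse_word = foldl (\<lambda>q b. parse q (if b then 2 else 1))"

lemma parse_word_simps [simp]:
  "parse_word q [] = q" "parse_word q (b # w) = parse_word (parse q (if b then 2 else 1)) w"
  "parse_word q (v @ w) = parse_word (parse_word q v) w"
  by (simp_all add: parse_word_def)

lemma parse_le: "parse q s \<le> 3"
  by (simp add: parse_def)

lemma automaton_parse: "j \<le> length x \<Longrightarrow> automaton parse 0 x j = parse_word 0 (take j x)"
proof (induction j)
  case (Suc j)
  then show ?case
    by (simp add: take_Suc_conv_app_nth word_cells_nth parse_le min_absorb2)
qed simp

lemma parse_word_nonzero: "q \<noteq> 0 \<Longrightarrow> parse_word q w \<noteq> 0"
  by (induction w arbitrary: q) (auto simp: parse_def)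

lemma parse_word_header: "parse_word 0 (replicate n True) = 0"
  by (induction n) (auto simp: parse_def)

lemma parse_word_var: "parse_word 3 (replicate n True) = 3"
  by (induction n) (auto simp: parse_def)

lemma parse_word_token [simp]: "parse_word (Suc 0) (encode_token t) = Suc 0"
  by (cases t) (auto simp: parse_def parse_word_var)

lemma parse_word_token_word [simp]: "parse_word (Suc 0) (token_word ts) = Suc 0"
  by (induction ts) auto

lemma parse_word_inside_token:
  assumes "0 < j" "j < length (encode_token t)"
  shows "parse_word 1 (take j (encode_token t)) \<ge> 2"
proof -
  obtain v b where literal: "t = Some (v, b)" using assms by (cases t) auto
  obtain i where j_eq: "j = Suc i" using assms by (cases j) auto
  show ?thesis
  proof (cases i)
    case 0
    then show ?thesis using literal j_eq by (simp add: parse_def)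
  next
    case (Suc m)
    then have "take j (encode_token t) = [True, b] @ replicate m True"
      using literal j_eq assms by (simp add: min_absorb1)
    then show ?thesis by (simp add: parse_def parse_word_var)
  qed
qed

lemma length_encode_token_pos: "0 < length (encode_token t)"
  by (cases t) auto

lemma upt_add_eq_map: "[0..<a + b] = [0..<a] @ map ((+) a) [0..<b]"
  by (induction b) auto

lemma token_starts:
  "filter (\<lambda>i. parse_word 1 (take i (token_word ts)) = 1) [0..<length (token_word ts)] =
     map (\<lambda>t. length (token_word (take t ts))) [0..<length ts]"
proof (induction ts)
  case (Cons u ts)
  let ?a = "length (encode_token u)" and ?w = "token_word ts"
  have first_token: "filter (\<lambda>i. parse_word 1 (take i (encode_token u @ ?w)) = 1) [0..<?a] = [0]"
  proof -
    have "[0..<?a] = 0 # [1..<?a]" using upt_conv_Cons[OF length_encode_token_pos[of u]] by simp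
    moreover have "parse_word 1 (take i (encode_token u @ ?w)) \<noteq> 1" if "i \<in> set [1..<?a]" for i
      using parse_word_inside_token[of i u] that by simp
    then have "filter (\<lambda>i. parse_word 1 (take i (encode_token u @ ?w)) = 1) [1..<?a] = []"
      unfolding filter_empty_conv by blast
    ultimately show ?thesis by simp
  qed
  have later_tokens:
    "filter (\<lambda>i. parse_word 1 (take i (encode_token u @ ?w)) = 1) (map ((+) ?a) [0..<length ?w]) =
      map ((+) ?a) (filter (\<lambda>i. parse_word 1 (take i ?w) = 1) [0..<length ?w])"
    by (simp add: filter_map comp_def)
  have indices: "[0..<length (u # ts)] = 0 # map Suc [0..<length ts]"
    using upt_conv_Cons[of 0 "length (u # ts)"] by (simp add: map_Suc_upt del: upt_Suc)
  show ?case
    unfolding indices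
    by (simp only: token_word_simps length_append upt_add_eq_map filter_append first_token
        later_tokens Cons)
      (simp add: comp_def)
qed simp

definition token_pos :: "nat \<Rightarrow> token list \<Rightarrow> nat \<Rightarrow> nat" where
  "token_pos n ts t = Suc n + length (token_word (take t ts))"

lemma cnf_word_at_token:
  assumes "t < length ts"
  shows "replicate n True @ False # token_word ts =
    (replicate n True @ False # token_word (take t ts)) @
    encode_token (ts ! t) @ token_word (drop (Suc t) ts)"
proof -
  have "token_word ts = token_word (take t ts) @ encode_token (ts ! t) @ token_word (drop (Suc t) ts)"
    using arg_cong[OF id_take_nth_drop[OF assms], of token_word] by simp
  then show ?thesis by simp
qed

locale cnf_word =
  fixes n :: nat and ts :: "token list" and x :: "bool list"
  assumes x_eq: "x = replicate n True @ False # token_word ts"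
begin

lemma length_x: "length x = Suc n + length (token_word ts)"
  by (simp add: x_eq)

lemma state_header: "i \<le> n \<Longrightarrow> automaton parse 0 x i = 0"
  by (simp add: automaton_parse length_x) (simp add: x_eq parse_word_header min_absorb1)

lemma state_after_header:
  assumes "i \<le> length (token_word ts)"
  shows "automaton parse 0 x (Suc n + i) = parse_word 1 (take i (token_word ts))"
proof -
  have "take (Suc n + i) x = (replicate n True @ [False]) @ take i (token_word ts)"
    by (simp add: x_eq)
  moreover have "automaton parse 0 x (Suc n + i) = parse_word 0 (take (Suc n + i) x)"
    using assms by (intro automaton_parse) (simp add: length_x)
  ultimately show ?thesis by (simp add: parse_word_header) (simp add: parse_def)
qed

lemma header_iff: "i < length x \<Longrightarrow> automaton parse 0 x (Suc i) = 0 \<longleftrightarrow> i < n"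
proof (cases "i < n")
  case False
  assume "i < length x"
  then have "automaton parse 0 x (Suc n + (i - n)) = parse_word 1 (take (i - n) (token_word ts))"
    using False by (intro state_after_header) (simp add: length_x)
  then show ?thesis using False parse_word_nonzero[of 1] by simp
qed (simp add: state_header del: automaton.simps)

lemma filter_tokens:
  "filter (\<lambda>i. i < length x \<and> automaton parse 0 x i = 1) [0..<k + length x] =
     map (token_pos n ts) [0..<length ts]"
proof -
  let ?P = "\<lambda>i. i < length x \<and> automaton parse 0 x i = 1"
  have "[0..<k + length x] = [0..<Suc n] @ map ((+) (Suc n)) [0..<length (token_word ts)]
      @ map ((+) (length x)) [0..<k]"
    by (simp only: add.commute[of k] upt_add_eq_map length_x append_assoc)
  moreover have "filter ?P [0..<Suc n] = []"
    by (auto simp: filter_empty_conv state_header simp del: upt_Suc)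
  moreover have "filter ?P (map ((+) (length x)) [0..<k]) = []"
    by (auto simp: filter_empty_conv)
  moreover have "filter ?P (map ((+) (Suc n)) [0..<length (token_word ts)]) =
      map ((+) (Suc n))
        (filter (\<lambda>i. parse_word 1 (take i (token_word ts)) = 1) [0..<length (token_word ts)])"
  proof -
    have "filter (?P \<circ> (+) (Suc n)) [0..<length (token_word ts)] =
        filter (\<lambda>i. parse_word 1 (take i (token_word ts)) = 1) [0..<length (token_word ts)]"
      using state_after_header
      by (intro filter_cong refl) (auto simp: length_x simp del: automaton.simps add_Suc)
    then show ?thesis by (simp only: filter_map)
  qed
  ultimately show ?thesis
    unfolding token_starts by (simp add: comp_def token_pos_def[abs_def] del: upt_Suc)
qed

lemma token_pos_less: "t < length ts \<Longrightarrow> token_pos n ts t < length x"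
  using arg_cong[OF cnf_word_at_token[of t ts n], of length] length_encode_token_pos[of "ts ! t"]
  by (simp add: x_eq token_pos_def)

lemma token_pos_Suc:
  "t < length ts \<Longrightarrow> token_pos n ts (Suc t) = token_pos n ts t + length (encode_token (ts ! t))"
  by (simp add: token_pos_def take_Suc_conv_app_nth)

lemma token_pos_mono:
  assumes "s < t" "t < length ts"
  shows "token_pos n ts s < token_pos n ts t"
  using assms
proof (induction t)
  case (Suc t)
  then have "token_pos n ts t < token_pos n ts (Suc t)"
    using token_pos_Suc[of t] length_encode_token_pos[of "ts ! t"] by simp
  then show ?case using Suc by (cases "s = t") auto
qed simp

lemma token_iff:
  assumes "i < length x"
  shows "automaton parse 0 x i = 1 \<longleftrightarrow> (\<exists>t<length ts. i = token_pos n ts t)"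
proof -
  have "i \<in> set (filter (\<lambda>i. i < length x \<and> automaton parse 0 x i = 1) [0..<0 + length x]) \<longleftrightarrow>
      i \<in> set (map (token_pos n ts) [0..<length ts])"
    unfolding filter_tokens ..
  then show ?thesis using assms by auto
qed

lemma token_pos_inj: "inj_on (token_pos n ts) {..<length ts}"
  by (rule inj_onI) (metis lessThan_iff less_irrefl linorder_neqE_nat token_pos_mono)

lemma token_positions_before:
  assumes t_less: "t < length ts"
  shows "{j. j < token_pos n ts t \<and> automaton parse 0 x j = 1} = token_pos n ts ` {..<t}"
proof (intro equalityI subsetI)
  fix j assume "j \<in> {j. j < token_pos n ts t \<and> automaton parse 0 x j = 1}"
  then have j_token: "j < token_pos n ts t" "automaton parse 0 x j = 1" by auto
  then obtain s where s_token: "s < length ts" "j = token_pos n ts s"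
    using token_iff[of j] token_pos_less[OF t_less] by auto
  moreover have "s < t"
    using j_token(1) s_token token_pos_mono[of t s] by (metis less_asym linorder_neqE_nat)
  ultimately show "j \<in> token_pos n ts ` {..<t}" by simp
next
  fix j assume "j \<in> token_pos n ts ` {..<t}"
  then obtain s where s_token: "s < t" "j = token_pos n ts s" by auto
  then have "j < token_pos n ts t" "s < length ts" using token_pos_mono[of s t] t_less by auto
  moreover have "automaton parse 0 x j = 1"
    using token_iff[of j] token_pos_less[of s] s_token(2) \<open>s < length ts\<close> by auto
  ultimately show "j \<in> {j. j < token_pos n ts t \<and> automaton parse 0 x j = 1}" by simp
qed

lemma token_rank:
  assumes t_less: "t < length ts"
  shows "(\<Sum>j<token_pos n ts t. if automaton parse 0 x j = 1 then 1 else 0) = t"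
proof -
  have "(\<Sum>j<token_pos n ts t. if automaton parse 0 x j = 1 then 1 else 0) =
      card {j. j < token_pos n ts t \<and> automaton parse 0 x j = 1}"
    by (simp add: sum.If_cases Int_def)
  also have "\<dots> = card (token_pos n ts ` {..<t})" by (simp only: token_positions_before[OF t_less])
  also have "\<dots> = t"
    using inj_on_subset[OF token_pos_inj, of "{..<t}"] t_less by (simp add: card_image)
  finally show ?thesis .
qed

lemma cell_token:
  assumes "t < length ts" "j < length (encode_token (ts ! t))"
  shows "word_cells x (int (token_pos n ts t + j)) = (if encode_token (ts ! t) ! j then 2 else 1)"
proof -
  have len: "length (replicate n True @ False # token_word (take t ts)) = token_pos n ts t"
    by (simp add: token_pos_def)
  have "x ! (token_pos n ts t + j) = encode_token (ts ! t) ! j"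
    unfolding x_eq cnf_word_at_token[OF assms(1)] using assms(2)
    by (simp only: len[symmetric] nth_append_length_plus) (simp add: nth_append)
  moreover have "token_pos n ts t + j < length x"
    using arg_cong[OF cnf_word_at_token[OF assms(1), of n], of length] assms(2) len
    by (simp add: x_eq)
  ultimately show ?thesis by (simp only: word_cells_nth)
qed

lemma cell_token_start:
  assumes "t < length ts"
  shows "word_cells x (int (token_pos n ts t)) = (if ts ! t = None then 1 else 2)"
  using cell_token[OF assms, of 0] length_encode_token_pos[of "ts ! t"]
  by (cases "ts ! t") (auto split: if_splits)

lemma first_failure_iff:
  fixes v w :: nat
  assumes "\<And>j. j < w \<Longrightarrow> P j" "\<not> P w"
  shows "(\<forall>j<v. P j) \<and> \<not> P v \<longleftrightarrow> v = w"
  using assms by (metis linorder_neqE_nat)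

lemma cell_literal:
  assumes t_less: "t < length ts"
  shows "word_cells x (int (token_pos n ts t)) = 2 \<and>
    word_cells x (int (token_pos n ts t + 1)) = (if b then 2 else 1) \<and>
    (\<forall>j<v. word_cells x (int (token_pos n ts t + 2 + j)) = 2) \<and>
    word_cells x (int (token_pos n ts t + 2 + v)) \<noteq> 2 \<longleftrightarrow> ts ! t = Some (v, b)"
proof (cases "ts ! t")
  case None
  then show ?thesis using cell_token_start[OF t_less] by simp
next
  case (Some l)
  obtain w d where l_eq: "l = (w, d)" by (cases l)
  have sign: "word_cells x (int (token_pos n ts t + 1)) = (if d then 2 else 1)"
    using cell_token[OF t_less, of 1] Some l_eq by simp
  have "word_cells x (int (token_pos n ts t + 2 + j)) = (if j < w then 2 else 1)" if "j \<le> w" for j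
    using cell_token[OF t_less, of "2 + j"] Some l_eq that by (simp add: nth_append add.assoc)
  then have "(\<forall>j<v. word_cells x (int (token_pos n ts t + 2 + j)) = 2) \<and>
      word_cells x (int (token_pos n ts t + 2 + v)) \<noteq> 2 \<longleftrightarrow> v = w"
    by (intro first_failure_iff) simp_all
  then show ?thesis
    using cell_token_start[OF t_less] sign Some l_eq by (cases b; cases d) auto
qed

lemma clause_start_iff:
  assumes t_less: "t < length ts"
  shows "automaton parse 0 x (token_pos n ts t - 1) \<le> 1 \<longleftrightarrow> clause_start ts t"
proof (cases t)
  case 0
  then show ?thesis using state_header[of n] by (simp add: token_pos_def clause_start_def)
next
  case (Suc s)
  then have s_less: "s < length ts" using t_less by simp
  let ?u = "ts ! s"
  have pos: "token_pos n ts t - 1 = token_pos n ts s + (length (encode_token ?u) - 1)"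
    unfolding Suc token_pos_Suc[OF s_less] using length_encode_token_pos[of ?u] by arith
  have "length (token_word (take s ts) @ encode_token ?u) \<le> length (token_word ts)"
    using arg_cong[OF cnf_word_at_token[OF s_less, of n], of length] by simp
  then have "automaton parse 0 x (token_pos n ts t - 1) =
      parse_word 1
        (take (length (token_word (take s ts)) + (length (encode_token ?u) - 1)) (token_word ts))"
    unfolding pos token_pos_def[of n ts s] add.assoc by (intro state_after_header) simp
  also have "token_word ts = token_word (take s ts) @ encode_token ?u @ token_word (drop (Suc s) ts)"
    using cnf_word_at_token[OF s_less, of n] by simp
  also have "take (length (token_word (take s ts)) + (length (encode_token ?u) - 1)) \<dots> =
      token_word (take s ts) @ take (length (encode_token ?u) - 1) (encode_token ?u)"
    by simp
  finally have "automaton parse 0 x (token_pos n ts t - 1) =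
      parse_word 1 (take (length (encode_token ?u) - 1) (encode_token ?u))" by simp
  then show ?thesis
    using Suc parse_word_inside_token[of "length (encode_token ?u) - 1" ?u]
    by (cases ?u) (auto simp: clause_start_def)
qed

end

abbreviation holds :: "bool list \<Rightarrow> (nat \<Rightarrow> nat) \<Rightarrow> nexp \<Rightarrow> bool" where
  "holds x \<rho> e \<equiv> nval x \<rho> e \<noteq> 0"

definition Not_n :: "nexp \<Rightarrow> nexp" where "Not_n a = Sub (Num 1) a"
definition And_n :: "nexp \<Rightarrow> nexp \<Rightarrow> nexp" where "And_n a b = Cond a b (Num 0)"
definition Or_n :: "nexp \<Rightarrow> nexp \<Rightarrow> nexp" where "Or_n a b = Cond a (Num 1) b"
definition Le_n :: "nexp \<Rightarrow> nexp \<Rightarrow> nexp" where "Le_n a b = Not_n (Sub a b)"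
definition Eq_n :: "nexp \<Rightarrow> nexp \<Rightarrow> nexp" where "Eq_n a b = And_n (Le_n a b) (Le_n b a)"
definition All_n :: "nat \<Rightarrow> nexp \<Rightarrow> nexp \<Rightarrow> nexp" where "All_n i e p = Not_n (Sum i e (Not_n p))"
definition Cell :: "nexp \<Rightarrow> nexp" where "Cell e = Aut (\<lambda>q s. s) 0 (Add e (Num 1))"
definition State :: "nexp \<Rightarrow> nexp" where "State e = Aut parse 0 e"

lemma holds_simps [simp]:
  "holds x \<rho> (Not_n a) \<longleftrightarrow> \<not> holds x \<rho> a"
  "holds x \<rho> (And_n a b) \<longleftrightarrow> holds x \<rho> a \<and> holds x \<rho> b"
  "holds x \<rho> (Or_n a b) \<longleftrightarrow> holds x \<rho> a \<or> holds x \<rho> b"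
  "holds x \<rho> (Le_n a b) \<longleftrightarrow> nval x \<rho> a \<le> nval x \<rho> b"
  "holds x \<rho> (Eq_n a b) \<longleftrightarrow> nval x \<rho> a = nval x \<rho> b"
  by (auto simp: Not_n_def And_n_def Or_n_def Le_n_def Eq_n_def)

lemma holds_All_n [simp]:
  "holds x \<rho> (All_n i e p) \<longleftrightarrow> (\<forall>k<nval x \<rho> e. holds x (\<rho>(i := k)) p)"
proof -
  have "holds x \<rho> (All_n i e p) \<longleftrightarrow> (\<Sum>k<nval x \<rho> e. nval x (\<rho>(i := k)) (Not_n p)) = 0"
    by (simp only: All_n_def holds_simps nval.simps not_not)
  also have "\<dots> \<longleftrightarrow> (\<forall>k<nval x \<rho> e. \<not> holds x (\<rho>(i := k)) (Not_n p))"
    by (auto simp del: holds_simps)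
  finally show ?thesis by (simp only: holds_simps not_not)
qed

lemma nval_Cell [simp]: "nval x \<rho> (Cell e) = word_cells x (int (nval x \<rho> e))"
  using word_cells_le[of x "int (nval x \<rho> e)"] by (simp add: Cell_def)

lemma nval_State [simp]: "nval x \<rho> (State e) = automaton parse 0 x (nval x \<rho> e)"
  by (simp add: State_def)

text \<open>
  In expressions a vertex is a pair of a class (0: special, 1: positive literal,
  2: negative literal, 3: token) and an index, which for a token is its position in the input.
\<close>
fun vclass :: "vertex \<Rightarrow> nat" where
  "vclass (Special i) = 0"
| "vclass (Pos v) = 1"
| "vclass (Neg v) = 2"
| "vclass (Tok t) = 3"

fun vindex :: "nat \<Rightarrow> token list \<Rightarrow> vertex \<Rightarrow> nat" where
  "vindex n ts (Special i) = i"
| "vindex n ts (Pos v) = v"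
| "vindex n ts (Neg v) = v"
| "vindex n ts (Tok t) = token_pos n ts t"

definition By_class :: "nat \<Rightarrow> nexp \<Rightarrow> nexp \<Rightarrow> nexp \<Rightarrow> nexp \<Rightarrow> nexp" where
  "By_class c a0 a1 a2 a3 = Cond (Eq_n (Var c) (Num 0)) a0 (Cond (Eq_n (Var c) (Num 1)) a1
     (Cond (Eq_n (Var c) (Num 2)) a2 a3))"

lemma nval_By_class [simp]:
  "nval x \<rho> (By_class c a0 a1 a2 a3) = (if \<rho> c = 0 then nval x \<rho> a0 else if \<rho> c = 1 then nval x \<rho> a1
     else if \<rho> c = 2 then nval x \<rho> a2 else nval x \<rho> a3)"
  using holds_simps(5)[of x \<rho> "Var c"] by (simp add: By_class_def)

definition Is_vertex :: "nat \<Rightarrow> nat \<Rightarrow> nat \<Rightarrow> nexp" where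
  "Is_vertex k c i =
     (let header = And_n (Not_n (Le_n (Var 0) (Var i))) (Eq_n (State (Add (Var i) (Num 1))) (Num 0))
      in By_class c (Not_n (Le_n (Num k) (Var i))) header header
        (And_n (Not_n (Le_n (Var 0) (Var i))) (Eq_n (State (Var i)) (Num 1))))"

definition For_vertices :: "nat \<Rightarrow> nat \<Rightarrow> nat \<Rightarrow> wexp \<Rightarrow> wexp" where
  "For_vertices k c i w = For c (Num 4) (For i (Add (Num k) (Var 0)) (When (Is_vertex k c i) w))"

definition Is_literal :: "nat \<Rightarrow> bool \<Rightarrow> nat \<Rightarrow> nexp" where
  "Is_literal i b v = And_n (Eq_n (Cell (Var i)) (Num 2))
     (And_n (Eq_n (Cell (Add (Var i) (Num 1))) (Num (if b then 2 else 1)))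
     (And_n (All_n 5 (Var v) (Eq_n (Cell (Add (Add (Var i) (Num 2)) (Var 5))) (Num 2)))
       (Not_n (Eq_n (Cell (Add (Add (Var i) (Num 2)) (Var v))) (Num 2)))))"

definition Token_rank :: "nat \<Rightarrow> nexp" where
  "Token_rank i = Sum 5 (Var i) (Cond (Eq_n (State (Var 5)) (Num 1)) (Num 1) (Num 0))"

definition Is_clause_start :: "nat \<Rightarrow> nexp" where
  "Is_clause_start i = Le_n (State (Sub (Var i) (Num 1))) (Num 1)"

definition Is_end :: "nat \<Rightarrow> nexp" where
  "Is_end i = Eq_n (Cell (Var i)) (Num 1)"

definition Gadget_adj :: nexp where
  "Gadget_adj = By_class 1
     (By_class 3 (Not_n (Eq_n (Var 2) (Var 4))) (Num 1) (Var 2)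
        (Or_n (Le_n (Num 2) (Var 2))
        (Or_n (And_n (Eq_n (Var 2) (Num 0)) (Is_clause_start 4))
              (And_n (Eq_n (Var 2) (Num 1)) (Is_end 4)))))
     (By_class 3 (Le_n (Num 2) (Var 4)) (Num 0) (Eq_n (Var 2) (Var 4)) (Is_literal 4 False 2))
     (By_class 3 (Not_n (Eq_n (Var 4) (Num 1))) (Num 0) (Num 0) (Is_literal 4 True 2))
     (By_class 3 (Or_n (Var 4) (Is_end 2)) (Num 0) (Num 0)
        (And_n (Not_n (Is_end 2)) (Eq_n (Token_rank 4) (Add (Token_rank 2) (Num 1)))))"

definition Gadget_word :: "nat \<Rightarrow> wexp" where
  "Gadget_word k = Cat (For_vertices k 1 2 (Bit (Num 1))) (Cat (Bit (Num 0))
     (For_vertices k 1 2 (For_vertices k 3 4 (Bit Gadget_adj))))"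

lemma concat_map_if: "concat (map (\<lambda>i. if P i then f i else []) is) = concat (map f (filter P is))"
  by (induction "is") auto

lemma filter_less_upt:
  assumes "k \<le> m"
  shows "filter (\<lambda>i. i < k) [0..<m] = [0..<k]"
proof -
  have "[0..<m] = [0..<k] @ [k..<m]" using assms by (metis le0 le_Suc_ex upt_add_eq_append)
  then show ?thesis by simp
qed

context cnf_word
begin

lemma holds_Is_literal:
  assumes "t < length ts" "\<rho> i = token_pos n ts t" "i \<noteq> 5" "v \<noteq> 5"
  shows "holds x \<rho> (Is_literal i b v) \<longleftrightarrow> ts ! t = Some (\<rho> v, b)"
  using cell_literal[OF assms(1), of b "\<rho> v"] assms(2-4)
  unfolding Is_literal_def holds_simps holds_All_n by (simp add: algebra_simps)

lemma nval_Token_rank: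
  assumes "t < length ts" "\<rho> i = token_pos n ts t"
  shows "nval x \<rho> (Token_rank i) = t"
proof -
  have "nval x \<rho> (Token_rank i) = (\<Sum>j<token_pos n ts t. if automaton parse 0 x j = 1 then 1 else 0)"
    unfolding Token_rank_def nval.simps holds_simps nval_State assms(2) fun_upd_same ..
  then show ?thesis using token_rank[OF assms(1)] by simp
qed

lemma holds_Is_clause_start:
  assumes "t < length ts" "\<rho> i = token_pos n ts t"
  shows "holds x \<rho> (Is_clause_start i) \<longleftrightarrow> clause_start ts t"
  using clause_start_iff[OF assms(1)] assms(2) unfolding Is_clause_start_def by (simp del: neq0_conv)

lemma holds_Is_end:
  assumes "t < length ts" "\<rho> i = token_pos n ts t"
  shows "holds x \<rho> (Is_end i) \<longleftrightarrow> ts ! t = None"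
  using cell_token_start[OF assms(1)] assms(2) unfolding Is_end_def by (simp del: neq0_conv)

lemma holds_Gadget_adj:
  assumes "u \<in> set (gadget_vertices k n ts)" "w \<in> set (gadget_vertices k n ts)"
    and "\<rho> 1 = vclass u" "\<rho> 2 = vindex n ts u" "\<rho> 3 = vclass w" "\<rho> 4 = vindex n ts w"
  shows "holds x \<rho> Gadget_adj \<longleftrightarrow> gadget ts u w"
  unfolding Gadget_adj_def
  by (cases u; cases w)
    (use assms in \<open>simp_all add: holds_Is_literal holds_Is_end holds_Is_clause_start nval_Token_rank
      del: neq0_conv\<close>)

lemma wval_For_vertices:
  assumes "\<rho> 0 = length x" "c \<noteq> 0" "i \<noteq> 0" "c \<noteq> i"
  shows "wval x \<rho> (For_vertices k c i a) =
    concat (map (\<lambda>u. wval x (\<rho>(c := vclass u, i := vindex n ts u)) a) (gadget_vertices k n ts))"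
proof -
  define f where "f = (\<lambda>q j. wval x (\<rho>(c := q, i := j)) a)"
  let ?B = "[0..<k + length x]"
  have header: "filter (\<lambda>j. j < length x \<and> automaton parse 0 x (Suc j) = 0) ?B = [0..<n]"
  proof -
    have "filter (\<lambda>j. j < length x \<and> automaton parse 0 x (Suc j) = 0) ?B = filter (\<lambda>j. j < n) ?B"
      using header_iff length_x by (intro filter_cong refl) (auto simp del: automaton.simps)
    then show ?thesis using length_x by (simp add: filter_less_upt)
  qed
  have vertex_iff: "holds x (\<rho>(c := q, i := j)) (Is_vertex k c i) \<longleftrightarrow>
      (if q = 0 then j < k else if q = 1 \<or> q = 2 then j < length x \<and> automaton parse 0 x (Suc j) = 0
       else j < length x \<and> automaton parse 0 x j = 1)" for q j
    using assms by (simp add: Is_vertex_def Let_def not_le del: neq0_conv automaton.simps)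
  have "wval x \<rho> (For_vertices k c i a) = concat (map (\<lambda>q. concat (map (f q)
      (filter (\<lambda>j. holds x (\<rho>(c := q, i := j)) (Is_vertex k c i)) ?B))) [0..<4])"
    unfolding For_vertices_def wval.simps using assms by (simp add: concat_map_if f_def del: neq0_conv)
  also have "[0..<4] = [0, 1, 2, 3::nat]" by (simp add: upt_rec)
  finally have "wval x \<rho> (For_vertices k c i a) =
      concat (map (f 0) [0..<k]) @ concat (map (f 1) [0..<n]) @ concat (map (f 2) [0..<n]) @
      concat (map (f 3) (map (token_pos n ts) [0..<length ts]))"
    unfolding vertex_iff
    by (simp add: filter_less_upt header filter_tokens[of k, simplified] del: automaton.simps map_map)
  then show ?thesis
    by (simp add: gadget_vertices_def f_def comp_def)
qed

lemma wval_Gadget_word: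
  assumes "\<rho> 0 = length x"
  shows "wval x \<rho> (Gadget_word k) = encode_digraph (list_digraph (gadget_vertices k n ts) (gadget ts))"
proof -
  let ?vs = "gadget_vertices k n ts" and ?row = "\<lambda>u. \<rho>(1 := vclass u, 2 := vindex n ts u)"
  have "wval x \<rho> (For_vertices k 1 2 (Bit (Num 1))) = replicate (length ?vs) True"
    using assms by (simp add: wval_For_vertices concat_map_singleton map_replicate_const)
  moreover have "wval x \<rho> (For_vertices k 1 2 (For_vertices k 3 4 (Bit Gadget_adj))) =
      concat (map (\<lambda>u. map (gadget ts u) ?vs) ?vs)"
  proof -
    have row: "wval x (?row u) (For_vertices k 3 4 (Bit Gadget_adj)) =
        map (gadget ts u) ?vs" if u_in: "u \<in> set ?vs" for u
    proof -
      have "wval x (?row u) (For_vertices k 3 4 (Bit Gadget_adj)) = concat (map (\<lambda>w.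
          wval x ((?row u)(3 := vclass w, 4 := vindex n ts w)) (Bit Gadget_adj)) ?vs)"
        using assms by (intro wval_For_vertices) auto
      also have "\<dots> = concat (map (\<lambda>w. [gadget ts u w]) ?vs)"
        using u_in
        by (intro arg_cong[of _ _ concat] map_cong refl) (simp add: holds_Gadget_adj del: neq0_conv)
      finally show ?thesis by (simp add: concat_map_singleton)
    qed
    have "wval x \<rho> (For_vertices k 1 2 (For_vertices k 3 4 (Bit Gadget_adj))) =
        concat (map (\<lambda>u. wval x (?row u) (For_vertices k 3 4 (Bit Gadget_adj))) ?vs)"
      using assms by (intro wval_For_vertices) auto
    also have "\<dots> = concat (map (\<lambda>u. map (gadget ts u) ?vs) ?vs)"
      by (intro arg_cong[of _ _ concat] map_cong refl row)
    finally show ?thesis .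
  qed
  ultimately show ?thesis by (simp add: Gadget_word_def encode_list_digraph)
qed

end

theorem word_fun_Gadget_word:
  "word_fun (Gadget_word k) (encode_cnf \<phi>) = encode_digraph (gadget_digraph k \<phi>)"
proof -
  obtain n cs where phi_eq: "\<phi> = (n, cs)" by (cases \<phi>)
  interpret cnf_word n "tokens cs" "encode_cnf \<phi>"
    by unfold_locales (simp only: phi_eq encode_cnf_tokens)
  show ?thesis
    unfolding word_fun_def gadget_digraph_def phi_eq fst_conv snd_conv
    by (rule wval_Gadget_word[unfolded phi_eq]) simp
qed


section \<open>Tableaux of computations\<close>

text \<open>
  The facts recorded at time \<open>t\<close>: the state, the head position and the cells of each tape, the
  symbol under each head, and the transition applied. Position \<open>p\<close> stands for cell \<open>p - T\<close>, where
  \<open>T\<close> is the running time; kinds without a position use position 0.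
\<close>
datatype kind =
    KState nat
  | KHead nat
  | KCell nat nat
  | KRead nat nat
  | KStep nat "nat list"

instance kind :: countable
  by countable_datatype

definition tm_action :: "tm \<Rightarrow> nat \<Rightarrow> nat list \<Rightarrow> nat \<times> (nat \<times> move) list" where
  "tm_action M q rs = (if q \<in> {tm_accept M, tm_reject M} then (q, map stay rs) else tm_delta M q rs)"

lemma tm_step_action:
  "tm_step M c = (fst (tm_action M (fst c) (map read_tape (snd c))),
     map2 act_tape (snd (tm_action M (fst c) (map read_tape (snd c)))) (snd c))"
proof (cases "halted M c")
  case True
  then show ?thesis
    using map2_act_stay[of "snd c"] unfolding tm_step_def tm_action_def halted_def by simp
next
  case False
  then show ?thesis
    unfolding tm_step_def tm_action_def halted_def by (simp add: case_prod_beta)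
qed

definition readings :: "tm \<Rightarrow> nat list list" where
  "readings M = List.n_lists (tm_tapes M) [0..<tm_symbols M]"

lemma in_readings: "rs \<in> set (readings M) \<longleftrightarrow> length rs = tm_tapes M \<and> set rs \<subseteq> {..<tm_symbols M}"
  by (simp add: readings_def set_n_lists atLeast0LessThan)

lemma readings_wf_config: "wf_config M c \<Longrightarrow> map read_tape (snd c) \<in> set (readings M)"
  using wf_config_read[of M c] by (simp add: in_readings wf_config_def)

lemma nth_tm_step:
  assumes wf_M: "wf_tm M" and wf_c: "wf_config M c" and j_less: "j < tm_tapes M"
  shows "snd (tm_step M c) ! j =
    act_tape (snd (tm_action M (fst c) (map read_tape (snd c))) ! j) (snd c ! j)"
proof -
  obtain q' as where delta: "tm_delta M (fst c) (map read_tape (snd c)) = (q', as)" by fastforce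
  have "length as = tm_tapes M"
    using wf_tm_delta(2)[OF wf_M _ _ wf_config_read[OF wf_c] delta] wf_c by (simp add: wf_config_def)
  then have "length (snd (tm_action M (fst c) (map read_tape (snd c)))) = length (snd c)"
    using delta wf_c by (simp add: tm_action_def wf_config_def)
  then show ?thesis
    unfolding tm_step_action using j_less wf_c by (simp add: wf_config_def)
qed

lemma pair_word_cells:
  "fst (word_tape (pair_word x y)) i =
     (if i < int (length x) then word_cells x i
      else if i = int (length x) then 3 else word_cells y (i - int (length x) - 1))"
proof -
  have "nat (i - int (length x) - 1) = nat i - length x - 1" if "i > int (length x)" using that by simp
  then show ?thesis
    by (auto simp: word_tape_def word_cells_def pair_word_def nth_append nth_Cons'
        not_less nat_less_iff nat_le_iff)
qed

lemma set_pair_word: "wf_tm M \<Longrightarrow> set (pair_word x y) \<subseteq> {..<tm_symbols M}"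
  using set_bits[of x] set_bits[of y] by (auto simp: pair_word_def wf_tm_def)

lemma nth_tm_init:
  "0 < tm_tapes M \<Longrightarrow> snd (tm_init M w) ! 0 = word_tape w"
  "j < tm_tapes M \<Longrightarrow> j \<noteq> 0 \<Longrightarrow> snd (tm_init M w) ! j = (\<lambda>_. 0, 0)"
  by (auto simp: tm_init_def word_tape_def nth_Cons')

text \<open>
  A head at position \<open>p + departure d\<close> that moves in direction \<open>d\<close> arrives at \<open>p + arrival d\<close>, without
  any subtraction.
\<close>
fun departure :: "move \<Rightarrow> nat" where
  "departure Left = 1"
| "departure _ = 0"

fun arrival :: "move \<Rightarrow> nat" where
  "arrival Right = 1"
| "arrival _ = 0"

lemma arrival_eq: "int (arrival d) = int (departure d) + move_offset d"
  by (cases d) auto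

locale tableau_start =
  fixes M :: tm and x :: "bool list" and Y T :: nat and \<Phi> :: "kind \<Rightarrow> nat \<Rightarrow> nat \<Rightarrow> bool"
  assumes state: "\<Phi> (KState (tm_start M)) 0 0"
    and head: "\<And>j. j < tm_tapes M \<Longrightarrow> \<Phi> (KHead j) 0 T"
    and work_tape: "\<And>j p. j < tm_tapes M \<Longrightarrow> j \<noteq> 0 \<Longrightarrow> p < 2 * T + 1 \<Longrightarrow> \<Phi> (KCell j 0) 0 p"
    and left: "\<And>p. p < T \<Longrightarrow> \<Phi> (KCell 0 0) 0 p"
    and input: "\<And>a i. a < 3 \<Longrightarrow> i < length x \<Longrightarrow> word_cells x (int i) = a \<Longrightarrow> \<Phi> (KCell 0 a) 0 (T + i)"
    and separator: "\<Phi> (KCell 0 3) 0 (T + length x)"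
    and certificate: "\<And>i. i < Y \<Longrightarrow> \<Phi> (KCell 0 0) 0 (T + length x + 1 + i) \<or>
      \<Phi> (KCell 0 1) 0 (T + length x + 1 + i) \<or> \<Phi> (KCell 0 2) 0 (T + length x + 1 + i)"
    and certificate_end: "\<And>i. i < Y \<Longrightarrow> \<Phi> (KCell 0 0) 0 (T + length x + 1 + i) \<Longrightarrow>
      \<Phi> (KCell 0 0) 0 (T + length x + 1 + i + 1)"
    and right: "\<And>i. i < T \<Longrightarrow> \<Phi> (KCell 0 0) 0 (T + length x + 1 + Y + i)"

locale tableau_steps =
  fixes M :: tm and T :: nat and \<Phi> :: "kind \<Rightarrow> nat \<Rightarrow> nat \<Rightarrow> bool"
  assumes read: "\<And>t j a p. t < T \<Longrightarrow> j < tm_tapes M \<Longrightarrow> a < tm_symbols M \<Longrightarrow> p < 2 * T + 1 \<Longrightarrow>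
      \<Phi> (KHead j) t p \<Longrightarrow> \<Phi> (KCell j a) t p \<Longrightarrow> \<Phi> (KRead j a) t 0"
    and step: "\<And>t q rs. t < T \<Longrightarrow> q < tm_states M \<Longrightarrow> rs \<in> set (readings M) \<Longrightarrow>
      \<Phi> (KState q) t 0 \<Longrightarrow> \<forall>j<tm_tapes M. \<Phi> (KRead j (rs ! j)) t 0 \<Longrightarrow> \<Phi> (KStep q rs) t 0"
    and next_state: "\<And>t q rs. t < T \<Longrightarrow> q < tm_states M \<Longrightarrow> rs \<in> set (readings M) \<Longrightarrow>
      \<Phi> (KStep q rs) t 0 \<Longrightarrow> \<Phi> (KState (fst (tm_action M q rs))) (t + 1) 0"
    and move_head: "\<And>t q rs j p. t < T \<Longrightarrow> q < tm_states M \<Longrightarrow> rs \<in> set (readings M) \<Longrightarrow>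
      j < tm_tapes M \<Longrightarrow> p < 2 * T + 1 \<Longrightarrow> \<Phi> (KStep q rs) t 0 \<Longrightarrow>
      \<Phi> (KHead j) t (p + departure (snd (snd (tm_action M q rs) ! j))) \<Longrightarrow>
      \<Phi> (KHead j) (t + 1) (p + arrival (snd (snd (tm_action M q rs) ! j)))"
    and write_cell: "\<And>t q rs j p. t < T \<Longrightarrow> q < tm_states M \<Longrightarrow> rs \<in> set (readings M) \<Longrightarrow>
      j < tm_tapes M \<Longrightarrow> p < 2 * T + 1 \<Longrightarrow> \<Phi> (KStep q rs) t 0 \<Longrightarrow> \<Phi> (KHead j) t p \<Longrightarrow>
      \<Phi> (KCell j (fst (snd (tm_action M q rs) ! j))) (t + 1) p"
    and keep_cell: "\<And>t j a p p'. t < T \<Longrightarrow> j < tm_tapes M \<Longrightarrow> a < tm_symbols M \<Longrightarrow> p < 2 * T + 1 \<Longrightarrow>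
      p' < 2 * T + 1 \<Longrightarrow> p \<noteq> p' \<Longrightarrow> \<Phi> (KCell j a) t p \<Longrightarrow> \<Phi> (KHead j) t p' \<Longrightarrow> \<Phi> (KCell j a) (t + 1) p"

locale tableau = tableau_start M x Y T \<Phi> + tableau_steps M T \<Phi>
  for M :: tm and x :: "bool list" and Y T :: nat and \<Phi> :: "kind \<Rightarrow> nat \<Rightarrow> nat \<Rightarrow> bool" +
  assumes accepting: "\<And>q. q < tm_states M \<Longrightarrow> q \<noteq> tm_accept M \<Longrightarrow> \<not> \<Phi> (KState q) T 0"


section \<open>Accepting computations yield tableaux\<close>

definition run_facts :: "tm \<Rightarrow> nat list \<Rightarrow> nat \<Rightarrow> kind \<Rightarrow> nat \<Rightarrow> nat \<Rightarrow> bool" where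
  "run_facts M w T \<kappa> t p = (let c = tm_run M w t in case \<kappa> of
     KState q \<Rightarrow> fst c = q
   | KHead j \<Rightarrow> int p = snd (snd c ! j) + int T
   | KCell j a \<Rightarrow> fst (snd c ! j) (int p - int T) = a
   | KRead j a \<Rightarrow> read_tape (snd c ! j) = a
   | KStep q rs \<Rightarrow> fst c = q \<and> map read_tape (snd c) = rs)"

lemma run_facts_simps [simp]:
  "run_facts M w T (KState q) t p \<longleftrightarrow> fst (tm_run M w t) = q"
  "run_facts M w T (KHead j) t p \<longleftrightarrow> int p = snd (snd (tm_run M w t) ! j) + int T"
  "run_facts M w T (KCell j a) t p \<longleftrightarrow> fst (snd (tm_run M w t) ! j) (int p - int T) = a"
  "run_facts M w T (KRead j a) t p \<longleftrightarrow> read_tape (snd (tm_run M w t) ! j) = a"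
  "run_facts M w T (KStep q rs) t p \<longleftrightarrow> fst (tm_run M w t) = q \<and> map read_tape (snd (tm_run M w t)) = rs"
  by (simp_all add: run_facts_def Let_def)

lemma tableau_start_run_facts:
  assumes wf_M: "wf_tm M" and length_y: "length y \<le> Y"
  shows "tableau_start M x Y T (run_facts M (pair_word x y) T)"
proof -
  have tapes: "0 < tm_tapes M" using wf_M by (simp add: wf_tm_def)
  have state: "fst (tm_init M (pair_word x y)) = tm_start M" by (simp add: tm_init_def)
  have head: "snd (snd (tm_init M (pair_word x y)) ! j) = 0" if "j < tm_tapes M" for j
    using that nth_tm_init by (cases "j = 0") (auto simp: word_tape_def)
  have certificate: "word_cells y i = 0 \<or> word_cells y i = 1 \<or> word_cells y i = 2" for i
    using word_cells_le[of y i] by linarith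
  have blank: "word_cells y (int i + 1) = 0" if "word_cells y (int i) = 0" for i
    using that by (auto simp: word_cells_eq_0_iff)
  show ?thesis
    by unfold_locales
      (use length_y certificate blank in \<open>auto simp: state head nth_tm_init tapes pair_word_cells
        word_cells_eq_0_iff algebra_simps\<close>)
qed

lemma tableau_steps_run_facts:
  assumes wf_M: "wf_tm M" and symbols_w: "set w \<subseteq> {..<tm_symbols M}"
  shows "tableau_steps M T (run_facts M w T)"
proof -
  note wf = wf_config_run[OF wf_M symbols_w]
  have state: "fst (tm_run M w (Suc t)) =
      fst (tm_action M (fst (tm_run M w t)) (map read_tape (snd (tm_run M w t))))" for t
    by (simp add: tm_run_Suc tm_step_action)
  have reading: "map read_tape (snd (tm_run M w t)) = rs"
    if "rs \<in> set (readings M)" "\<forall>j<tm_tapes M. read_tape (snd (tm_run M w t) ! j) = rs ! j" for t rs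
    using that wf[of t] by (intro nth_equalityI) (auto simp: in_readings wf_config_def)
  have tape: "snd (tm_run M w (Suc t)) ! j = act_tape (snd (tm_action M (fst (tm_run M w t))
      (map read_tape (snd (tm_run M w t)))) ! j) (snd (tm_run M w t) ! j)" if "j < tm_tapes M" for t j
    unfolding tm_run_Suc by (rule nth_tm_step[OF wf_M wf that])
  show ?thesis
    by unfold_locales
      (auto simp: state reading tape read_tape_eq act_tape_eq arrival_eq algebra_simps
        simp del: map_map)
qed

lemma tableau_run_facts:
  assumes wf_M: "wf_tm M" and length_y: "length y \<le> Y"
    and accept: "fst (tm_run M (pair_word x y) T) = tm_accept M"
  shows "tableau M x Y T (run_facts M (pair_word x y) T)"
  using tableau_start_run_facts[OF wf_M length_y] accept
    tableau_steps_run_facts[OF wf_M set_pair_word[OF wf_M]]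
  by (simp add: tableau_def tableau_axioms_def)


section \<open>Tableaux yield accepting computations\<close>

lemma word_cells_Cons:
  "word_cells (b # y) 0 = (if b then 2 else 1)"
  "word_cells (b # y) (1 + int i) = word_cells y (int i)"
  by (simp_all add: word_cells_def word_tape_def bits_def nat_add_distrib)

lemma certificate_cells:
  assumes "\<And>i. i < Y \<Longrightarrow> C 0 i \<or> C 1 i \<or> C 2 i"
    and "\<And>i. Suc i < Y \<Longrightarrow> C 0 i \<Longrightarrow> C 0 (Suc i)"
  shows "\<exists>y. length y \<le> Y \<and> (\<forall>i<Y. C (word_cells y (int i)) i)"
  using assms
proof (induction Y arbitrary: C)
  case (Suc Y)
  show ?case
  proof (cases "C 0 0")
    case True
    have "C 0 i" if "i < Suc Y" for i
      using that by (induction i) (simp_all add: True Suc.prems(2))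
    then show ?thesis by (intro exI[of _ "[]"]) simp
  next
    case False
    obtain y where rest: "length y \<le> Y" "\<forall>i<Y. C (word_cells y (int i)) (Suc i)"
      using Suc.IH[of "\<lambda>a i. C a (Suc i)"] Suc.prems by (metis Suc_less_eq)
    have "C (word_cells (C 2 0 # y) (int i)) i" if "i < Suc Y" for i
      using Suc.prems(1)[of 0] False rest(2) that by (cases i) (auto simp: word_cells_Cons)
    then show ?thesis using rest(1) by (intro exI[of _ "C 2 0 # y"]) simp
  qed
qed simp

lemma start_position_cases:
  fixes p T n Y :: nat
  assumes "p < 2 * T + 1"
  obtains (before) "p < T" | (on_input) i where "p = T + i" "i < n" | (on_separator) "p = T + n"
    | (on_certificate) i where "p = T + n + 1 + i" "i < Y"
    | (behind) i where "p = T + n + 1 + Y + i" "i < T"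
proof -
  consider "p < T" | "T \<le> p" "p - T < n" | "p = T + n" | "T + n + 1 \<le> p" "p - (T + n + 1) < Y"
    | "T + n + 1 + Y \<le> p" by linarith
  then show thesis by cases (use that assms in \<open>force dest!: le_Suc_ex\<close>)+
qed

lemma (in tableau_start) certificate_exists:
  obtains y where "length y \<le> Y"
    and "\<And>p. p < 2 * T + 1 \<Longrightarrow> \<Phi> (KCell 0 (fst (word_tape (pair_word x y)) (int p - int T))) 0 p"
proof -
  let ?n = "length x"
  obtain y where length_y: "length y \<le> Y"
    and cells: "\<And>i. i < Y \<Longrightarrow> \<Phi> (KCell 0 (word_cells y (int i))) 0 (T + ?n + 1 + i)"
    using certificate_cells[of Y "\<lambda>a i. \<Phi> (KCell 0 a) 0 (T + ?n + 1 + i)"] certificate certificate_end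
    by auto
  have "\<Phi> (KCell 0 (fst (word_tape (pair_word x y)) (int p - int T))) 0 p" if "p < 2 * T + 1" for p
    using that
  proof (cases rule: start_position_cases[where n = ?n and Y = Y])
    case before
    then have "word_cells x (int p - int T) = 0" by (simp add: word_cells_eq_0_iff)
    then show ?thesis using left before by (simp add: pair_word_cells)
  next
    case (on_input i)
    then show ?thesis
      using input[OF _ _ refl, of i] word_cells_le[of x "int i"] by (simp add: pair_word_cells)
  next
    case on_separator
    then show ?thesis using separator by (simp add: pair_word_cells)
  next
    case (on_certificate i)
    then show ?thesis using cells[of i] by (simp add: pair_word_cells)
  next
    case (behind i)
    then have "fst (word_tape (pair_word x y)) (int p - int T) = 0"
      using length_y by (simp add: pair_word_cells word_cells_eq_0_iff)
    then show ?thesis using right[of i] behind by simp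
  qed
  with length_y that show thesis by blast
qed

definition tape_recorded :: "(kind \<Rightarrow> nat \<Rightarrow> nat \<Rightarrow> bool) \<Rightarrow> nat \<Rightarrow> nat \<Rightarrow> nat \<Rightarrow> tape \<Rightarrow> bool" where
  "tape_recorded \<Phi> T t j U \<longleftrightarrow> \<bar>snd U\<bar> \<le> int t \<and> \<Phi> (KHead j) t (nat (snd U + int T)) \<and>
     (\<forall>p<2 * T + 1. \<Phi> (KCell j (fst U (int p - int T))) t p)"

definition recorded :: "(kind \<Rightarrow> nat \<Rightarrow> nat \<Rightarrow> bool) \<Rightarrow> nat \<Rightarrow> nat \<Rightarrow> config \<Rightarrow> bool" where
  "recorded \<Phi> T t c \<longleftrightarrow>
     \<Phi> (KState (fst c)) t 0 \<and> (\<forall>j<length (snd c). tape_recorded \<Phi> T t j (snd c ! j))"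

lemma (in tableau_start) recorded_init:
  assumes wf_M: "wf_tm M"
    and cells: "\<And>p. p < 2 * T + 1 \<Longrightarrow> \<Phi> (KCell 0 (fst (word_tape w) (int p - int T))) 0 p"
  shows "recorded \<Phi> T 0 (tm_init M w)"
proof -
  have tapes: "0 < tm_tapes M" "length (snd (tm_init M w)) = tm_tapes M"
    using wf_M by (auto simp: wf_tm_def tm_init_def)
  have "tape_recorded \<Phi> T 0 j (snd (tm_init M w) ! j)" if j_less: "j < tm_tapes M" for j
  proof (cases "j = 0")
    case True
    have "snd (word_tape w) = 0" by (simp add: word_tape_def)
    then show ?thesis
      using True head[OF j_less] cells tapes by (simp add: nth_tm_init tape_recorded_def)
  next
    case False
    then show ?thesis
      using head[OF j_less] work_tape[OF j_less] j_less by (simp add: nth_tm_init tape_recorded_def)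
  qed
  moreover have "\<Phi> (KState (fst (tm_init M w))) 0 0" using state by (simp add: tm_init_def)
  ultimately show ?thesis unfolding recorded_def tapes(2) by blast
qed

lemma (in tableau_steps) tape_recorded_act:
  assumes t_less: "t < T" and step: "q < tm_states M" "rs \<in> set (readings M)" "\<Phi> (KStep q rs) t 0"
    and j_less: "j < tm_tapes M" and symbols: "\<And>i. fst U i < tm_symbols M"
    and rec: "tape_recorded \<Phi> T t j U"
  shows "tape_recorded \<Phi> T (t + 1) j (act_tape (snd (tm_action M q rs) ! j) U)"
proof -
  obtain a d where action: "snd (tm_action M q rs) ! j = (a, d)" by fastforce
  define h where "h = nat (snd U + int T)"
  have head: "int h = snd U + int T" "0 < h" "h < 2 * T" "\<Phi> (KHead j) t h" "\<bar>snd U\<bar> \<le> int t"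
    using rec t_less by (auto simp: tape_recorded_def h_def)
  have cells: "\<Phi> (KCell j (fst U (int p - int T))) t p" if "p < 2 * T + 1" for p
    using rec that by (simp add: tape_recorded_def)
  obtain p where p_eq: "p + departure d = h"
    using head(2) by (cases d) (auto simp: gr0_conv_Suc)
  have "\<Phi> (KHead j) (t + 1) (p + arrival d)"
    using move_head[OF t_less step(1,2) j_less _ step(3), of p] head(3,4) p_eq by (simp add: action)
  moreover have "nat (snd (act_tape (a, d) U) + int T) = p + arrival d"
    using p_eq head(1) arrival_eq[of d] by (simp add: act_tape_eq)
  moreover have "\<bar>snd (act_tape (a, d) U)\<bar> \<le> int (t + 1)"
    using head(5) by (cases d) (auto simp: act_tape_eq)
  moreover have "\<Phi> (KCell j (fst (act_tape (a, d) U) (int p - int T))) (t + 1) p"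
    if p_less: "p < 2 * T + 1" for p
  proof (cases "p = h")
    case True
    then show ?thesis
      using write_cell[OF t_less step(1,2) j_less p_less step(3)] head(1,4)
      by (simp add: act_tape_eq action)
  next
    case False
    then show ?thesis
      using keep_cell[OF t_less j_less symbols p_less _ False cells[OF p_less] head(4)] head(1,3)
      by (simp add: act_tape_eq)
  qed
  ultimately show ?thesis by (simp add: tape_recorded_def action)
qed

lemma (in tableau_steps) recorded_step:
  assumes wf_M: "wf_tm M" and wf_c: "wf_config M c" and t_less: "t < T" and rec: "recorded \<Phi> T t c"
  shows "recorded \<Phi> T (t + 1) (tm_step M c)"
proof -
  define rs where "rs = map read_tape (snd c)"
  have len: "length (snd c) = tm_tapes M" "length (snd (tm_step M c)) = tm_tapes M"
    and state: "fst c < tm_states M"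
    and symbols: "\<And>j i. j < tm_tapes M \<Longrightarrow> fst (snd c ! j) i < tm_symbols M"
    using wf_c wf_config_step[OF wf_M wf_c] by (auto simp: wf_config_def)
  have reading: "rs \<in> set (readings M)" unfolding rs_def by (rule readings_wf_config[OF wf_c])
  have tape: "tape_recorded \<Phi> T t j (snd c ! j)" if "j < tm_tapes M" for j
    using rec that len by (simp add: recorded_def)
  have "\<Phi> (KRead j (rs ! j)) t 0" if j_less: "j < tm_tapes M" for j
  proof -
    define h where "h = nat (snd (snd c ! j) + int T)"
    have head: "int h - int T = snd (snd c ! j)" "h < 2 * T + 1" "\<Phi> (KHead j) t h"
      using tape[OF j_less] t_less by (auto simp: tape_recorded_def h_def)
    moreover have "\<Phi> (KCell j (fst (snd c ! j) (int h - int T))) t h"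
      using tape[OF j_less] head(2) by (simp add: tape_recorded_def)
    moreover have "rs ! j = fst (snd c ! j) (int h - int T)"
      unfolding rs_def using j_less len head(1) by (simp add: read_tape_eq)
    ultimately show ?thesis using read[OF t_less j_less symbols[OF j_less]] by simp
  qed
  then have apply_step: "\<Phi> (KStep (fst c) rs) t 0"
    using step[OF t_less state reading] rec by (simp add: recorded_def)
  have "tape_recorded \<Phi> T (t + 1) j (snd (tm_step M c) ! j)" if j_less: "j < tm_tapes M" for j
    unfolding nth_tm_step[OF wf_M wf_c j_less]
    using tape_recorded_act[OF t_less state reading apply_step j_less symbols[OF j_less] tape[OF j_less]]
    by (simp add: rs_def)
  moreover have "\<Phi> (KState (fst (tm_step M c))) (t + 1) 0"
    using next_state[OF t_less state reading apply_step] by (simp add: tm_step_action rs_def)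
  ultimately show ?thesis unfolding recorded_def len(2) by blast
qed

lemma tableau_sound:
  assumes wf_M: "wf_tm M" and tableau: "tableau M x Y T \<Phi>"
  shows "\<exists>y. length y \<le> Y \<and> fst (tm_run M (pair_word x y) T) = tm_accept M"
proof -
  interpret tableau M x Y T \<Phi> by (rule tableau)
  obtain y where length_y: "length y \<le> Y"
    and cells: "\<And>p. p < 2 * T + 1 \<Longrightarrow> \<Phi> (KCell 0 (fst (word_tape (pair_word x y)) (int p - int T))) 0 p"
    using certificate_exists by blast
  note wf = wf_config_run[OF wf_M set_pair_word[OF wf_M], of x y]
  have "recorded \<Phi> T t (tm_run M (pair_word x y) t)" if "t \<le> T" for t
    using that
  proof (induction t)
    case 0
    show ?case using recorded_init[OF wf_M cells] by simp
  next
    case (Suc t)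
    then show ?case using recorded_step[OF wf_M wf, of t] by (simp add: tm_run_Suc)
  qed
  then have "\<Phi> (KState (fst (tm_run M (pair_word x y) T))) T 0" by (simp add: recorded_def)
  moreover have "fst (tm_run M (pair_word x y) T) < tm_states M"
    using wf[of T] by (simp add: wf_config_def)
  ultimately have "fst (tm_run M (pair_word x y) T) = tm_accept M" using accepting by blast
  then show ?thesis using length_y by blast
qed


section \<open>Expressions for formulas\<close>

datatype cexp =
    Clause "(nexp \<times> bool) list"
  | CNone
  | CCat cexp cexp
  | CIf nexp cexp
  | CFor nat nexp cexp

fun cval :: "bool list \<Rightarrow> (nat \<Rightarrow> nat) \<Rightarrow> cexp \<Rightarrow> literal list list" where
  "cval x \<rho> (Clause ls) = [map (\<lambda>(e, b). (nval x \<rho> e, b)) ls]"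
| "cval x \<rho> CNone = []"
| "cval x \<rho> (CCat a b) = cval x \<rho> a @ cval x \<rho> b"
| "cval x \<rho> (CIf e a) = (if nval x \<rho> e \<noteq> 0 then cval x \<rho> a else [])"
| "cval x \<rho> (CFor i e a) = concat (map (\<lambda>k. cval x (\<rho>(i := k)) a) [0..<nval x \<rho> e])"

definition Ones :: "nexp \<Rightarrow> wexp" where
  "Ones e = For 9 e (Bit (Num 1))"

lemma wval_Ones [simp]: "wval x \<rho> (Ones e) = replicate (nval x \<rho> e) True"
  by (simp add: Ones_def concat_map_singleton map_replicate_const)

fun literal_word :: "nexp \<times> bool \<Rightarrow> wexp" where
  "literal_word (e, b) =
     Cat (Bit (Num 1)) (Cat (Bit (Num (if b then 1 else 0))) (Cat (Ones e) (Bit (Num 0))))"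

fun cword :: "cexp \<Rightarrow> wexp" where
  "cword (Clause ls) = foldr (\<lambda>l w. Cat (literal_word l) w) ls (Bit (Num 0))"
| "cword CNone = Empty"
| "cword (CCat a b) = Cat (cword a) (cword b)"
| "cword (CIf e a) = When e (cword a)"
| "cword (CFor i e a) = For i e (cword a)"

lemma concat_map_concat: "concat (map f (concat xss)) = concat (map (\<lambda>xs. concat (map f xs)) xss)"
  by (induction xss) auto

lemma wval_cword: "wval x \<rho> (cword c) = concat (map encode_clause (cval x \<rho> c))"
proof (induction c arbitrary: \<rho>)
  case (Clause ls)
  have "wval x \<rho> (foldr (\<lambda>l w. Cat (literal_word l) w) ls (Bit (Num 0))) =
      encode_clause (map (\<lambda>(e, b). (nval x \<rho> e, b)) ls)"
    by (induction ls) (auto simp: encode_clause_def)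
  then show ?case by simp
next
  case (CFor i e a)
  show ?case
    by (simp only: cword.simps wval.simps cval.simps concat_map_concat CFor.IH map_map comp_def)
qed auto

lemma poly_expressible: "\<exists>e. \<forall>x \<rho>. nval x \<rho> e = poly (p :: nat poly) (\<rho> 0)"
proof (induction p)
  case 0
  have "\<forall>x \<rho>. nval x \<rho> (Num 0) = poly (0 :: nat poly) (\<rho> 0)" by simp
  then show ?case by blast
next
  case (pCons a p)
  then obtain e where nval_e: "\<forall>x \<rho>. nval x \<rho> e = poly p (\<rho> 0)" by blast
  then have "\<forall>x \<rho>. nval x \<rho> (Add (Num a) (Sum 9 (Var 0) e)) = poly (pCons a p) (\<rho> 0)"
    by simp
  then show ?case by blast
qed

lemma length_concat_map_ge: "y \<in> set ys \<Longrightarrow> length (f y) \<le> length (concat (map f ys))"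
  by (induction ys) auto

lemma literal_var_less:
  assumes "C \<in> set cs" "(v, b) \<in> set C"
  shows "v < length (concat (map encode_clause cs))"
proof -
  have "v < length (encode_literal (v, b))" by simp
  also have "\<dots> \<le> length (encode_clause C)"
    using length_concat_map_ge[OF assms(2), of encode_literal] by (simp add: encode_clause_def)
  also have "\<dots> \<le> length (concat (map encode_clause cs))"
    by (rule length_concat_map_ge[OF assms(1)])
  finally show ?thesis .
qed

text \<open>
  As variables are written in unary, the length of the word for the clauses bounds the variables,
  so that a polynomial bound on this length can serve as the number of variables.
\<close>
lemma cexp_cnf_computable:
  obtains n where "poly_time_computable (\<lambda>x. encode_cnf (n x, cval x ((\<lambda>_. 0)(0 := length x)) c))"
    and "\<And>x. (n x, cval x ((\<lambda>_. 0)(0 := length x)) c) \<in> wf_cnf"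
proof -
  obtain p where length_le: "\<And>x. length (word_fun (cword c) x) \<le> poly p (length x)"
    using poly_time_computable_length[OF poly_time_computable_word_fun] by blast
  obtain e where nval_e: "\<And>x \<rho>. nval x \<rho> e = poly p (\<rho> 0)" using poly_expressible[of p] by blast
  let ?F = "\<lambda>x. (poly p (length x), cval x ((\<lambda>_. 0)(0 := length x)) c)"
  have "word_fun (Cat (Ones e) (Cat (Bit (Num 0)) (cword c))) = (\<lambda>x. encode_cnf (?F x))"
    by (rule ext) (simp add: word_fun_def wval_cword nval_e)
  then have "poly_time_computable (\<lambda>x. encode_cnf (?F x))"
    using poly_time_computable_word_fun[of "Cat (Ones e) (Cat (Bit (Num 0)) (cword c))"] by simp
  moreover have "?F x \<in> wf_cnf" for x
    using literal_var_less length_le[of x] unfolding wf_cnf_def word_fun_def wval_cword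
    by (fastforce dest: order_less_le_trans)
  ultimately show thesis by (rule that)
qed

definition csat :: "(nat \<Rightarrow> bool) \<Rightarrow> bool list \<Rightarrow> (nat \<Rightarrow> nat) \<Rightarrow> cexp \<Rightarrow> bool" where
  "csat \<sigma> x \<rho> c \<longleftrightarrow> (\<forall>C\<in>set (cval x \<rho> c). \<exists>(v, b)\<in>set C. \<sigma> v = b)"

lemma satisfiable_cval: "satisfiable (n, cval x \<rho> c) \<longleftrightarrow> (\<exists>\<sigma>. csat \<sigma> x \<rho> c)"
  by (simp add: satisfiable_def csat_def)

lemma ball_upt: "(\<forall>j\<in>{0..<K}. P j) \<longleftrightarrow> (\<forall>j<K::nat. P j)"
  by auto

lemma csat_simps:
  "csat \<sigma> x \<rho> (Clause ls) \<longleftrightarrow> (\<exists>(e, b)\<in>set ls. \<sigma> (nval x \<rho> e) = b)"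
  "csat \<sigma> x \<rho> CNone \<longleftrightarrow> True"
  "csat \<sigma> x \<rho> (CCat a b) \<longleftrightarrow> csat \<sigma> x \<rho> a \<and> csat \<sigma> x \<rho> b"
  "csat \<sigma> x \<rho> (CIf e a) \<longleftrightarrow> (holds x \<rho> e \<longrightarrow> csat \<sigma> x \<rho> a)"
  "csat \<sigma> x \<rho> (CFor i e a) \<longleftrightarrow> (\<forall>k<nval x \<rho> e. csat \<sigma> x (\<rho>(i := k)) a)"
  by (simp_all add: csat_def case_prod_beta ball_Un ball_upt) blast

definition Horn :: "nexp list \<Rightarrow> nexp \<Rightarrow> cexp" where
  "Horn ps h = Clause ((h, True) # map (\<lambda>e. (e, False)) ps)"

lemma csat_Horn: "csat \<sigma> x \<rho> (Horn ps h) \<longleftrightarrow> ((\<forall>e\<in>set ps. \<sigma> (nval x \<rho> e)) \<longrightarrow> \<sigma> (nval x \<rho> h))"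
  by (auto simp: Horn_def csat_simps)

definition CAll :: "'a list \<Rightarrow> ('a \<Rightarrow> cexp) \<Rightarrow> cexp" where
  "CAll is f = foldr (\<lambda>i c. CCat (f i) c) is CNone"

lemma csat_CAll: "csat \<sigma> x \<rho> (CAll is f) \<longleftrightarrow> (\<forall>i\<in>set is. csat \<sigma> x \<rho> (f i))"
  unfolding CAll_def by (induction "is") (auto simp: csat_simps)


section \<open>The Cook--Levin theorem\<close>

definition Pair_n :: "nexp \<Rightarrow> nexp \<Rightarrow> nexp" where
  "Pair_n a b = Add (Sum 9 (Add a b) (Add (Var 9) (Num 1))) a"

lemma triangle_eq_sum: "triangle n = (\<Sum>k<n. k + 1)"
  by (induction n) simp_all

lemma nval_Pair_n [simp]: "nval x \<rho> (Pair_n a b) = prod_encode (nval x \<rho> a, nval x \<rho> b)"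
  by (simp add: Pair_n_def prod_encode_def triangle_eq_sum)

definition fact_var :: "kind \<Rightarrow> nat \<Rightarrow> nat \<Rightarrow> nat" where
  "fact_var \<kappa> t p = prod_encode (to_nat \<kappa>, prod_encode (t, p))"

definition Fact :: "kind \<Rightarrow> nexp \<Rightarrow> nexp \<Rightarrow> nexp" where
  "Fact \<kappa> t p = Pair_n (Num (to_nat \<kappa>)) (Pair_n t p)"

lemma nval_Fact [simp]: "nval x \<rho> (Fact \<kappa> t p) = fact_var \<kappa> (nval x \<rho> t) (nval x \<rho> p)"
  by (simp add: Fact_def fact_var_def)

lemma surj_fact_assignments: "\<exists>\<sigma>. \<forall>\<kappa> t p. \<sigma> (fact_var \<kappa> t p) = \<Phi> \<kappa> t p"
proof (intro exI allI)
  fix \<kappa> t p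
  show "(\<lambda>v. case prod_decode v of (i, tp) \<Rightarrow> case prod_decode tp of (t, p) \<Rightarrow> \<Phi> (from_nat i) t p)
      (fact_var \<kappa> t p) = \<Phi> \<kappa> t p"
    by (simp add: fact_var_def)
qed

locale tableau_formula =
  fixes M :: tm and Te Ye :: nexp and T Y :: "nat \<Rightarrow> nat"
  assumes Te: "\<And>x \<rho>. nval x \<rho> Te = T (\<rho> 0)" and Ye: "\<And>x \<rho>. nval x \<rho> Ye = Y (\<rho> 0)"
begin

abbreviation Width :: nexp where "Width \<equiv> Add (Add Te Te) (Num 1)"

text \<open>Variables 1, 2 and 3 hold the time and two positions.\<close>
abbreviation Now :: nexp where "Now \<equiv> Var 1"
abbreviation Next :: nexp where "Next \<equiv> Add (Var 1) (Num 1)"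

abbreviation Initially :: "kind \<Rightarrow> nexp \<Rightarrow> cexp" where
  "Initially \<kappa> p \<equiv> Horn [] (Fact \<kappa> (Num 0) p)"

abbreviation Certificate_pos :: nexp where
  "Certificate_pos \<equiv> Add (Add (Add Te (Var 0)) (Num 1)) (Var 2)"

definition Start :: cexp where
  "Start = CAll [
     Initially (KState (tm_start M)) (Num 0),
     CAll [0..<tm_tapes M] (\<lambda>j. Initially (KHead j) Te),
     CAll [0..<tm_tapes M] (\<lambda>j. CIf (Num j) (CFor 2 Width (Initially (KCell j 0) (Var 2)))),
     CFor 2 Te (Initially (KCell 0 0) (Var 2)),
     CAll [0..<3] (\<lambda>a. CFor 2 (Var 0)
       (CIf (Eq_n (Cell (Var 2)) (Num a)) (Initially (KCell 0 a) (Add Te (Var 2))))),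
     Initially (KCell 0 3) (Add Te (Var 0)),
     CFor 2 Ye (Clause (map (\<lambda>a. (Fact (KCell 0 a) (Num 0) Certificate_pos, True)) [0, 1, 2])),
     CFor 2 Ye (Horn [Fact (KCell 0 0) (Num 0) Certificate_pos]
       (Fact (KCell 0 0) (Num 0) (Add Certificate_pos (Num 1)))),
     CFor 2 Te (Initially (KCell 0 0) (Add (Add (Add (Add Te (Var 0)) (Num 1)) Ye) (Var 2)))]
     (\<lambda>c. c)"

definition Apply_transition :: "nat \<Rightarrow> nat list \<Rightarrow> cexp" where
  "Apply_transition q rs = CAll [
     Horn (Fact (KState q) Now (Num 0) #
         map (\<lambda>j. Fact (KRead j (rs ! j)) Now (Num 0)) [0..<tm_tapes M])
       (Fact (KStep q rs) Now (Num 0)),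
     Horn [Fact (KStep q rs) Now (Num 0)] (Fact (KState (fst (tm_action M q rs))) Next (Num 0)),
     CAll [0..<tm_tapes M] (\<lambda>j. CFor 2 Width
       (Horn [Fact (KStep q rs) Now (Num 0),
           Fact (KHead j) Now (Add (Var 2) (Num (departure (snd (snd (tm_action M q rs) ! j)))))]
         (Fact (KHead j) Next (Add (Var 2) (Num (arrival (snd (snd (tm_action M q rs) ! j)))))))),
     CAll [0..<tm_tapes M] (\<lambda>j. CFor 2 Width
       (Horn [Fact (KStep q rs) Now (Num 0), Fact (KHead j) Now (Var 2)]
         (Fact (KCell j (fst (snd (tm_action M q rs) ! j))) Next (Var 2))))]
     (\<lambda>c. c)"

definition Steps :: cexp where
  "Steps = CFor 1 Te (CAll [
     CAll [0..<tm_tapes M] (\<lambda>j. CAll [0..<tm_symbols M] (\<lambda>a. CFor 2 Width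
       (Horn [Fact (KHead j) Now (Var 2), Fact (KCell j a) Now (Var 2)]
         (Fact (KRead j a) Now (Num 0))))),
     CAll [0..<tm_states M] (\<lambda>q. CAll (readings M) (Apply_transition q)),
     CAll [0..<tm_tapes M] (\<lambda>j. CAll [0..<tm_symbols M] (\<lambda>a. CFor 2 Width (CFor 3 Width
       (CIf (Not_n (Eq_n (Var 2) (Var 3)))
         (Horn [Fact (KCell j a) Now (Var 2), Fact (KHead j) Now (Var 3)]
           (Fact (KCell j a) Next (Var 2)))))))]
     (\<lambda>c. c))"

definition Accepting :: cexp where
  "Accepting = CAll [0..<tm_states M] (\<lambda>q. CIf (Not_n (Eq_n (Num q) (Num (tm_accept M))))
     (Clause [(Fact (KState q) Te (Num 0), False)]))"

definition Formula :: cexp where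
  "Formula = CCat Start (CCat Steps Accepting)"

lemma csat_Start:
  assumes "\<rho> 0 = length x"
  shows "csat \<sigma> x \<rho> Start \<longleftrightarrow>
    tableau_start M x (Y (length x)) (T (length x)) (\<lambda>\<kappa> t p. \<sigma> (fact_var \<kappa> t p))"
  unfolding Start_def tableau_start_def using assms
  by (simp add: csat_CAll csat_simps csat_Horn ball_upt Te Ye mult_2 del: neq0_conv)

lemma csat_Steps:
  assumes "\<rho> 0 = length x"
  shows "csat \<sigma> x \<rho> Steps \<longleftrightarrow>
    tableau_steps M (T (length x)) (\<lambda>\<kappa> t p. \<sigma> (fact_var \<kappa> t p))"
  unfolding Steps_def Apply_transition_def tableau_steps_def using assms
  by (simp add: csat_CAll csat_simps csat_Horn ball_upt Te mult_2 Ball_def[of "set (readings M)"]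
      imp_conjL imp_conjR all_conj_distrib del: neq0_conv)

lemma csat_Formula:
  assumes "\<rho> 0 = length x"
  shows "csat \<sigma> x \<rho> Formula \<longleftrightarrow>
    tableau M x (Y (length x)) (T (length x)) (\<lambda>\<kappa> t p. \<sigma> (fact_var \<kappa> t p))"
  unfolding Formula_def Accepting_def tableau_def tableau_axioms_def csat_simps
  using assms
  by (simp add: csat_Start csat_Steps csat_CAll csat_simps ball_upt Te del: neq0_conv)

lemma csat_Formula_iff:
  assumes wf_M: "wf_tm M" and "\<rho> 0 = length x"
  shows "(\<exists>\<sigma>. csat \<sigma> x \<rho> Formula) \<longleftrightarrow>
    (\<exists>y. length y \<le> Y (length x) \<and> fst (tm_run M (pair_word x y) (T (length x))) = tm_accept M)"
  unfolding csat_Formula[where \<rho> = \<rho>, OF assms(2)]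
proof
  assume "\<exists>\<sigma>. tableau M x (Y (length x)) (T (length x)) (\<lambda>\<kappa> t p. \<sigma> (fact_var \<kappa> t p))"
  then show "\<exists>y. length y \<le> Y (length x) \<and> fst (tm_run M (pair_word x y) (T (length x))) = tm_accept M"
    using tableau_sound[OF wf_M] by blast
next
  assume "\<exists>y. length y \<le> Y (length x) \<and> fst (tm_run M (pair_word x y) (T (length x))) = tm_accept M"
  then obtain y where accepted: "length y \<le> Y (length x)"
    "fst (tm_run M (pair_word x y) (T (length x))) = tm_accept M" by blast
  obtain \<sigma> where "\<And>\<kappa> t p. \<sigma> (fact_var \<kappa> t p) = run_facts M (pair_word x y) (T (length x)) \<kappa> t p"
    using surj_fact_assignments by metis
  then show "\<exists>\<sigma>. tableau M x (Y (length x)) (T (length x)) (\<lambda>\<kappa> t p. \<sigma> (fact_var \<kappa> t p))"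
    using tableau_run_facts[OF wf_M accepted] by (intro exI[of _ \<sigma>]) simp
qed

end

theorem Cook_Levin: "NP_hard encode_cnf wf_cnf satisfiable"
  unfolding NP_hard_def
proof
  fix L assume "L \<in> NP"
  then obtain M and p q :: "nat poly" where wf_M: "wf_tm M"
    and halt: "\<And>x y. halted M (tm_run M (pair_word x y) (poly p (length x + length y)))"
    and in_L_iff: "\<And>x. x \<in> L \<longleftrightarrow> (\<exists>y. length y \<le> poly q (length x) \<and>
      fst (tm_run M (pair_word x y) (poly p (length x + length y))) = tm_accept M)"
    unfolding NP_def mem_Collect_eq by (elim exE conjE) blast
  define r where "r = pcompose p ([:0, 1:] + q)"
  have poly_r: "poly r n = poly p (n + poly q n)" for n by (simp add: r_def poly_pcompose)
  obtain Te Ye where "\<And>x \<rho>. nval x \<rho> Te = poly r (\<rho> 0)" "\<And>x \<rho>. nval x \<rho> Ye = poly q (\<rho> 0)"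
    using poly_expressible by metis
  then interpret tableau_formula M Te Ye "poly r" "poly q" by unfold_locales
  obtain n where formula:
    "poly_time_computable (\<lambda>x. encode_cnf (n x, cval x ((\<lambda>_. 0)(0 := length x)) Formula))"
    "\<And>x. (n x, cval x ((\<lambda>_. 0)(0 := length x)) Formula) \<in> wf_cnf"
    using cexp_cnf_computable[of Formula] by blast
  have "satisfiable (n x, cval x ((\<lambda>_. 0)(0 := length x)) Formula) \<longleftrightarrow> x \<in> L" for x
  proof -
    have "tm_run M (pair_word x y) (poly r (length x)) =
        tm_run M (pair_word x y) (poly p (length x + length y))"
      if "length y \<le> poly q (length x)" for y
      using that by (intro tm_run_halted_le[OF halt]) (simp add: poly_r poly_nat_mono)
    then show ?thesis
      unfolding satisfiable_cval in_L_iff by (simp add: csat_Formula_iff[OF wf_M] cong: conj_cong)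
  qed
  with formula show "\<exists>f. poly_time_computable f \<and>
      (\<forall>x. \<exists>\<phi>\<in>wf_cnf. f x = encode_cnf \<phi> \<and> (x \<in> L \<longleftrightarrow> satisfiable \<phi>))"
    by blast
qed


section \<open>Hardness of coloring\<close>

lemma length_encode_clause_le:
  assumes "length C \<le> 3" "fst ` set C \<subseteq> {..<n}"
  shows "length (encode_clause C) \<le> 3 * (n + 3) + 1"
proof -
  have "length (encode_literal l) \<le> n + 3" if "l \<in> set C" for l
    using assms(2) that by (cases l) force
  then have "sum_list (map (\<lambda>l. length (encode_literal l)) C) \<le> sum_list (map (\<lambda>_. n + 3) C)"
    by (rule sum_list_mono)
  also have "\<dots> \<le> 3 * (n + 3)" using assms(1) by (simp only: sum_list_triv of_nat_id mult_le_mono1)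
  finally show ?thesis by (simp add: encode_clause_def length_concat comp_def)
qed

lemma length_encode_cnf_le:
  assumes "\<phi> \<in> three_cnf"
  shows "length (encode_cnf \<phi>) \<le> cnf_size \<phi> + 1 + cnf_size \<phi> * (3 * (cnf_size \<phi> + 3) + 1)"
proof -
  obtain n cs where phi_eq: "\<phi> = (n, cs)" by (cases \<phi>)
  let ?s = "cnf_size \<phi>"
  have sizes: "n \<le> ?s" "length cs \<le> ?s" by (simp_all add: phi_eq cnf_size_def)
  have "length (encode_clause C) \<le> 3 * (?s + 3) + 1" if "C \<in> set cs" for C
  proof (rule length_encode_clause_le)
    have clause: "length C \<le> 3" "fst ` set C \<subseteq> {..<n}"
      using assms that by (auto simp: phi_eq three_cnf_def)
    show "length C \<le> 3" by (rule clause(1))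
    show "fst ` set C \<subseteq> {..<?s}" using clause(2) sizes(1) by (meson lessThan_subset_iff order_trans)
  qed
  then have "sum_list (map (\<lambda>C. length (encode_clause C)) cs) \<le>
      sum_list (map (\<lambda>_. 3 * (?s + 3) + 1) cs)"
    by (rule sum_list_mono)
  also have "\<dots> \<le> ?s * (3 * (?s + 3) + 1)"
    using sizes(2) by (simp only: sum_list_triv of_nat_id mult_le_mono1)
  finally show ?thesis using sizes(1) by (simp add: phi_eq length_concat comp_def)
qed

lemma gadget_reduction:
  assumes "k \<ge> 2" "\<phi> \<in> wf_cnf"
  shows "gadget_digraph k \<phi> \<in> digraphs_with_fvs k \<and>
    word_fun (Gadget_word k) (encode_cnf \<phi>) = encode_digraph (gadget_digraph k \<phi>) \<and>
    (k_colorable k (with_proj (gadget_digraph k \<phi>)) \<longleftrightarrow> satisfiable \<phi>)"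
  using assms by (simp add: gadget_digraph_fvs word_fun_Gadget_word k_colorable_gadget_digraph)

theorem theorem4:
  fixes k :: nat
  assumes "k \<ge> 2"
  shows "NP_hard encode_digraph (digraphs_with_fvs k) (\<lambda>D. k_colorable k (with_proj D)) \<and>
    (ETH \<longrightarrow>
      \<not> solvable_subexp encode_digraph (digraphs_with_fvs k)
          (\<lambda>D. k_colorable k (with_proj D)) (\<lambda>D. card (pverts D)))"
proof (intro conjI impI notI)
  show "NP_hard encode_digraph (digraphs_with_fvs k) (\<lambda>D. k_colorable k (with_proj D))"
    by (rule NP_hard_reduction[OF Cook_Levin poly_time_computable_word_fun gadget_reduction[OF assms]])
next
  assume ETH and solvable: "solvable_subexp encode_digraph (digraphs_with_fvs k)
    (\<lambda>D. k_colorable k (with_proj D)) (\<lambda>D. card (pverts D))"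
  have "solvable_subexp encode_cnf three_cnf satisfiable cnf_size"
  proof (rule solvable_subexp_reduction[OF solvable poly_time_computable_word_fun])
    fix \<phi> assume phi_in: "\<phi> \<in> three_cnf"
    show "gadget_digraph k \<phi> \<in> digraphs_with_fvs k \<and>
        word_fun (Gadget_word k) (encode_cnf \<phi>) = encode_digraph (gadget_digraph k \<phi>) \<and>
        (k_colorable k (with_proj (gadget_digraph k \<phi>)) \<longleftrightarrow> satisfiable \<phi>)"
      using assms phi_in three_cnf_subset_wf_cnf by (intro gadget_reduction) auto
    show "card (pverts (gadget_digraph k \<phi>)) \<le> k + 4 * cnf_size \<phi>"
      by (rule card_gadget_digraph_le[OF phi_in])
    show "length (encode_cnf \<phi>) \<le> cnf_size \<phi> + 1 + cnf_size \<phi> * (3 * (cnf_size \<phi> + 3) + 1)"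
      by (rule length_encode_cnf_le[OF phi_in])
  qed (intro poly_bounded_intros)
  with \<open>ETH\<close> show False by (simp add: ETH_def)
qed

end
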